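(* In the setting described in the context, suppose that every $A_w$ is Fredholm, every $\mathcal B_w$ is Fredholm, and that either every operator $A_w$, $w\in W$, has compact resolvent, or every relation $\mathcal B_w$, $w\in W$, has compact resolvent. Then $A'_w$, $w\in W$, is a continuous family of self-adjoint Fredholm operators and $$\operatorname{a\text{-}ind}(A'_\bullet)=\operatorname{a\text{-}ind}(A_\bullet)+\operatorname{a\text{-}ind}(\mathcal B_\bullet)\quad\text{in }K^1(W).$$
   Context: Let $W$ be a compactly generated paracompact space and $H$ a separable Hilbert space. For a self-adjoint operator or self-adjoint closed relation $\mathcal B$ in a Hilbert space, its Cayley transform $U(\mathcal B)$ is the unitary operator with graph $\{(b+ia,\ b-ia):(a,b)\in\mathcal B\}$ (for an operator, $U(B)=(B-i)(B+i)^{-1}$). A family of self-adjoint operators is continuous (in the uniform resolvent topology) iff the Cayley transforms depend norm-continuously on the parameter. A self-adjoint relation is Fredholm iff $-1$ is not in the essential spectrum of its Cayley transform; it has compact resolvent iff $U(\mathcal B)-1$ is compact. If $U$ is a unitary operator on a closed subspace $\mathcal K\subset H$, $U_H$ denotes the operator on $H$ equal to $U$ on $\mathcal K$ and to the identity on $\mathcal K^\perp$. For a continuous family of self-adjoint Fredholm operators or relations, its analytical index $\operatorname{a\text{-}ind}\in K^1(W)$ is the homotopy class of the family of (extended) Cayley transforms as a map into the space $U^{\mathrm{Fred}}$ of unitary operators on $H$ whose essential spectrum does not contain $-1$ (a classifying space for $K^1$). Data: $T_w$, $w\in W$, closed densely defined symmetric operators in $H$; $A_w$ self-adjoint with $T_w\subset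 A_w\subset T_w^*$, continuous in the uniform resolvent topology. Put $\mathcal K_{w+}=\operatorname{Ker}(T_w^*-i)$, $\mathcal K_{w-}=\operatorname{Ker}(T_w^*+i)$, and let $V_w:\mathcal K_{w+}\to\mathcal K_{w-}$ be the restriction of $U(A_w)$ (it is the von Neumann isometry with $\mathcal D(A_w)=\{x+y-V_wy: x\in\mathcal D(T_w),y\in\mathcal K_{w+}\}$). Every $z\in\mathcal D(T_w^* )$ is uniquely $z=z_T+z_++z_-$ with $z_T\in\mathcal D(T_w)$, $z_\pm\in\mathcal K_{w\pm}$; set $\Gamma_{w0}z=z_-+V_wz_+$ and $\Gamma_{w1}z=-iz_-+iV_wz_+$. Assume $\mathcal K_{w-}$ is a norm-continuous family of closed subspaces of $H$. Let $\mathcal B_w\subset\mathcal K_{w-}\oplus\mathcal K_{w-}$ be self-adjoint closed relations such that $U(\mathcal B_w)_H$ depends norm-continuously on $w$. Let $A'_w$ be the restriction of $T_w^*$ to $\{z\in\mathcal D(T_w^* ):(\Gamma_{w0}z,\Gamma_{w1}z)\in\mathcal B_w\}$. *)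

theory Defs
  imports "HOL-Analysis.Analysis"
begin

class chilbert = banach +
  fixes scaleC :: "complex \<Rightarrow> 'a \<Rightarrow> 'a"
  fixes cinner :: "'a \<Rightarrow> 'a \<Rightarrow> complex"
  assumes scaleC_add_right: "scaleC a (x + y) = scaleC a x + scaleC a y"
    and scaleC_add_left: "scaleC (a + b) x = scaleC a x + scaleC b x"
    and scaleC_scaleC: "scaleC a (scaleC b x) = scaleC (a * b) x"
    and scaleC_one: "scaleC 1 x = x"
    and scaleC_of_real: "scaleC (complex_of_real r) x = scaleR r x"
    and cinner_add_right: "cinner x (y + z) = cinner x y + cinner x z"
    and cinner_scaleC_right: "cinner x (scaleC a y) = a * cinner x y"
    and cinner_commute: "cinner y x = cnj (cinner x y)"
    and cinner_nonneg: "0 \<le> Re (cinner x x)"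
    and cinner_eq_zero_iff: "cinner x x = 0 \<longleftrightarrow> x = 0"
    and norm_cinner: "norm x = sqrt (Re (cinner x x))"

definition separable_hilbert :: "'h::chilbert itself \<Rightarrow> bool" where
  "separable_hilbert _ \<longleftrightarrow> (\<exists>D::'h set. countable D \<and> closure D = UNIV)"

definition csubspace :: "'h::chilbert set \<Rightarrow> bool" where
  "csubspace S \<longleftrightarrow> 0 \<in> S \<and> (\<forall>x\<in>S. \<forall>y\<in>S. x + y \<in> S) \<and> (\<forall>c. \<forall>x\<in>S. scaleC c x \<in> S)"

definition closed_csubspace :: "'h::chilbert set \<Rightarrow> bool" where
  "closed_csubspace S \<longleftrightarrow> csubspace S \<and> closed S"

definition orth :: "'h::chilbert set \<Rightarrow> 'h set" where
  "orth S = {y. \<forall>x\<in>S. cinner x y = 0}"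

definition proj :: "'h::chilbert set \<Rightarrow> 'h \<Rightarrow> 'h" where
  "proj K x = (THE p. p \<in> K \<and> x - p \<in> orth K)"

definition fin_dim :: "'h::chilbert set \<Rightarrow> bool" where
  "fin_dim S \<longleftrightarrow> (\<exists>F. finite F \<and> S \<subseteq> {\<Sum>v\<in>F. scaleC (c v) v | c. True})"

definition cbounded :: "('h::chilbert \<Rightarrow> 'h) \<Rightarrow> bool" where
  "cbounded L \<longleftrightarrow> bounded_linear L \<and> (\<forall>c x. L (scaleC c x) = scaleC c (L x))"

definition unitary :: "('h::chilbert \<Rightarrow> 'h) \<Rightarrow> bool" where
  "unitary U \<longleftrightarrow> cbounded U \<and> bij U \<and> (\<forall>x y. cinner (U x) (U y) = cinner x y)"

definition cfredholm :: "('h::chilbert \<Rightarrow> 'h) \<Rightarrow> bool" where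
  "cfredholm L \<longleftrightarrow> cbounded L \<and> fin_dim {x. L x = 0} \<and> closed (range L)
      \<and> fin_dim (orth (range L))"

definition ess_spec :: "('h::chilbert \<Rightarrow> 'h) \<Rightarrow> complex set" where
  "ess_spec L = {c. \<not> cfredholm (\<lambda>x. L x - scaleC c x)}"

definition compact_op :: "('h::chilbert \<Rightarrow> 'h) \<Rightarrow> bool" where
  "compact_op L \<longleftrightarrow> cbounded L \<and> compact (closure (L ` ball 0 1))"

definition Ufred :: "('h::chilbert \<Rightarrow> 'h) \<Rightarrow> bool" where
  "Ufred U \<longleftrightarrow> unitary U \<and> - 1 \<notin> ess_spec U"

definition norm_cont :: "'w topology \<Rightarrow> ('w \<Rightarrow> 'h::chilbert \<Rightarrow> 'h) \<Rightarrow> bool" where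
  "norm_cont X F \<longleftrightarrow> (\<forall>w\<in>topspace X. \<forall>e>0. \<exists>N. openin X N \<and> w \<in> N \<and>
      (\<forall>v\<in>N. onorm (\<lambda>x. F v x - F w x) < e))"

definition linrel :: "('h::chilbert \<times> 'h) set \<Rightarrow> bool" where
  "linrel R \<longleftrightarrow> (0,0) \<in> R \<and> (\<forall>(a,b)\<in>R. \<forall>(c,d)\<in>R. (a+c, b+d) \<in> R)
     \<and> (\<forall>k. \<forall>(a,b)\<in>R. (scaleC k a, scaleC k b) \<in> R)"

definition is_op :: "('h \<times> 'h) set \<Rightarrow> bool" where
  "is_op R \<longleftrightarrow> (\<forall>x y z. (x,y) \<in> R \<longrightarrow> (x,z) \<in> R \<longrightarrow> y = z)"

definition adjK :: "'h::chilbert set \<Rightarrow> ('h \<times> 'h) set \<Rightarrow> ('h \<times> 'h) set" where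
  "adjK K R = {(y,z). y \<in> K \<and> z \<in> K \<and> (\<forall>(x,u)\<in>R. cinner u y = cinner x z)}"

abbreviation adj :: "('h::chilbert \<times> 'h) set \<Rightarrow> ('h \<times> 'h) set" where
  "adj R \<equiv> adjK UNIV R"

definition selfadjK :: "'h::chilbert set \<Rightarrow> ('h \<times> 'h) set \<Rightarrow> bool" where
  "selfadjK K R \<longleftrightarrow> R \<subseteq> K \<times> K \<and> adjK K R = R"

definition closed_dd_symmetric :: "('h::chilbert \<times> 'h) set \<Rightarrow> bool" where
  "closed_dd_symmetric T \<longleftrightarrow> linrel T \<and> is_op T \<and> closed T
     \<and> closure (Domain T) = UNIV \<and> T \<subseteq> adj T"

definition cayley_graph :: "('h::chilbert \<times> 'h) set \<Rightarrow> ('h \<times> 'h) set" where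
  "cayley_graph R = {(b + scaleC \<i> a, b - scaleC \<i> a) | a b. (a,b) \<in> R}"

definition cay :: "('h::chilbert \<times> 'h) set \<Rightarrow> 'h \<Rightarrow> 'h" where
  "cay R x = (THE y. (x,y) \<in> cayley_graph R)"

definition cayH :: "'h::chilbert set \<Rightarrow> ('h \<times> 'h) set \<Rightarrow> 'h \<Rightarrow> 'h" where
  "cayH K R x = cay R (proj K x) + (x - proj K x)"

definition fredK :: "'h::chilbert set \<Rightarrow> ('h \<times> 'h) set \<Rightarrow> bool" where
  "fredK K R \<longleftrightarrow> - 1 \<notin> ess_spec (cayH K R)"

definition compact_resolventK :: "'h::chilbert set \<Rightarrow> ('h \<times> 'h) set \<Rightarrow> bool" where
  "compact_resolventK K R \<longleftrightarrow> compact_op (\<lambda>x. cayH K R x - x)"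

definition Kplus :: "('h::chilbert \<times> 'h) set \<Rightarrow> 'h set" where
  "Kplus T = {z. (z, scaleC \<i> z) \<in> adj T}"

definition Kminus :: "('h::chilbert \<times> 'h) set \<Rightarrow> 'h set" where
  "Kminus T = {z. (z, scaleC (- \<i>) z) \<in> adj T}"

text \<open>von Neumann decomposition z = z_T + z_+ + z_- of z in D(T^*).\<close>
definition vn_dec :: "('h::chilbert \<times> 'h) set \<Rightarrow> 'h \<Rightarrow> 'h \<times> 'h \<times> 'h" where
  "vn_dec T z = (THE (a,b,c). a \<in> Domain T \<and> b \<in> Kplus T \<and> c \<in> Kminus T \<and> z = a + b + c)"

definition Gamma0 :: "('h::chilbert \<times> 'h) set \<Rightarrow> ('h \<times> 'h) set \<Rightarrow> 'h \<Rightarrow> 'h" where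
  "Gamma0 T A z = (case vn_dec T z of (zT, zp, zm) \<Rightarrow> zm + cay A zp)"

definition Gamma1 :: "('h::chilbert \<times> 'h) set \<Rightarrow> ('h \<times> 'h) set \<Rightarrow> 'h \<Rightarrow> 'h" where
  "Gamma1 T A z = (case vn_dec T z of (zT, zp, zm) \<Rightarrow> scaleC (- \<i>) zm + scaleC \<i> (cay A zp))"

definition Aprime :: "('h::chilbert \<times> 'h) set \<Rightarrow> ('h \<times> 'h) set \<Rightarrow> ('h \<times> 'h) set \<Rightarrow> ('h \<times> 'h) set" where
  "Aprime T A B = {(z,u) \<in> adj T. (Gamma0 T A z, Gamma1 T A z) \<in> B}"

definition paracompact_space :: "'w topology \<Rightarrow> bool" where
  "paracompact_space X \<longleftrightarrow> Hausdorff_space X \<and>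
    (\<forall>\<U>. (\<forall>U\<in>\<U>. openin X U) \<and> topspace X \<subseteq> \<Union>\<U> \<longrightarrow>
      (\<exists>\<V>. (\<forall>V\<in>\<V>. openin X V) \<and> topspace X \<subseteq> \<Union>\<V> \<and> (\<forall>V\<in>\<V>. \<exists>U\<in>\<U>. V \<subseteq> U) \<and>
           (\<forall>x\<in>topspace X. \<exists>N. openin X N \<and> x \<in> N \<and> finite {V\<in>\<V>. V \<inter> N \<noteq> {}})))"

definition ufred_homotopic :: "'w topology \<Rightarrow> ('w \<Rightarrow> 'h::chilbert \<Rightarrow> 'h) \<Rightarrow> ('w \<Rightarrow> 'h \<Rightarrow> 'h) \<Rightarrow> bool" where
  "ufred_homotopic X f g \<longleftrightarrow> (\<exists>h :: real \<times> 'w \<Rightarrow> 'h \<Rightarrow> 'h.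
      norm_cont (prod_topology (top_of_set {0..1}) X) h \<and>
      (\<forall>t\<in>{0..1}. \<forall>w\<in>topspace X. Ufred (h (t,w))) \<and>
      (\<forall>w\<in>topspace X. h (0,w) = f w \<and> h (1,w) = g w))"

text \<open>A unitary identification H = H (+) H, used to define the group structure of K^1(W)
  (direct sum of unitaries).\<close>
definition hsplit :: "('h::chilbert \<Rightarrow> 'h \<times> 'h) \<Rightarrow> bool" where
  "hsplit \<Phi> \<longleftrightarrow> bij \<Phi> \<and> (\<forall>x y. \<Phi> (x + y) = \<Phi> x + \<Phi> y) \<and>
     (\<forall>c x. \<Phi> (scaleC c x) = (scaleC c (fst (\<Phi> x)), scaleC c (snd (\<Phi> x)))) \<and>
     (\<forall>x y. cinner x y = cinner (fst (\<Phi> x)) (fst (\<Phi> y)) + cinner (snd (\<Phi> x)) (snd (\<Phi> y)))"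

definition dsum :: "('h::chilbert \<Rightarrow> 'h \<times> 'h) \<Rightarrow> ('h \<Rightarrow> 'h) \<Rightarrow> ('h \<Rightarrow> 'h) \<Rightarrow> 'h \<Rightarrow> 'h" where
  "dsum \<Phi> U1 U2 x = inv \<Phi> (U1 (fst (\<Phi> x)), U2 (snd (\<Phi> x)))"

end

theory Submission
  imports Defs
begin

text \<open>By von Neumann's parametrisation the Cayley transform of \<open>A'\<close> is the product \<open>P Q\<close> with
  \<open>P = U(B)\<^sub>H\<close> and \<open>Q = U(A)\<close>, which reduces everything to a statement about families of unitaries.

  For a unitary \<open>U\<close>, \<open>-1\<close> is not in the essential spectrum iff \<open>U + 1\<close> is proper on bounded sets
  (bounded sequences with convergent images have convergent subsequences), a condition visibly stable
  under compact perturbations.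

  The homotopy comes from symplectic reduction. If \<open>U\<close> is the Cayley transform of a relation \<open>L\<close> with
  \<open>U + 1\<close> proper and \<open>g\<close> is bounded and injective, then \<open>{(g x, y). (x, g\<^sup>* y) \<in> L}\<close> is again self-adjoint
  and its Cayley transform \<open>V(U, g)\<close> depends norm-continuously on \<open>U\<close> and \<open>g\<close> and keeps \<open>V + 1\<close> proper.
  Here \<open>V(U, 1) = U\<close>, while for an isometry \<open>S\<close> and a phase \<open>\<omega>\<close>, \<open>V(U, \<omega> S) = 1 + S (U - 1) S\<^sup>*\<close> is \<open>U\<close>
  transported to the range of \<open>S\<close> and extended by the identity. The segment \<open>(1 - t) + t \<omega> S\<close> consists of
  injective operators as soon as \<open>-1\<close> is not an eigenvalue of \<open>\<omega> S\<close>; since \<open>H\<close> is separable, \<open>S\<close> has only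
  countably many eigenvalues, so such an \<open>\<omega>\<close> exists. Applying this to \<open>Q\<close> with \<open>S\<^sub>1\<close> and to \<open>P\<close> with \<open>S\<^sub>2\<close>,
  where \<open>S\<^sub>1, S\<^sub>2\<close> are the two isometries of a splitting \<open>H = H \<oplus> H\<close>, deforms \<open>P Q\<close> into \<open>Q \<oplus> P\<close>.\<close>

subsection \<open>Complex Hilbert spaces\<close>

lemma cinner_add_left: "cinner (x + y) (z::'h::chilbert) = cinner x z + cinner y z"
  by (metis cinner_add_right cinner_commute complex_cnj_add)

lemma cinner_scaleC_left: "cinner (scaleC a x) (y::'h::chilbert) = cnj a * cinner x y"
  by (metis cinner_scaleC_right cinner_commute complex_cnj_mult)

lemma cinner_zero_right [simp]: "cinner (x::'h::chilbert) 0 = 0"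
  using cinner_add_right[of x 0 0] by simp

lemma cinner_zero_left [simp]: "cinner 0 (x::'h::chilbert) = 0"
  using cinner_add_left[of 0 0 x] by simp

lemma cinner_minus_right: "cinner (x::'h::chilbert) (- y) = - cinner x y"
  using cinner_add_right[of x y "- y"] by (simp add: eq_neg_iff_add_eq_0 add.commute)

lemma cinner_minus_left: "cinner (- x) (y::'h::chilbert) = - cinner x y"
  using cinner_add_left[of x "- x" y] by (simp add: eq_neg_iff_add_eq_0 add.commute)

lemma cinner_diff_right: "cinner (x::'h::chilbert) (y - z) = cinner x y - cinner x z"
  using cinner_add_right[of x y "- z"] by (simp add: cinner_minus_right)

lemma cinner_diff_left: "cinner (x - y) (z::'h::chilbert) = cinner x z - cinner y z"
  using cinner_add_left[of x "- y" z] by (simp add: cinner_minus_left)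

lemma cinner_scaleR_right: "cinner (x::'h::chilbert) (r *\<^sub>R y) = of_real r * cinner x y"
  by (metis cinner_scaleC_right scaleC_of_real)

lemma cinner_scaleR_left: "cinner (r *\<^sub>R (x::'h::chilbert)) y = of_real r * cinner x y"
  by (metis cinner_scaleC_left scaleC_of_real complex_cnj_complex_of_real)

lemmas cinner_simps = cinner_add_left cinner_add_right cinner_diff_left cinner_diff_right
  cinner_minus_left cinner_minus_right cinner_scaleC_left cinner_scaleC_right
  cinner_scaleR_left cinner_scaleR_right

lemma Re_cinner_commute: "Re (cinner x (y::'h::chilbert)) = Re (cinner y x)"
  by (subst cinner_commute) simp

lemma Re_cinner_self: "Re (cinner x (x::'h::chilbert)) = (norm x)\<^sup>2"
  by (simp add: norm_cinner cinner_nonneg)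

lemma cinner_self: "cinner x (x::'h::chilbert) = complex_of_real ((norm x)\<^sup>2)"
proof (rule complex_eqI)
  show "Im (cinner x x) = Im (complex_of_real ((norm x)\<^sup>2))"
    using cinner_commute[of x x] by (metis Im_complex_of_real Reals_cnj_iff complex_is_Real_iff)
qed (simp add: Re_cinner_self)

lemma norm_add_sq: "(norm (x + y))\<^sup>2 = (norm x)\<^sup>2 + 2 * Re (cinner x (y::'h::chilbert)) + (norm y)\<^sup>2"
  using Re_cinner_commute[of x y] by (simp add: Re_cinner_self[symmetric] cinner_simps)

lemma norm_diff_sq: "(norm (x - y))\<^sup>2 = (norm x)\<^sup>2 - 2 * Re (cinner x (y::'h::chilbert)) + (norm y)\<^sup>2"
  using Re_cinner_commute[of x y] by (simp add: Re_cinner_self[symmetric] cinner_simps)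

lemma norm_scaleC: "norm (scaleC a (x::'h::chilbert)) = cmod a * norm x"
proof -
  have "cinner (scaleC a x) (scaleC a x) = (cnj a * a) * cinner x x"
    by (simp add: cinner_simps)
  also have "\<dots> = complex_of_real ((cmod a * norm x)\<^sup>2)"
    by (simp add: cinner_self mult.commute[of "cnj a"] complex_norm_square[symmetric] power_mult_distrib del: complex_norm_square)
  finally have "(norm (scaleC a x))\<^sup>2 = (cmod a * norm x)\<^sup>2"
    using cinner_self[of "scaleC a x"] by (metis of_real_eq_iff)
  then show ?thesis by (simp add: power2_eq_iff_nonneg)
qed

lemma Cauchy_Schwarz: "cmod (cinner x (y::'h::chilbert)) \<le> norm x * norm y"
proof (cases "x = 0")
  case False
  \<comment> \<open>\<open>scaleC c x\<close> is the orthogonal projection of \<open>y\<close> onto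
    the line through \<open>x\<close>; the inequality is the nonnegativity of the squared distance
    from \<open>y\<close> to it.\<close>
  define c where "c = cinner x y / cinner x x"
  have n0: "norm x > 0" using False by simp
  have cx: "c = cinner x y / of_real ((norm x)\<^sup>2)" by (simp add: c_def cinner_self)
  have "Re (cinner (scaleC c x) y) = (cmod (cinner x y))\<^sup>2 / (norm x)\<^sup>2"
    by (simp add: cinner_simps cx mult.commute[of "cnj _"] complex_norm_square[symmetric]
        flip: of_real_power of_real_divide)
  moreover have "cmod c = cmod (cinner x y) / (norm x)\<^sup>2"
    by (simp add: cx norm_divide norm_power)
  then have "(norm (scaleC c x))\<^sup>2 = (cmod (cinner x y))\<^sup>2 / (norm x)\<^sup>2"
    using n0 by (simp add: norm_scaleC power2_eq_square)
  ultimately have "(norm (scaleC c x - y))\<^sup>2 = (norm y)\<^sup>2 - (cmod (cinner x y))\<^sup>2 / (norm x)\<^sup>2"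
    by (simp add: norm_diff_sq)
  then have "(cmod (cinner x y))\<^sup>2 / (norm x)\<^sup>2 \<le> (norm y)\<^sup>2"
    by (metis diff_ge_0_iff_ge zero_le_power2)
  then have "(cmod (cinner x y))\<^sup>2 \<le> (norm x * norm y)\<^sup>2"
    using n0 by (simp add: pos_divide_le_eq power_mult_distrib mult.commute)
  then show ?thesis by (simp add: power2_le_iff_abs_le)
qed simp

lemma Re_cinner_le: "\<bar>Re (cinner x (y::'h::chilbert))\<bar> \<le> norm x * norm y"
  using Cauchy_Schwarz[of x y] abs_Re_le_cmod[of "cinner x y"] by linarith

lemma bounded_bilinear_cinner: "bounded_bilinear (cinner :: 'h::chilbert \<Rightarrow> _)"
proof
  show "\<exists>K. \<forall>a b::'h. norm (cinner a b) \<le> norm a * norm b * K"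
    using Cauchy_Schwarz by (metis mult.right_neutral)
qed (auto simp: cinner_simps scaleR_conv_of_real)

lemma bounded_linear_scaleC: "bounded_linear (scaleC c :: 'h::chilbert \<Rightarrow> 'h)"
proof
  show "scaleC c (r *\<^sub>R x) = r *\<^sub>R scaleC c x" for r and x :: 'h
    by (metis scaleC_of_real scaleC_scaleC mult.commute)
  show "\<exists>K. \<forall>x::'h. norm (scaleC c x) \<le> norm x * K"
    by (metis norm_scaleC mult.commute order_refl)
qed (simp add: scaleC_add_right)

lemma scaleC_zero_right [simp]: "scaleC c (0::'h::chilbert) = 0"
  using linear_0[OF bounded_linear.linear[OF bounded_linear_scaleC]] .

lemma scaleC_minus_right: "scaleC c (- x::'h::chilbert) = - scaleC c x"
  using linear_neg[OF bounded_linear.linear[OF bounded_linear_scaleC]] .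

lemma scaleC_diff_right: "scaleC c (x - y::'h::chilbert) = scaleC c x - scaleC c y"
  using linear_diff[OF bounded_linear.linear[OF bounded_linear_scaleC]] .

lemma scaleC_zero_left [simp]: "scaleC 0 (x::'h::chilbert) = 0"
  using scaleC_of_real[of 0 x] by simp

lemma scaleC_minus1 [simp]: "scaleC (- 1) (x::'h::chilbert) = - x"
  using scaleC_of_real[of "- 1" x] by simp

lemma scaleC_minus_left: "scaleC (- c) (x::'h::chilbert) = - scaleC c x"
  using scaleC_scaleC[of "- 1" c x] by simp

lemma scaleC_diff_left: "scaleC (a - b) (x::'h::chilbert) = scaleC a x - scaleC b x"
  using scaleC_add_left[of a "- b" x] by (simp add: scaleC_minus_left)

lemma scaleC_scaleR: "scaleC c (r *\<^sub>R x) = r *\<^sub>R scaleC c (x::'h::chilbert)"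
  by (metis scaleC_of_real scaleC_scaleC mult.commute)

declare scaleC_one [simp]

lemma scaleC_2: "scaleC 2 (x::'h::chilbert) = x + x"
  using scaleC_add_left[of 1 1 x] by simp

lemma scaleC_eq_0: "scaleC c (x::'h::chilbert) = 0 \<longleftrightarrow> c = 0 \<or> x = 0"
  by (metis norm_scaleC norm_eq_zero mult_eq_0_iff)

lemmas scaleC_simps = scaleC_add_left scaleC_add_right scaleC_diff_left scaleC_diff_right
  scaleC_minus_left scaleC_minus_right scaleC_scaleC

section \<open>Orthogonal complements and projections onto closed subspaces\<close>

lemma orth_csubspace: "closed_csubspace (orth (S::'h::chilbert set))"
proof -
  have "closed (orth S)"
    unfolding orth_def Collect_ball_eq
    by (intro closed_INT ballI closed_Collect_eq continuous_intros
        bounded_linear.continuous_on[OF bounded_bilinear.bounded_linear_right[OF bounded_bilinear_cinner]])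
  then show ?thesis
    unfolding closed_csubspace_def csubspace_def
    by (auto simp: orth_def cinner_simps)
qed

lemma orth_commute: "cinner x y = 0 \<longleftrightarrow> cinner y (x::'h::chilbert) = 0"
  by (metis cinner_commute complex_cnj_zero)

lemma csubspaceD:
  assumes "csubspace (S::'h::chilbert set)"
  shows "0 \<in> S" "x \<in> S \<Longrightarrow> y \<in> S \<Longrightarrow> x + y \<in> S" "x \<in> S \<Longrightarrow> scaleC c x \<in> S"
    "x \<in> S \<Longrightarrow> y \<in> S \<Longrightarrow> x - y \<in> S" "x \<in> S \<Longrightarrow> r *\<^sub>R x \<in> S" "x \<in> S \<Longrightarrow> - x \<in> S"
proof -
  show *: "0 \<in> S" "x \<in> S \<Longrightarrow> y \<in> S \<Longrightarrow> x + y \<in> S" "x \<in> S \<Longrightarrow> scaleC c x \<in> S" for x y c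
    using assms by (auto simp: csubspace_def)
  show m: "x \<in> S \<Longrightarrow> - x \<in> S" for x using *(3)[of x "- 1"] by simp
  show "x \<in> S \<Longrightarrow> y \<in> S \<Longrightarrow> x - y \<in> S" using *(2)[of x "- y"] m by simp
  show "x \<in> S \<Longrightarrow> r *\<^sub>R x \<in> S" using *(3)[of x "of_real r"] by (simp add: scaleC_of_real)
qed

text \<open>Best approximation: midpoints of a minimising sequence stay in \<open>K\<close>, so the
  parallelogram law makes the sequence Cauchy. Its limit \<open>q\<close> attains the infimum
  \<open>d\<close> of the squared distances, and varying \<open>q\<close> inside \<open>K\<close>
  gives orthogonality.\<close>

lemma projection_exists:
  assumes K: "closed_csubspace (K::'h::chilbert set)"
  shows "\<exists>p\<in>K. x - p \<in> orth K"
proof -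
  have cs: "csubspace K" and cl: "closed K" using K by (auto simp: closed_csubspace_def)
  note D = csubspaceD[OF cs]
  define d where "d = Inf ((\<lambda>p. (norm (x - p))\<^sup>2) ` K)"
  have bb: "bdd_below ((\<lambda>p. (norm (x - p))\<^sup>2) ` K)" by (intro bdd_belowI2[of _ 0]) simp
  have dle: "d \<le> (norm (x - p))\<^sup>2" if "p \<in> K" for p
    unfolding d_def using cInf_lower[OF _ bb] that by blast
  have "\<exists>p\<in>K. (norm (x - p))\<^sup>2 < d + 1 / Suc n" for n
  proof -
    have "Inf ((\<lambda>p. (norm (x - p))\<^sup>2) ` K) < d + 1 / Suc n" by (simp add: d_def)
    then show ?thesis using cInf_less_iff[OF _ bb] D(1) by blast
  qed
  then obtain p where p: "p n \<in> K" "(norm (x - p n))\<^sup>2 < d + 1 / Suc n" for n by metis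
  have est: "(norm (p m - p n))\<^sup>2 \<le> 2 * (1 / Suc m) + 2 * (1 / Suc n)" for m n
  proof -
    have "(1/2) *\<^sub>R (p m + p n) \<in> K" by (intro D(5) D(2) p(1))
    from dle[OF this] have "4 * d \<le> 4 * (norm (x - (1/2) *\<^sub>R (p m + p n)))\<^sup>2" by linarith
    also have "\<dots> = (2 * norm (x - (1/2) *\<^sub>R (p m + p n)))\<^sup>2"
      by (simp only: power_mult_distrib) simp
    also have "2 * norm (x - (1/2) *\<^sub>R (p m + p n)) = norm (2 *\<^sub>R (x - (1/2) *\<^sub>R (p m + p n)))" by simp
    also have "2 *\<^sub>R (x - (1/2) *\<^sub>R (p m + p n)) = (x - p m) + (x - p n)"
      by (simp add: algebra_simps scaleR_2)
    finally have a: "4 * d \<le> (norm ((x - p m) + (x - p n)))\<^sup>2" .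
    have "(norm (p m - p n))\<^sup>2 = (norm ((x - p m) - (x - p n)))\<^sup>2"
      by (simp add: norm_minus_commute)
    also have "\<dots> = 2 * (norm (x - p m))\<^sup>2 + 2 * (norm (x - p n))\<^sup>2 - (norm ((x - p m) + (x - p n)))\<^sup>2"
      unfolding norm_diff_sq[of "x - p m" "x - p n"] norm_add_sq by simp
    finally show ?thesis using a p(2)[of m] p(2)[of n] by linarith
  qed
  have "Cauchy p"
  proof (rule metric_CauchyI)
    fix e :: real assume e: "e > 0"
    obtain M where M: "1 / Suc M < e\<^sup>2 / 4" using e by (meson nat_approx_posE zero_less_divide_iff zero_less_numeral zero_less_power)
    have "dist (p m) (p n) < e" if "m \<ge> M" "n \<ge> M" for m n
    proof -
      have "1 / Suc m \<le> 1 / Suc M" "1 / Suc n \<le> 1 / Suc M" using that by (auto simp: frac_le)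
      then have "(norm (p m - p n))\<^sup>2 < e\<^sup>2" using est[of m n] M by linarith
      then show ?thesis using e by (simp add: dist_norm power2_less_imp_less)
    qed
    then show "\<exists>M. \<forall>m\<ge>M. \<forall>n\<ge>M. dist (p m) (p n) < e" by blast
  qed
  then obtain q where q: "p \<longlonglongrightarrow> q" using Cauchy_convergent_iff convergent_def by blast
  have qK: "q \<in> K" using cl p(1) q by (meson closed_sequentially)
  have "(\<lambda>n. (norm (x - p n))\<^sup>2) \<longlonglongrightarrow> (norm (x - q))\<^sup>2" by (intro tendsto_intros q)
  moreover have "(\<lambda>n. d + 1 / Suc n) \<longlonglongrightarrow> d + 0"
    by (intro tendsto_add tendsto_const LIMSEQ_Suc[OF lim_1_over_n])
  ultimately have qd: "(norm (x - q))\<^sup>2 \<le> d"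
    by (metis (no_types, lifting) LIMSEQ_le add.right_neutral less_imp_le p(2))
  have re0: "Re (cinner y (x - q)) \<le> 0" if y: "y \<in> K" for y
  proof (rule ccontr)
    assume "\<not> ?thesis"
    then have pos: "Re (cinner y (x - q)) > 0" by simp
    define r where "r = Re (cinner y (x - q))"
    \<comment> \<open>For this step size the linear gain \<open>2 * t * r\<close> exceeds the
      quadratic cost \<open>t^2 * (norm y)^2\<close>, against minimality. The added 1 also covers
      \<open>y = 0\<close>.\<close>
    define t where "t = r / ((norm y)\<^sup>2 + 1)"
    have nn: "(norm y)\<^sup>2 + 1 > 0" by (simp add: add_nonneg_pos)
    have tp: "t > 0" using pos nn by (simp add: t_def r_def)
    have "q + t *\<^sub>R y \<in> K" by (intro D(2) D(5) qK y)
    from dle[OF this] qd have "(norm (x - q))\<^sup>2 \<le> (norm ((x - q) - t *\<^sub>R y))\<^sup>2" unfolding diff_diff_eq by linarith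
    also have "\<dots> = (norm (x - q))\<^sup>2 - 2 * (t * r) + t\<^sup>2 * (norm y)\<^sup>2"
      using Re_cinner_commute[of "x - q" y]
      by (simp only: norm_diff_sq cinner_scaleR_right) (simp add: r_def power_mult_distrib)
    finally have "t * (2 * r) \<le> t * (t * (norm y)\<^sup>2)" by (simp add: power2_eq_square mult.assoc)
    then have "2 * r \<le> t * (norm y)\<^sup>2" using tp by simp
    also have "\<dots> \<le> t * ((norm y)\<^sup>2 + 1)" using tp by simp
    also have "\<dots> = r" using nn by (simp add: t_def)
    finally show False using pos r_def by simp
  qed
  \<comment> \<open>The one-sided bound \<open>re0\<close> at \<open>y\<close> and
    \<open>- y\<close> kills the real part; at the multiples of \<open>y\<close> by
    \<open>\<i>\<close> and \<open>- \<i>\<close> it kills the imaginary part.\<close>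
  have "cinner y (x - q) = 0" if y: "y \<in> K" for y
  proof (rule complex_eqI)
    show "Re (cinner y (x - q)) = Re 0"
      using re0[OF y] re0[OF D(6)[OF y]] by (simp add: cinner_minus_left)
    show "Im (cinner y (x - q)) = Im 0"
      using re0[OF D(3)[OF y, of \<i>]] re0[OF D(3)[OF y, of "-\<i>"]] by (simp add: cinner_scaleC_left)
  qed
  then show ?thesis using qK by (auto simp: orth_def)
qed

lemma proj_eqI:
  assumes "csubspace (K::'h::chilbert set)" "p \<in> K" "x - p \<in> orth K"
  shows "proj K x = p"
  unfolding proj_def
proof (rule the_equality)
  fix q assume q: "q \<in> K \<and> x - q \<in> orth K"
  have pq: "p - q \<in> K" using assms q csubspaceD by blast
  have "cinner (p - q) ((x - q) - (x - p)) = 0"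
    using pq q assms unfolding orth_def by (subst cinner_diff_right) auto
  then have "cinner (p - q) (p - q) = 0" by simp
  then show "q = p" by (simp add: cinner_eq_zero_iff)
qed (use assms in auto)

lemma proj_props:
  assumes "closed_csubspace (K::'h::chilbert set)"
  shows "proj K x \<in> K" "x - proj K x \<in> orth K"
proof -
  obtain p where "p \<in> K" "x - p \<in> orth K" using projection_exists[OF assms] by blast
  then have "proj K x = p" "p \<in> K" "x - p \<in> orth K"
    using assms proj_eqI unfolding closed_csubspace_def by blast+
  then show "proj K x \<in> K" "x - proj K x \<in> orth K" by auto
qed

lemma proj_in: "csubspace (K::'h::chilbert set) \<Longrightarrow> x \<in> K \<Longrightarrow> proj K x = x"
  by (rule proj_eqI) (auto simp: orth_def)

lemma proj_add:
  assumes "closed_csubspace (K::'h::chilbert set)"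
  shows "proj K (x + y) = proj K x + proj K y"
proof (rule proj_eqI)
  have K: "csubspace K" using assms by (simp add: closed_csubspace_def)
  then show "csubspace K" "proj K x + proj K y \<in> K"
    using proj_props(1)[OF assms] csubspaceD(2) by blast+
  have "(x - proj K x) + (y - proj K y) \<in> orth K"
    using proj_props(2)[OF assms] orth_csubspace csubspaceD(2) unfolding closed_csubspace_def by blast
  then show "x + y - (proj K x + proj K y) \<in> orth K" by (simp add: algebra_simps)
qed

lemma proj_scaleC:
  assumes "closed_csubspace (K::'h::chilbert set)"
  shows "proj K (scaleC c x) = scaleC c (proj K x)"
proof (rule proj_eqI)
  have K: "csubspace K" using assms by (simp add: closed_csubspace_def)
  then show "csubspace K" "scaleC c (proj K x) \<in> K"
    using proj_props(1)[OF assms] csubspaceD(3) by blast+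
  have "scaleC c (x - proj K x) \<in> orth K"
    using proj_props(2)[OF assms] orth_csubspace csubspaceD(3) unfolding closed_csubspace_def by blast
  then show "scaleC c x - scaleC c (proj K x) \<in> orth K" by (simp add: scaleC_simps)
qed

text \<open>The residual \<open>x - proj K x\<close> lies in \<open>M\<close> and in
  \<open>orth K\<close>, hence vanishes. Taking \<open>M\<close> to be a subspace allows its use
  inside \<open>K\<close> for relations and inside the complement of a kernel for ranges.\<close>

lemma orth_trivial_imp_all:
  assumes "closed_csubspace (K::'h::chilbert set)" "csubspace M" "K \<subseteq> M"
    "\<And>y. y \<in> M \<Longrightarrow> y \<in> orth K \<Longrightarrow> y = 0" "x \<in> M"
  shows "x \<in> K"
proof -
  have "proj K x \<in> K" "x - proj K x \<in> orth K" using proj_props assms(1) by blast+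
  moreover have "x - proj K x \<in> M" using assms calculation csubspaceD(4) by blast
  ultimately show ?thesis using assms(4) by (metis eq_iff_diff_eq_0)
qed

subsection \<open>Cayley transforms of self-adjoint relations\<close>

lemma linrelD:
  assumes "linrel (R::('h::chilbert \<times> 'h) set)"
  shows "(0,0) \<in> R" "(a,b) \<in> R \<Longrightarrow> (c,d) \<in> R \<Longrightarrow> (a+c,b+d) \<in> R"
    "(a,b) \<in> R \<Longrightarrow> (scaleC k a, scaleC k b) \<in> R" "(a,b) \<in> R \<Longrightarrow> (c,d) \<in> R \<Longrightarrow> (a-c,b-d) \<in> R"
proof -
  show *: "(0,0) \<in> R" "(a,b) \<in> R \<Longrightarrow> (c,d) \<in> R \<Longrightarrow> (a+c,b+d) \<in> R"
    "(a,b) \<in> R \<Longrightarrow> (scaleC k a, scaleC k b) \<in> R" for a b c d k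
    using assms by (auto simp: linrel_def)
  show "(a,b) \<in> R \<Longrightarrow> (c,d) \<in> R \<Longrightarrow> (a-c,b-d) \<in> R"
    using *(2)[of a b "-c" "-d"] *(3)[of c d "-1"] by simp
qed

lemma linrel_adjK: "csubspace (K::'h::chilbert set) \<Longrightarrow> linrel (adjK K R)"
  unfolding linrel_def adjK_def
  by (auto simp: cinner_simps csubspaceD split: prod.splits)

lemma closed_adj: "closed (adj (R::('h::chilbert \<times> 'h) set))"
proof -
  have "adj R = (\<Inter>p\<in>R. {q. cinner (snd p) (fst q) = cinner (fst p) (snd q)})"
    by (fastforce simp: adjK_def split: prod.splits)
  moreover have "closed {q. cinner (snd p) (fst q) = cinner (fst p) (snd q)}" for p :: "'h \<times> 'h"
    by (intro closed_Collect_eq continuous_intros bounded_bilinear.continuous_on[OF bounded_bilinear_cinner])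
  ultimately show ?thesis by auto
qed

lemma selfadjK_symmetric: "selfadjK (K::'h::chilbert set) R \<Longrightarrow> R \<subseteq> adj R"
proof -
  have "adjK K R \<subseteq> adj R" by (auto simp: adjK_def)
  then show "selfadjK K R \<Longrightarrow> R \<subseteq> adj R" by (simp add: selfadjK_def)
qed

lemma selfadjK_linrel: "csubspace (K::'h::chilbert set) \<Longrightarrow> selfadjK K R \<Longrightarrow> linrel R"
  unfolding selfadjK_def using linrel_adjK by metis

lemma selfadjK_closed: "closed (K::'h::chilbert set) \<Longrightarrow> selfadjK K R \<Longrightarrow> closed R"
proof -
  assume K: "closed K" and R: "selfadjK K R"
  have "adjK K R = adj R \<inter> K \<times> K" unfolding adjK_def by auto
  then have "R = adj R \<inter> K \<times> K" using R unfolding selfadjK_def by simp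
  then show "closed R" using closed_adj[of R] K by (metis closed_Int closed_Times)
qed

text \<open>Symmetry makes \<open>cinner b a\<close> real, so the cross term of \<open>b\<close>
  with \<open>scaleC c a\<close> has zero real part. Injectivity, closed range and isometry of the
  Cayley transform all come from this identity.\<close>

lemma symmetric_norm:
  assumes "(R::('h::chilbert \<times> 'h) set) \<subseteq> adj R" "(a,b) \<in> R" "c = \<i> \<or> c = - \<i>"
  shows "(norm (b + scaleC c a))\<^sup>2 = (norm b)\<^sup>2 + (norm a)\<^sup>2"
proof -
  have "cinner b a = cinner a b" using assms(1,2) by (auto simp: adjK_def)
  then have "Im (cinner b a) = 0" using cinner_commute[of b a] by (metis Reals_cnj_iff complex_is_Real_iff)
  then have "Re (cinner b (scaleC c a)) = 0" using assms(3) by (auto simp: cinner_simps)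
  moreover have "cmod c = 1" using assms(3) by auto
  ultimately show ?thesis by (simp add: norm_add_sq norm_scaleC)
qed

text \<open>By \<open>symmetric_norm\<close>, convergence of \<open>b + scaleC c a\<close> forces
  the first components to be Cauchy; the second components then converge too, and closedness of
  \<open>R\<close> keeps the limit pair in \<open>R\<close>.\<close>

lemma symmetric_range_closed:
  assumes R: "linrel (R::('h::chilbert \<times> 'h) set)" "closed R" "R \<subseteq> adj R" and c: "c = \<i> \<or> c = - \<i>"
  shows "closed_csubspace ((\<lambda>(a,b). b + scaleC c a) ` R)" (is "closed_csubspace ?S")
proof -
  have "closed ?S"
    unfolding closed_sequential_limits
  proof (intro allI impI, elim conjE)
    fix f l assume f: "\<forall>n::nat. f n \<in> ?S" and l: "f \<longlonglongrightarrow> l"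
    have "\<exists>p\<in>R. f n = snd p + scaleC c (fst p)" for n
    proof -
      obtain q where "q \<in> R" "f n = (case q of (a,b) \<Rightarrow> b + scaleC c a)"
        using spec[OF f, of n] by (rule imageE) blast
      then show ?thesis by (intro bexI[of _ q]) (auto split: prod.splits)
    qed
    then obtain p where p: "p n \<in> R" "f n = snd (p n) + scaleC c (fst (p n))" for n by metis
    have le: "norm (fst (p m) - fst (p n)) \<le> norm (f m - f n)" for m n
    proof -
      have "p m - p n \<in> R" using linrelD(4)[OF R(1)] p(1) by (metis minus_prod_def prod.collapse)
      then have "(fst (p m) - fst (p n), snd (p m) - snd (p n)) \<in> R" by (simp add: minus_prod_def)
      from symmetric_norm[OF R(3) this c] have "(norm (f m - f n))\<^sup>2 \<ge> (norm (fst (p m) - fst (p n)))\<^sup>2"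
        by (simp add: p(2) scaleC_simps algebra_simps)
      then show ?thesis by (simp add: power2_le_iff_abs_le)
    qed
    have "Cauchy f" using l LIMSEQ_imp_Cauchy by blast
    then have "Cauchy (\<lambda>n. fst (p n))"
      unfolding Cauchy_def dist_norm using le by (meson le_less_trans)
    then obtain a where a: "(\<lambda>n. fst (p n)) \<longlonglongrightarrow> a" using Cauchy_convergent_iff convergent_def by blast
    have "(\<lambda>n. f n - scaleC c (fst (p n))) \<longlonglongrightarrow> l - scaleC c a"
      by (intro tendsto_diff l bounded_linear.tendsto[OF bounded_linear_scaleC] a)
    then have "(\<lambda>n. snd (p n)) \<longlonglongrightarrow> l - scaleC c a" by (simp add: p(2))
    then have "(\<lambda>n. (fst (p n), snd (p n))) \<longlonglongrightarrow> (a, l - scaleC c a)" using a by (rule tendsto_Pair[rotated])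
    from closed_sequentially[OF R(2) _ this] have "(a, l - scaleC c a) \<in> R" using p(1) by simp
    then show "l \<in> ?S" by (rule rev_image_eqI) simp
  qed
  moreover have "csubspace ?S"
    unfolding csubspace_def
  proof (intro conjI ballI allI)
    show "0 \<in> ?S" using linrelD(1)[OF R(1)] by force
    fix x assume x: "x \<in> ?S"
    then obtain a b where ab: "(a,b) \<in> R" "x = b + scaleC c a" by auto
    { fix y assume "y \<in> ?S"
      then obtain a' b' where "(a',b') \<in> R" "y = b' + scaleC c a'" by auto
      then show "x + y \<in> ?S" using linrelD(2)[OF R(1) ab(1)] ab(2)
        by (auto intro!: image_eqI[of _ _ "(a+a',b+b')"] simp: scaleC_simps) }
    fix k show "scaleC k x \<in> ?S" using linrelD(3)[OF R(1) ab(1)] ab(2)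
        by (auto intro!: image_eqI[of _ _ "(scaleC k a,scaleC k b)"] simp: scaleC_simps mult.commute)
  qed
  ultimately show ?thesis by (simp add: closed_csubspace_def)
qed

text \<open>This justifies the description operator in \<open>cay\<close>: two pairs with the same
  \<open>b + scaleC \<i> a\<close> differ by a pair for which this expression is 0, and
  \<open>symmetric_norm\<close> forces that pair to be zero.\<close>

lemma cay_eq:
  assumes R: "linrel (R::('h::chilbert \<times> 'h) set)" "R \<subseteq> adj R" "(a,b) \<in> R"
  shows "cay R (b + scaleC \<i> a) = b - scaleC \<i> a"
  unfolding cay_def
proof (rule the_equality)
  show "(b + scaleC \<i> a, b - scaleC \<i> a) \<in> cayley_graph R" using R(3) by (auto simp: cayley_graph_def)
  fix y assume "(b + scaleC \<i> a, y) \<in> cayley_graph R"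
  then obtain a' b' where *: "(a',b') \<in> R" "b + scaleC \<i> a = b' + scaleC \<i> a'" "y = b' - scaleC \<i> a'"
    by (auto simp: cayley_graph_def)
  have "(b - b') + scaleC \<i> (a - a') = 0" using *(2) by (simp add: scaleC_simps algebra_simps)
  then have "(norm (b - b'))\<^sup>2 + (norm (a - a'))\<^sup>2 = 0"
    using symmetric_norm[OF R(2) linrelD(4)[OF R(1,3) *(1)], of \<i>] by simp
  then have "b = b'" "a = a'" by (auto simp: sum_power2_eq_zero_iff)
  then show "y = b - scaleC \<i> a" using *(3) by simp
qed

text \<open>A vector \<open>z\<close> of \<open>K\<close> orthogonal to the range gives the pair
  \<open>(z, scaleC (- cnj c) z)\<close> of the adjoint, that is of \<open>A\<close>. Symmetry of
  \<open>A\<close> on this pair equates \<open>c\<close> and \<open>cnj c\<close> unless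
  \<open>z = 0\<close>. Since the range is closed, it is all of \<open>K\<close>.\<close>

lemma selfadjK_surj:
  assumes K: "closed_csubspace (K::'h::chilbert set)" and A: "selfadjK K A" and y: "y \<in> K"
    and c: "c = \<i> \<or> c = - \<i>"
  shows "\<exists>(a,b)\<in>A. y = b + scaleC c a"
proof -
  have cK: "csubspace K" "closed K" using K by (auto simp: closed_csubspace_def)
  have S: "closed_csubspace ((\<lambda>(a,b). b + scaleC c a) ` A)"
    using symmetric_range_closed[OF selfadjK_linrel selfadjK_closed selfadjK_symmetric c] cK A by blast
  have AK: "A \<subseteq> K \<times> K" "adjK K A = A" using A by (auto simp: selfadjK_def)
  have sub: "(\<lambda>(a,b). b + scaleC c a) ` A \<subseteq> K" using AK(1) csubspaceD(2,3)[OF cK(1)] by fastforce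
  have "z = 0" if z: "z \<in> K" "z \<in> orth ((\<lambda>(a,b). b + scaleC c a) ` A)" for z
  proof -
    have "cinner (b + scaleC c a) z = 0" if "(a,b) \<in> A" for a b using z(2) that by (force simp: orth_def)
    then have "cinner b z = cinner a (scaleC (- cnj c) z)" if "(a,b) \<in> A" for a b
      using that by (fastforce simp: cinner_simps eq_neg_iff_add_eq_0)
    moreover have "scaleC (- cnj c) z \<in> K" using z csubspaceD(3)[OF cK(1)] by blast
    ultimately have zA: "(z, scaleC (- cnj c) z) \<in> A" using z(1) by (subst AK(2)[symmetric]) (auto simp: adjK_def)
    then have "cinner (scaleC (- cnj c) z) z = cinner z (scaleC (- cnj c) z)"
      using selfadjK_symmetric[OF A] by (auto simp: adjK_def)
    then have "(- c) * cinner z z = (- cnj c) * cinner z z" by (simp add: cinner_simps)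
    then show "z = 0" using c cinner_eq_zero_iff[of z] by auto
  qed
  from orth_trivial_imp_all[OF S cK(1) sub this y] show ?thesis by auto
qed

section \<open>Unitary operators and unitarity of Cayley transforms\<close>

text \<open>Polarisation: norms of sums determine the real part of the inner product, and replacing
  \<open>x\<close> by \<open>scaleC \<i> x\<close> recovers the imaginary part.\<close>

lemma unitaryI:
  assumes add: "\<And>x y. U (x + y) = U x + U (y::'h::chilbert)" and sc: "\<And>c x. U (scaleC c x) = scaleC c (U x)"
    and nrm: "\<And>x. norm (U x) = norm x" and "surj U"
  shows "unitary U"
proof -
  have sR: "U (r *\<^sub>R x) = r *\<^sub>R U x" for r x by (metis sc scaleC_of_real)
  have bl: "bounded_linear U"
    by (rule bounded_linear_intro[of _ 1]) (auto simp: add sR nrm)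
  have re: "Re (cinner (U x) (U y)) = Re (cinner x y)" for x y
    using norm_add_sq[of "U x" "U y"] norm_add_sq[of x y] nrm[of "x+y"] nrm by (simp add: add)
  have "cinner (U x) (U y) = cinner x y" for x y
  proof (rule complex_eqI)
    show "Im (cinner (U x) (U y)) = Im (cinner x y)"
      using re[of "scaleC \<i> x" y] by (simp add: sc cinner_simps)
  qed (rule re)
  moreover have "inj U"
    using nrm linear_injective_0[OF bounded_linear.linear[OF bl]] by (metis norm_eq_zero)
  ultimately show ?thesis using assms bl by (auto simp: unitary_def cbounded_def bij_def)
qed

lemma unitaryD:
  assumes "unitary (U::'h::chilbert \<Rightarrow> 'h)"
  shows "U (x + y) = U x + U y" "U (x - y) = U x - U y" "U (- x) = - U x" "U 0 = 0"
    "U (scaleC c x) = scaleC c (U x)" "norm (U x) = norm x" "surj U" "inj U" "bij U"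
    "cinner (U x) (U y) = cinner x y" "bounded_linear U" "U (r *\<^sub>R x) = r *\<^sub>R U x" "cbounded U"
proof -
  show bl: "bounded_linear U" and "U (scaleC c x) = scaleC c (U x)" "bij U" "surj U" "inj U" "cbounded U"
    and ci: "cinner (U x) (U y) = cinner x y" for x y
    using assms by (auto simp: unitary_def cbounded_def bij_def)
  note l = bounded_linear.linear[OF bl]
  show "U (x + y) = U x + U y" "U (x - y) = U x - U y" "U (- x) = - U x" "U 0 = 0" "U (r *\<^sub>R x) = r *\<^sub>R U x"
    using linear_add[OF l] linear_diff[OF l] linear_neg[OF l] linear_0[OF l] linear_scale[OF l] by auto
  show "norm (U x) = norm x" by (simp add: norm_cinner ci)
qed

lemma unitary_comp: "unitary U \<Longrightarrow> unitary V \<Longrightarrow> unitary (\<lambda>x. U (V (x::'h::chilbert)))"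
  using comp_surj[of V U] by (intro unitaryI) (simp_all add: unitaryD comp_def)

lemma cay_on:
  assumes K: "closed_csubspace (K::'h::chilbert set)" and A: "selfadjK K A"
  shows "x \<in> K \<Longrightarrow> cay A x \<in> K" "x \<in> K \<Longrightarrow> y \<in> K \<Longrightarrow> cay A (x + y) = cay A x + cay A y"
    "x \<in> K \<Longrightarrow> cay A (scaleC c x) = scaleC c (cay A x)" "x \<in> K \<Longrightarrow> norm (cay A x) = norm x"
    "y \<in> K \<Longrightarrow> \<exists>x\<in>K. cay A x = y" "x \<in> K \<Longrightarrow> (x, cay A x) \<in> cayley_graph A"
proof -
  have cK: "csubspace K" "closed K" using K by (auto simp: closed_csubspace_def)
  have AK: "A \<subseteq> K \<times> K" using A by (auto simp: selfadjK_def)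
  note L = selfadjK_linrel[OF cK(1) A] and S = selfadjK_symmetric[OF A]
  note surj = selfadjK_surj[OF K A]
  have ex: "\<exists>a b. (a,b) \<in> A \<and> a \<in> K \<and> b \<in> K \<and> x = b + scaleC \<i> a \<and> cay A x = b - scaleC \<i> a" if x: "x \<in> K" for x
  proof -
    obtain a b where "(a,b) \<in> A" "x = b + scaleC \<i> a" using surj[OF x, of \<i>] by auto
    then show ?thesis using cay_eq[OF L S] AK by blast
  qed
  show "cay A x \<in> K" if "x \<in> K" using ex[OF that] csubspaceD(3,4)[OF cK(1)] by metis
  show "(x, cay A x) \<in> cayley_graph A" if "x \<in> K" using ex[OF that] by (auto simp: cayley_graph_def)
  show "cay A (x + y) = cay A x + cay A y" if xy: "x \<in> K" "y \<in> K"
  proof -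
    obtain a b where 1: "(a,b) \<in> A" "x = b + scaleC \<i> a" "cay A x = b - scaleC \<i> a" using ex[OF xy(1)] by blast
    obtain a' b' where 2: "(a',b') \<in> A" "y = b' + scaleC \<i> a'" "cay A y = b' - scaleC \<i> a'" using ex[OF xy(2)] by blast
    have "cay A (b + b' + scaleC \<i> (a + a')) = b + b' - scaleC \<i> (a + a')"
      by (rule cay_eq[OF L S linrelD(2)[OF L 1(1) 2(1)]])
    moreover have "b + b' + scaleC \<i> (a + a') = x + y" by (simp add: 1(2) 2(2) scaleC_simps)
    ultimately show ?thesis by (simp add: 1(3) 2(3) scaleC_simps)
  qed
  show "cay A (scaleC c x) = scaleC c (cay A x)" if x: "x \<in> K"
  proof -
    obtain a b where 1: "(a,b) \<in> A" "x = b + scaleC \<i> a" "cay A x = b - scaleC \<i> a" using ex[OF x] by blast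
    have "cay A (scaleC c b + scaleC \<i> (scaleC c a)) = scaleC c b - scaleC \<i> (scaleC c a)"
      by (rule cay_eq[OF L S linrelD(3)[OF L 1(1)]])
    moreover have "scaleC c b + scaleC \<i> (scaleC c a) = scaleC c x" by (simp add: 1(2) scaleC_simps mult.commute)
    ultimately show ?thesis by (simp add: 1(3) scaleC_simps mult.commute)
  qed
  show "norm (cay A x) = norm x" if x: "x \<in> K"
  proof -
    obtain a b where 1: "(a,b) \<in> A" "x = b + scaleC \<i> a" "cay A x = b - scaleC \<i> a" using ex[OF x] by blast
    have "(norm (cay A x))\<^sup>2 = (norm x)\<^sup>2"
      using symmetric_norm[OF S 1(1), of \<i>] symmetric_norm[OF S 1(1), of "-\<i>"] by (simp add: 1(3) scaleC_minus_left) (simp add: 1(2))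
    then show ?thesis by (simp add: power2_eq_iff_nonneg)
  qed
  show "\<exists>x\<in>K. cay A x = y" if y: "y \<in> K"
  proof -
    obtain a b where ab: "(a,b) \<in> A" "y = b - scaleC \<i> a" using surj[OF y, of "-\<i>"] by (auto simp: scaleC_minus_left)
    then have "b + scaleC \<i> a \<in> K" using AK csubspaceD(2,3)[OF cK(1)] by blast
    then show ?thesis using cay_eq[OF L S ab(1)] ab(2) by blast
  qed
qed

lemma closed_csubspace_UNIV: "closed_csubspace (UNIV :: 'h::chilbert set)"
  by (simp add: closed_csubspace_def csubspace_def)

lemma cayH_UNIV: "cayH UNIV A = cay (A :: ('h::chilbert \<times> 'h) set)"
  by (intro ext) (simp add: cayH_def proj_in csubspace_def)

lemma unitary_cayH:
  assumes K: "closed_csubspace (K::'h::chilbert set)" and A: "selfadjK K A"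
  shows "unitary (cayH K A)"
proof (rule unitaryI)
  note c = cay_on[OF K A] and p = proj_props[OF K]
  show "cayH K A (x + y) = cayH K A x + cayH K A y" for x y
    by (simp add: cayH_def proj_add[OF K] c(2) p)
  show "cayH K A (scaleC k x) = scaleC k (cayH K A x)" for k x
    by (simp add: cayH_def proj_scaleC[OF K] c(3) p scaleC_simps)
  show "norm (cayH K A x) = norm x" for x
  proof -
    have o: "cinner q (x - proj K x) = 0" if "q \<in> K" for q using p(2) that by (auto simp: orth_def)
    have "(norm (cayH K A x))\<^sup>2 = (norm (proj K x))\<^sup>2 + (norm (x - proj K x))\<^sup>2"
      by (simp add: cayH_def norm_add_sq o c(1) p c(4))
    also have "\<dots> = (norm (proj K x + (x - proj K x)))\<^sup>2" by (simp only: norm_add_sq o[OF p(1)]) simp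
    finally show ?thesis by (simp add: power2_eq_iff_nonneg)
  qed
  show "surj (cayH K A)"
  unfolding surj_def proof (intro allI)
    fix y
    obtain x where x: "x \<in> K" "cay A x = proj K y" using c(5)[OF p(1)] by blast
    have "proj K (x + (y - proj K y)) = x"
      using K x(1) p(2) by (intro proj_eqI) (auto simp: closed_csubspace_def)
    then have "cayH K A (x + (y - proj K y)) = y" using x(2) by (simp add: cayH_def)
    then show "\<exists>x. y = cayH K A x" by metis
  qed
qed

lemma unitary_cay: "selfadjK UNIV A \<Longrightarrow> unitary (cay (A::('h::chilbert \<times> 'h) set))"
  using unitary_cayH[OF closed_csubspace_UNIV] by (simp add: cayH_UNIV)

subsection \<open>Von Neumann decomposition\<close>

text \<open>Deficiency spaces are complements of ranges, with opposite sign: the kernel of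
  \<open>T* - i\<close> is orthogonal to the range of \<open>T + i\<close>. This makes them closed
  and lets them be reached by projection.\<close>

lemma Kplus_orth: "Kplus (T::('h::chilbert \<times> 'h) set) = orth ((\<lambda>(a,b). b + scaleC \<i> a) ` T)"
  unfolding Kplus_def orth_def adjK_def by (auto simp: cinner_simps)

lemma Kminus_orth: "Kminus (T::('h::chilbert \<times> 'h) set) = orth ((\<lambda>(a,b). b + scaleC (- \<i>) a) ` T)"
  unfolding Kminus_def orth_def adjK_def by (auto simp: cinner_simps add_eq_0_iff)

lemma closed_csubspace_Kplus: "closed_csubspace (Kplus (T::('h::chilbert \<times> 'h) set))"
  by (simp add: Kplus_orth orth_csubspace)

lemma closed_csubspace_Kminus: "closed_csubspace (Kminus (T::('h::chilbert \<times> 'h) set))"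
  by (simp add: Kminus_orth orth_csubspace)

lemma csubspace_Kplus: "csubspace (Kplus (T::('h::chilbert \<times> 'h) set))"
  using closed_csubspace_Kplus by (auto simp: closed_csubspace_def)

lemma csubspace_Kminus: "csubspace (Kminus (T::('h::chilbert \<times> 'h) set))"
  using closed_csubspace_Kminus by (auto simp: closed_csubspace_def)

lemma KplusD: "b \<in> Kplus T \<Longrightarrow> (a,u) \<in> T \<Longrightarrow> cinner (u + scaleC \<i> a) (b::'h::chilbert) = 0"
  by (force simp: Kplus_orth orth_def)

text \<open>Two values of the adjoint at one point differ by a vector orthogonal to the dense domain
  of \<open>T\<close>, hence orthogonal to itself.\<close>

lemma is_op_adj:
  assumes "closed_dd_symmetric (T::('h::chilbert \<times> 'h) set)"
  shows "is_op (adj T)"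
  unfolding is_op_def
proof (intro allI impI)
  fix x y z assume a: "(x,y) \<in> adj T" "(x,z) \<in> adj T"
  have "cinner (y - z) a = 0" if "(a,u) \<in> T" for a u
  proof -
    have "cinner a y = cinner a z" using a that unfolding adjK_def by (simp add: split_beta) (metis fst_conv snd_conv)
    then show ?thesis using orth_commute[of a "y - z"] by (simp add: cinner_diff_right)
  qed
  then have "Domain T \<subseteq> orth {y - z}" by (auto simp: orth_def)
  then have "closure (Domain T) \<subseteq> orth {y - z}"
    using orth_csubspace closure_minimal unfolding closed_csubspace_def by blast
  then have "y - z \<in> orth {y - z}" using assms by (auto simp: closed_dd_symmetric_def)
  then show "y = z" by (auto simp: orth_def cinner_eq_zero_iff)
qed

lemma linrel_adj: "linrel (adj (T::('h::chilbert \<times> 'h) set))"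
  by (rule linrel_adjK) (simp add: csubspace_def)

text \<open>Projecting \<open>y + scaleC \<i> z\<close> onto the closed range of
  \<open>T + i\<close> yields the part \<open>a\<close> in the domain; the residual is a multiple of
  the component in \<open>Kplus\<close>, and what remains of \<open>z\<close> lands in
  \<open>Kminus\<close>.\<close>

lemma vn_dec_exists:
  assumes T: "closed_dd_symmetric (T::('h::chilbert \<times> 'h) set)" and z: "(z,y) \<in> adj T"
  obtains a u b c where "(a,u) \<in> T" "b \<in> Kplus T" "c \<in> Kminus T" "z = a + b + c"
    "y = u + scaleC \<i> b - scaleC \<i> c"
proof -
  let ?S = "(\<lambda>(a,b). b + scaleC \<i> a) ` T"
  have T': "linrel T" "closed T" "T \<subseteq> adj T" using T by (auto simp: closed_dd_symmetric_def)
  have S: "closed_csubspace ?S" using symmetric_range_closed[OF T'] by blast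
  define v where "v = y + scaleC \<i> z"
  obtain a u where au: "(a,u) \<in> T" "proj ?S v = u + scaleC \<i> a" using proj_props(1)[OF S, of v] by auto
  define p where "p = v - (u + scaleC \<i> a)"
  have p: "p \<in> Kplus T" using proj_props(2)[OF S, of v] by (simp add: Kplus_orth p_def au(2))
  \<comment> \<open>An element \<open>b\<close> of \<open>Kplus\<close> contributes
    \<open>2 * \<i>\<close> times itself to \<open>y + scaleC \<i> z\<close>, while elements of
    \<open>Kminus\<close> contribute 0; hence \<open>p\<close> has to equal
    \<open>scaleC (2 * \<i>) b\<close>.\<close>
  define b where "b = scaleC (- \<i> / 2) p"
  have b: "b \<in> Kplus T" unfolding b_def by (rule csubspaceD(3)[OF csubspace_Kplus p])
  have pb: "p = scaleC \<i> b + scaleC \<i> b" by (simp add: b_def scaleC_scaleC flip: scaleC_add_left)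
  define c where "c = z - a - b"
  have "(z - a - b, y - u - scaleC \<i> b) \<in> adj T"
    by (intro linrelD(4)[OF linrel_adj] z subsetD[OF T'(3) au(1)]) (use b in \<open>simp add: Kplus_def\<close>)
  moreover have y: "y = u + scaleC \<i> b - scaleC \<i> c"
    using pb by (simp add: p_def v_def c_def scaleC_simps algebra_simps)
  ultimately have cK: "c \<in> Kminus T" by (simp add: Kminus_def c_def scaleC_minus_left)
  have "z = a + b + c" by (simp add: c_def)
  then show ?thesis by (rule that[OF au(1) b cK _ y])
qed

text \<open>Uniqueness of the decomposition. Applying the adjoint to \<open>a + b + c = 0\<close>
  and eliminating \<open>c\<close> leaves a sum of \<open>u + scaleC \<i> a\<close> and
  \<open>scaleC (2 * \<i>) b\<close>. These are orthogonal, so both vanish, and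
  \<open>symmetric_norm\<close> gives \<open>a = 0\<close>.\<close>

lemma vn_dec_zero:
  assumes T: "closed_dd_symmetric (T::('h::chilbert \<times> 'h) set)" and au: "(a,u) \<in> T"
    and b: "b \<in> Kplus T" and c: "c \<in> Kminus T" and s: "a + b + c = 0"
  shows "a = 0 \<and> b = 0 \<and> c = 0"
proof -
  have T': "linrel T" "closed T" "T \<subseteq> adj T" using T by (auto simp: closed_dd_symmetric_def)
  have "(a + b + c, u + scaleC \<i> b + scaleC (- \<i>) c) \<in> adj T"
    by (intro linrelD(2)[OF linrel_adj] subsetD[OF T'(3) au]) (use b c in \<open>simp_all add: Kplus_def Kminus_def\<close>)
  then have z: "u + scaleC \<i> b + scaleC (- \<i>) c = 0"
    using is_op_adj[OF T] linrelD(1)[OF linrel_adj, of T] s unfolding is_op_def by metis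
  have "c = - (a + b)" using s by (metis add_eq_0_iff)
  with z have e: "(u + scaleC \<i> a) + (scaleC \<i> b + scaleC \<i> b) = 0"
    by (simp add: scaleC_simps algebra_simps)
  have "cinner (u + scaleC \<i> a) b = 0" using KplusD[OF b au] .
  then have "cinner (u + scaleC \<i> a) (u + scaleC \<i> a) = cinner (u + scaleC \<i> a) ((u + scaleC \<i> a) + (scaleC \<i> b + scaleC \<i> b))"
    by (simp only: cinner_add_right[of _ "u + scaleC \<i> a" "scaleC \<i> b + scaleC \<i> b"]
        cinner_add_right[of _ "scaleC \<i> b" "scaleC \<i> b"] cinner_scaleC_right) simp
  then have 0: "u + scaleC \<i> a = 0" unfolding e by (simp only: cinner_zero_right cinner_eq_zero_iff)
  then have "(norm u)\<^sup>2 + (norm a)\<^sup>2 = 0" using symmetric_norm[OF T'(3) au, of \<i>] by simp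
  then have "a = 0" by (auto simp: sum_power2_eq_zero_iff)
  moreover have "b = 0"
  proof -
    have "scaleC (2 * \<i>) b = 0" using e 0 by (simp add: scaleC_2 flip: scaleC_scaleC)
    then show ?thesis by (simp add: scaleC_eq_0)
  qed
  ultimately show ?thesis using s by simp
qed

lemma vn_dec_eq:
  assumes T: "closed_dd_symmetric (T::('h::chilbert \<times> 'h) set)" and au: "(a,u) \<in> T"
    and b: "b \<in> Kplus T" and c: "c \<in> Kminus T"
  shows "vn_dec T (a + b + c) = (a,b,c)"
  unfolding vn_dec_def
proof (rule the_equality)
  show "case (a, b, c) of (a', b', c') \<Rightarrow> a' \<in> Domain T \<and> b' \<in> Kplus T \<and> c' \<in> Kminus T \<and> a + b + c = a' + b' + c'"
    using au b c by auto
  fix t assume t: "case t of (a', b', c') \<Rightarrow> a' \<in> Domain T \<and> b' \<in> Kplus T \<and> c' \<in> Kminus T \<and> a + b + c = a' + b' + c'"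
  then obtain a' u' b' c' where t': "t = (a',b',c')" "(a',u') \<in> T" "b' \<in> Kplus T" "c' \<in> Kminus T" "a + b + c = a' + b' + c'"
    by (auto split: prod.splits)
  have "linrel T" using T by (simp add: closed_dd_symmetric_def)
  then have 1: "(a - a', u - u') \<in> T" by (rule linrelD(4)[OF _ au t'(2)])
  have 2: "b - b' \<in> Kplus T" by (rule csubspaceD(4)[OF csubspace_Kplus b t'(3)])
  have 3: "c - c' \<in> Kminus T" by (rule csubspaceD(4)[OF csubspace_Kminus c t'(4)])
  have "(a - a') + (b - b') + (c - c') = 0" using t'(5) by (simp add: algebra_simps)
  from vn_dec_zero[OF T 1 2 3 this] show "t = (a,b,c)" using t'(1) by simp
qed

section \<open>The Cayley transform of the extension \<open>A'\<close>\<close>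

text \<open>The unitary \<open>cay A\<close> maps the range of \<open>T + i\<close> onto the range
  of \<open>T - i\<close> because \<open>A\<close> extends \<open>T\<close>, so it carries the
  complement of the first into the complement of the second.\<close>

lemma cay_Kplus:
  assumes A: "selfadjK UNIV (A::('h::chilbert \<times> 'h) set)" and TA: "T \<subseteq> A" and b: "b \<in> Kplus T"
  shows "cay A b \<in> Kminus T"
proof -
  have L: "linrel A" by (rule selfadjK_linrel[OF _ A]) (simp add: csubspace_def)
  have "cinner (u + scaleC (- \<i>) x) (cay A b) = 0" if xu: "(x,u) \<in> T" for x u
  proof -
    have "cinner (u + scaleC (- \<i>) x) (cay A b) = cinner (cay A (u + scaleC \<i> x)) (cay A b)"
      using cay_eq[OF L selfadjK_symmetric[OF A] subsetD[OF TA xu]] by (simp add: scaleC_minus_left)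
    also have "\<dots> = cinner (u + scaleC \<i> x) b" by (rule unitaryD(10)[OF unitary_cay[OF A]])
    also have "\<dots> = 0" by (rule KplusD[OF b xu])
    finally show ?thesis .
  qed
  then show ?thesis by (auto simp: Kminus_orth orth_def)
qed

lemma cayley_graph_iff: "(p,q) \<in> cayley_graph (R::('h::chilbert \<times> 'h) set) \<longleftrightarrow>
  (scaleC (- \<i> / 2) (p - q), scaleC (1 / 2) (p + q)) \<in> R"
proof -
  have eq: "p = b + scaleC \<i> a \<and> q = b - scaleC \<i> a \<longleftrightarrow> a = scaleC (- \<i> / 2) (p - q) \<and> b = scaleC (1 / 2) (p + q)"
    for a b
  proof
    assume "p = b + scaleC \<i> a \<and> q = b - scaleC \<i> a"
    then have "p - q = scaleC (2 * \<i>) a" "p + q = scaleC 2 b"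
      by (simp_all add: scaleC_2 flip: scaleC_scaleC)
    then show "a = scaleC (- \<i> / 2) (p - q) \<and> b = scaleC (1 / 2) (p + q)"
      by (simp add: scaleC_scaleC)
  next
    assume "a = scaleC (- \<i> / 2) (p - q) \<and> b = scaleC (1 / 2) (p + q)"
    then have ab: "scaleC \<i> a = scaleC (1 / 2) (p - q)" "b = scaleC (1 / 2) (p + q)"
      by (simp_all add: scaleC_scaleC)
    have h: "scaleC (1/2) p + scaleC (1/2) p = p" "scaleC (1/2) q + scaleC (1/2) q = q"
      by (simp_all flip: scaleC_add_left)
    have "b + scaleC \<i> a = scaleC (1/2) p + scaleC (1/2) p" "b - scaleC \<i> a = scaleC (1/2) q + scaleC (1/2) q"
      unfolding ab scaleC_add_right scaleC_diff_right by simp_all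
    then show "p = b + scaleC \<i> a \<and> q = b - scaleC \<i> a" unfolding h by simp
  qed
  show ?thesis unfolding cayley_graph_def using eq by auto
qed

text \<open>The factorisation \<open>U(A') = U(B)_H U(A)\<close>. On vectors
  \<open>u + scaleC \<i> a\<close> from \<open>T\<close> both sides give
  \<open>u - scaleC \<i> a\<close>, which is orthogonal to \<open>Kminus T\<close> and so fixed by
  the extended transform of \<open>B\<close>. On the remaining \<open>Kplus\<close> component the
  boundary condition says exactly that \<open>cay B\<close> is applied after
  \<open>cay A\<close>.\<close>

lemma cayley_graph_Aprime:
  assumes T: "closed_dd_symmetric (T::('h::chilbert \<times> 'h) set)" and A: "selfadjK UNIV A" and TA: "T \<subseteq> A"
    and B: "selfadjK (Kminus T) B"
  shows "(v,y) \<in> cayley_graph (Aprime T A B) \<longleftrightarrow> y = cayH (Kminus T) B (cay A v)"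
proof -
  have T': "linrel T" "closed T" "T \<subseteq> adj T" using T by (auto simp: closed_dd_symmetric_def)
  note K = closed_csubspace_Kminus[of T]
  have L: "linrel A" by (rule selfadjK_linrel[OF _ A]) (simp add: csubspace_def)
  have LB: "linrel B" using selfadjK_linrel[OF csubspace_Kminus B] .
  note UA = unitaryD[OF unitary_cay[OF A]]
  have Kb: "scaleC (2 * \<i>) (cay A b) \<in> Kminus T" if "b \<in> Kplus T" for b
    by (rule csubspaceD(3)[OF csubspace_Kminus cay_Kplus[OF A TA that]])
  have val: "cayH (Kminus T) B (cay A (u + scaleC \<i> a + scaleC (2 * \<i>) b)) =
      u - scaleC \<i> a + cay B (scaleC (2 * \<i>) (cay A b))"
    if au: "(a,u) \<in> T" and b: "b \<in> Kplus T" for a u b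
  proof -
    have c: "cay A (u + scaleC \<i> a + scaleC (2 * \<i>) b) = (u - scaleC \<i> a) + scaleC (2 * \<i>) (cay A b)"
      using cay_eq[OF L selfadjK_symmetric[OF A] subsetD[OF TA au]] by (simp only: UA(1,5))
    have "cinner (u - scaleC \<i> a) x = 0" if "x \<in> Kminus T" for x
      using that au by (force simp: Kminus_orth orth_def scaleC_minus_left)
    then have "u - scaleC \<i> a \<in> orth (Kminus T)"
      using orth_commute[of "u - scaleC \<i> a"] by (simp add: orth_def)
    then have "proj (Kminus T) (cay A (u + scaleC \<i> a + scaleC (2 * \<i>) b)) = scaleC (2 * \<i>) (cay A b)"
      unfolding c by (intro proj_eqI csubspace_Kminus Kb b) simp
    then show ?thesis unfolding cayH_def by (simp add: c)
  qed
  \<comment> \<open>The combinations \<open>Gamma1 + i Gamma0\<close> and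
    \<open>Gamma1 - i Gamma0\<close> isolate the two deficiency components: they equal
    \<open>2i V b\<close> and \<open>- 2i c\<close>, with \<open>V\<close> the restriction of
    \<open>cay A\<close>.\<close>
  have G: "(Gamma0 T A (a + b + c), Gamma1 T A (a + b + c)) \<in> B \<longleftrightarrow>
      (scaleC (2 * \<i>) (cay A b), - scaleC (2 * \<i>) c) \<in> cayley_graph B"
    if "(a,u) \<in> T" "b \<in> Kplus T" "c \<in> Kminus T" for a u b c
    unfolding cayley_graph_iff Gamma0_def Gamma1_def vn_dec_eq[OF T that]
    by (simp add: scaleC_simps add.commute)
  have cB: "(p, q) \<in> cayley_graph B \<longleftrightarrow> q = cay B p" if p: "p \<in> Kminus T" for p q
  proof
    assume "(p,q) \<in> cayley_graph B"
    then show "q = cay B p" using cay_eq[OF LB selfadjK_symmetric[OF B]] by (auto simp: cayley_graph_def)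
  qed (use cay_on(6)[OF K B p] in auto)
  show ?thesis
  proof
    assume "(v,y) \<in> cayley_graph (Aprime T A B)"
    then obtain z w where zw: "(z,w) \<in> adj T" "(Gamma0 T A z, Gamma1 T A z) \<in> B"
        "v = w + scaleC \<i> z" "y = w - scaleC \<i> z"
      by (auto simp: cayley_graph_def Aprime_def)
    obtain a u b c where d: "(a,u) \<in> T" "b \<in> Kplus T" "c \<in> Kminus T" "z = a + b + c"
      "w = u + scaleC \<i> b - scaleC \<i> c" using vn_dec_exists[OF T zw(1)] .
    have "- scaleC (2 * \<i>) c = cay B (scaleC (2 * \<i>) (cay A b))"
      using zw(2) G[OF d(1-3)] cB[OF Kb[OF d(2)]] d(4) by simp
    moreover have "v = u + scaleC \<i> a + scaleC (2 * \<i>) b"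
      by (simp add: zw(3) d scaleC_add_right scaleC_2 algebra_simps flip: scaleC_scaleC)
    moreover have "y = u - scaleC \<i> a - scaleC (2 * \<i>) c"
      by (simp add: zw(4) d scaleC_add_right scaleC_2 algebra_simps flip: scaleC_scaleC)
    ultimately show "y = cayH (Kminus T) B (cay A v)" using val[OF d(1,2)] by simp
  next
    assume y: "y = cayH (Kminus T) B (cay A v)"
    let ?S = "(\<lambda>(a,b). b + scaleC \<i> a) ` T"
    have S: "closed_csubspace ?S" using symmetric_range_closed[OF T'] by blast
    obtain a u where au: "(a,u) \<in> T" "proj ?S v = u + scaleC \<i> a" using proj_props(1)[OF S, of v] by auto
    \<comment> \<open>Conversely \<open>v\<close> determines the domain part and \<open>b\<close>
      through projection; the boundary condition then dictates \<open>c\<close>, chosen so that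
      \<open>- scaleC (2 * \<i>) c\<close> is the value of \<open>cay B\<close>.\<close>
    define b where "b = scaleC (- \<i> / 2) (v - (u + scaleC \<i> a))"
    have b: "b \<in> Kplus T" unfolding b_def
      by (rule csubspaceD(3)[OF csubspace_Kplus]) (use proj_props(2)[OF S, of v] in \<open>simp add: Kplus_orth au(2)\<close>)
    have v: "v = u + scaleC \<i> a + scaleC (2 * \<i>) b" by (simp add: b_def scaleC_scaleC)
    define c where "c = scaleC (\<i> / 2) (cay B (scaleC (2 * \<i>) (cay A b)))"
    have c: "c \<in> Kminus T" unfolding c_def
      by (rule csubspaceD(3)[OF csubspace_Kminus cay_on(1)[OF K B Kb[OF b]]])
    have c': "- scaleC (2 * \<i>) c = cay B (scaleC (2 * \<i>) (cay A b))" by (simp add: c_def scaleC_scaleC)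
    then have g: "(Gamma0 T A (a + b + c), Gamma1 T A (a + b + c)) \<in> B"
      using G[OF au(1) b c] cB[OF Kb[OF b]] by simp
    define w where "w = u + scaleC \<i> b - scaleC \<i> c"
    have "(a + b + c, u + scaleC \<i> b + scaleC (- \<i>) c) \<in> adj T"
      by (intro linrelD(2)[OF linrel_adj] subsetD[OF T'(3) au(1)]) (use b c in \<open>simp_all add: Kplus_def Kminus_def\<close>)
    then have "(a + b + c, w) \<in> Aprime T A B" using g by (simp add: Aprime_def w_def scaleC_minus_left)
    moreover have "v = w + scaleC \<i> (a + b + c)"
      by (subst v) (simp add: w_def scaleC_add_right scaleC_2 algebra_simps flip: scaleC_scaleC)
    moreover have "y = w - scaleC \<i> (a + b + c)"
    proof -
      have "y = u - scaleC \<i> a + (- scaleC (2 * \<i>) c)" unfolding y c' val[OF au(1) b, symmetric] by (simp flip: v)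
      then show ?thesis by (simp add: w_def scaleC_add_right scaleC_2 algebra_simps flip: scaleC_scaleC)
    qed
    ultimately show "(v,y) \<in> cayley_graph (Aprime T A B)" by (auto simp: cayley_graph_def)
  qed
qed

text \<open>A pair \<open>(y, z)\<close> of the adjoint, rewritten through \<open>p\<close> and
  \<open>q\<close>, satisfies \<open>cinner v p = cinner (U v) q\<close> for all \<open>v\<close>.
  Thus \<open>U p - q\<close> is orthogonal to the range of \<open>U\<close>, which is everything,
  and \<open>(p, q)\<close> lies on the graph of \<open>U\<close>.\<close>

lemma selfadj_of_unitary_cayley:
  assumes U: "unitary (U::'h::chilbert \<Rightarrow> 'h)" and R: "\<And>v y. (v,y) \<in> cayley_graph R \<longleftrightarrow> y = U v"
  shows "selfadjK UNIV R" "cay R = U"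
proof -
  note UD = unitaryD[OF U]
  show "cay R = U" unfolding cay_def R by auto
  have RU: "(a,b) \<in> R \<longleftrightarrow> U (b + scaleC \<i> a) = b - scaleC \<i> a" for a b
  proof -
    have 1: "scaleC (- \<i> / 2) ((b + scaleC \<i> a) - (b - scaleC \<i> a)) = a"
      by (simp add: scaleC_scaleC flip: scaleC_add_left scaleC_add_right scaleC_2)
    have 2: "scaleC (1/2) ((b + scaleC \<i> a) + (b - scaleC \<i> a)) = b"
      by (simp add: scaleC_scaleC flip: scaleC_2)
    show ?thesis using cayley_graph_iff[of "b + scaleC \<i> a" "b - scaleC \<i> a" R] unfolding 1 2 R by auto
  qed
  have "(y,z) \<in> adj R \<longleftrightarrow> (y,z) \<in> R" for y z
  proof
    assume "(y,z) \<in> R"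
    then have 2: "U (z + scaleC \<i> y) = z - scaleC \<i> y" by (simp add: RU)
    have "cinner b y = cinner a z" if ab: "(a,b) \<in> R" for a b
    proof -
      have 1: "U (b + scaleC \<i> a) = b - scaleC \<i> a" using ab by (simp add: RU)
      have "cinner (b - scaleC \<i> a) (z - scaleC \<i> y) = cinner (b + scaleC \<i> a) (z + scaleC \<i> y)"
        using UD(10)[of "b + scaleC \<i> a" "z + scaleC \<i> y"] unfolding 1 2 .
      then show ?thesis by (simp add: cinner_simps algebra_simps)
    qed
    then show "(y,z) \<in> adj R" by (auto simp: adjK_def)
  next
    assume a: "(y,z) \<in> adj R"
    define p q where "p = z + scaleC \<i> y" and "q = z - scaleC \<i> y"
    have "cinner (U v) (U p - q) = 0" for v
    proof -
      have "(v, U v) \<in> cayley_graph R" by (simp add: R)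
      then obtain a' b' where ab: "(a',b') \<in> R" "v = b' + scaleC \<i> a'" "U v = b' - scaleC \<i> a'"
        by (auto simp: cayley_graph_def)
      have "cinner b' y = cinner a' z" using a ab(1) by (auto simp: adjK_def)
      then have "cinner v p = cinner (U v) q"
        unfolding ab(3) unfolding ab(2) by (simp add: p_def q_def cinner_simps algebra_simps)
      then show ?thesis by (simp add: cinner_diff_right UD(10))
    qed
    then have "cinner (U p - q) (U p - q) = 0" using UD(7) by (metis surjD)
    then have "U p = q" by (simp add: cinner_eq_zero_iff)
    then show "(y,z) \<in> R" by (simp add: RU p_def q_def)
  qed
  then show "selfadjK UNIV R" unfolding selfadjK_def by auto
qed

subsection \<open>Fredholm and proper operators\<close>

text \<open>For a bounded linear operator this amounts to finite-dimensional kernel and closed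
  range. The sequential form lets perturbation and composition arguments proceed by extracting
  subsequences.\<close>

definition proper_on_bounded :: "('h::chilbert \<Rightarrow> 'h) \<Rightarrow> bool" where
  "proper_on_bounded L \<longleftrightarrow> (\<forall>x::nat \<Rightarrow> 'h. bounded (range x) \<longrightarrow> convergent (\<lambda>n. L (x n)) \<longrightarrow>
     (\<exists>r::nat \<Rightarrow> nat. strict_mono r \<and> convergent (\<lambda>n. x (r n))))"

definition seq_compact_map :: "('h::chilbert \<Rightarrow> 'h) \<Rightarrow> bool" where
  "seq_compact_map L \<longleftrightarrow> (\<forall>x::nat \<Rightarrow> 'h. bounded (range x) \<longrightarrow>
     (\<exists>r::nat \<Rightarrow> nat. strict_mono r \<and> convergent (\<lambda>n. L (x (r n)))))"

lemma convergent_subseq: "convergent f \<Longrightarrow> strict_mono (r::nat \<Rightarrow> nat) \<Longrightarrow> convergent (\<lambda>n. f (r n))"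
  using convergent_subseq_convergent[of f r] by (simp add: comp_def)

lemma bounded_subseq: "bounded (range x) \<Longrightarrow> bounded (range (\<lambda>n. x (r n)))"
  by (rule bounded_subset) auto

lemma convergent_bounded_linear: "bounded_linear L \<Longrightarrow> convergent f \<Longrightarrow> convergent (\<lambda>n. L (f n))"
  unfolding convergent_def using bounded_linear.tendsto by blast

lemma bounded_range_linear: "bounded_linear L \<Longrightarrow> bounded (range x) \<Longrightarrow> bounded (range (\<lambda>n. L (x n)))"
  using bounded_linear_image[of "range x" L] by (simp add: image_image)

lemma compact_op_seq_compact:
  assumes "compact_op (K::'h::chilbert \<Rightarrow> 'h)"
  shows "seq_compact_map K"
  unfolding seq_compact_map_def
proof (intro allI impI)
  fix x :: "nat \<Rightarrow> 'h" assume "bounded (range x)"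
  then obtain M where M: "M > 0" "\<And>n. norm (x n) \<le> M" unfolding bounded_pos by auto
  have bl: "bounded_linear K" using assms by (simp add: compact_op_def cbounded_def)
  have sK: "K (s *\<^sub>R y) = s *\<^sub>R K y" for s y using linear_scale[OF bounded_linear.linear[OF bl]] .
  \<comment> \<open>The factor 2 puts the rescaled sequence into the open unit ball that occurs in
    \<open>compact_op\<close>.\<close>
  define y where "y n = (1 / (2 * M)) *\<^sub>R x n" for n
  have "norm (y n) < 1" for n using M(2)[of n] M(1) by (simp add: y_def field_simps)
  then have "\<forall>n. K (y n) \<in> closure (K ` ball 0 1)" by (intro allI subsetD[OF closure_subset]) simp
  moreover have "seq_compact (closure (K ` ball 0 1))"
    using assms by (simp add: compact_op_def compact_eq_seq_compact_metric)
  ultimately obtain l r where r: "strict_mono (r::nat \<Rightarrow> nat)" "((\<lambda>n. K (y n)) \<circ> r) \<longlonglongrightarrow> l"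
    unfolding seq_compact_def by meson
  have "K (x (r n)) = (2 * M) *\<^sub>R K (y (r n))" for n using M(1) by (simp add: y_def sK)
  then have "(\<lambda>n. K (x (r n))) \<longlonglongrightarrow> (2 * M) *\<^sub>R l"
    using tendsto_scaleR[OF tendsto_const r(2), of "2 * M"] by (simp add: comp_def)
  then show "\<exists>r. strict_mono r \<and> convergent (\<lambda>n. K (x (r n)))" using r(1) convergentI by blast
qed

lemma proper_on_bounded_add_compact:
  assumes L: "proper_on_bounded L" and K: "seq_compact_map K"
  shows "proper_on_bounded (\<lambda>x. L x + K x)"
  unfolding proper_on_bounded_def
proof (intro allI impI)
  fix x :: "nat \<Rightarrow> 'a" assume b: "bounded (range x)" and c: "convergent (\<lambda>n. L (x n) + K (x n))"
  obtain r where r: "strict_mono r" "convergent (\<lambda>n. K (x (r n)))" using K b unfolding seq_compact_map_def by blast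
  have "convergent (\<lambda>n. (L (x (r n)) + K (x (r n))) - K (x (r n)))"
    by (intro convergent_diff convergent_subseq[OF c r(1)] r(2))
  then have "convergent (\<lambda>n. L (x (r n)))" by simp
  then obtain s where s: "strict_mono s" "convergent (\<lambda>n. x (r (s n)))"
    using L bounded_subseq[OF b, of r] unfolding proper_on_bounded_def by blast
  then show "\<exists>r. strict_mono r \<and> convergent (\<lambda>n. x (r n))"
    using strict_mono_o[OF r(1) s(1)] by (auto simp: comp_def)
qed

text \<open>If no constant worked, unit vectors of \<open>S\<close> would have images under
  \<open>L\<close> and \<open>g\<close> tending to 0; properness extracts a limit of norm 1 in
  \<open>S\<close> annihilated by both. It is applied with \<open>g = 0\<close> off a kernel and
  with an injective \<open>g\<close> on the whole space.\<close>

lemma proper_bounded_below: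
  assumes L: "proper_on_bounded L" "bounded_linear L" and g: "bounded_linear g"
    and S: "closed S" "\<And>(r::real) x. x \<in> S \<Longrightarrow> r *\<^sub>R x \<in> S"
    and inj: "\<And>x. x \<in> S \<Longrightarrow> L x = 0 \<Longrightarrow> g x = 0 \<Longrightarrow> x = 0"
  shows "\<exists>c>0. \<forall>x\<in>S. c * norm (x::'h::chilbert) \<le> norm (L x) + norm (g x :: 'h)"
proof (rule ccontr)
  assume "\<not> ?thesis"
  then have "\<exists>x\<in>S. norm (L x) + norm (g x) < c * norm x" if "c > 0" for c using that not_le by blast
  from this[of "1 / Suc _"] have "\<exists>x\<in>S. norm (L x) + norm (g x) < (1 / Suc n) * norm x" for n
    by simp
  then obtain x where x: "x n \<in> S" "norm (L (x n)) + norm (g (x n)) < (1 / Suc n) * norm (x n)" for n by metis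
  have lL: "L (r *\<^sub>R y) = r *\<^sub>R L y" and lg: "g (r *\<^sub>R y) = r *\<^sub>R g y" for r y
    using linear_scale[OF bounded_linear.linear[OF L(2)]] linear_scale[OF bounded_linear.linear[OF g]] by auto
  have pos: "norm (x n) > 0" for n
  proof -
    have "0 < (1 / Suc n) * norm (x n)"
      using x(2)[of n] norm_ge_zero[of "L (x n)"] norm_ge_zero[of "g (x n)"] by linarith
    then show ?thesis by (simp only: zero_less_mult_iff) simp
  qed
  define z where "z n = (1 / norm (x n)) *\<^sub>R x n" for n
  have zS: "z n \<in> S" and z1: "norm (z n) = 1" for n
    using x(1) S(2) pos[of n] by (auto simp: z_def)
  have zs: "norm (L (z n)) + norm (g (z n)) \<le> 1 / Suc n" for n
  proof -
    have "norm (L (z n)) + norm (g (z n)) = (norm (L (x n)) + norm (g (x n))) / norm (x n)"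
      using pos[of n] by (simp add: z_def lL lg add_divide_distrib)
    also have "\<dots> \<le> 1 / Suc n" using x(2)[of n] pos[of n] by (subst pos_divide_le_eq) auto
    finally show ?thesis .
  qed
  have lim: "(\<lambda>n. 1 / real (Suc n)) \<longlonglongrightarrow> 0" by (rule LIMSEQ_Suc[OF lim_1_over_n])
  have L0: "(\<lambda>n. L (z n)) \<longlonglongrightarrow> 0" and g0: "(\<lambda>n. g (z n)) \<longlonglongrightarrow> 0"
  proof -
    have *: "norm (L (z n)) \<le> 1 / real (Suc n)" "norm (g (z n)) \<le> 1 / real (Suc n)" for n
      using zs[of n] norm_ge_zero[of "L (z n)"] norm_ge_zero[of "g (z n)"] by linarith+
    show "(\<lambda>n. L (z n)) \<longlonglongrightarrow> 0" "(\<lambda>n. g (z n)) \<longlonglongrightarrow> 0"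
      by (rule Lim_null_comparison[OF always_eventually lim], intro allI *)+
  qed
  have "bounded (range z)" unfolding bounded_iff using z1 by force
  then obtain r l where r: "strict_mono (r::nat\<Rightarrow>nat)" "(\<lambda>n. z (r n)) \<longlonglongrightarrow> l"
    using L(1) L0 unfolding proper_on_bounded_def convergent_def by blast
  have "l \<in> S" using closed_sequentially[OF S(1) _ r(2)] zS by blast
  moreover have "L l = 0"
    using LIMSEQ_unique[OF bounded_linear.tendsto[OF L(2) r(2)]] LIMSEQ_subseq_LIMSEQ[OF L0 r(1)] by (simp add: comp_def)
  moreover have "g l = 0"
    using LIMSEQ_unique[OF bounded_linear.tendsto[OF g r(2)]] LIMSEQ_subseq_LIMSEQ[OF g0 r(1)] by (simp add: comp_def)
  moreover have "norm l = 1" using LIMSEQ_unique[OF tendsto_norm[OF r(2)]] z1 by simp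
  ultimately show False using inj by fastforce
qed

section \<open>Finite-dimensional subspaces and convergent subsequences\<close>

definition cspan :: "'h::chilbert set \<Rightarrow> 'h set" where
  "cspan F = {\<Sum>v\<in>F. scaleC (c v) v | c. True}"

lemma csubspace_cspan: "csubspace (cspan (F::'h::chilbert set))"
proof -
  have 0: "0 \<in> cspan F" unfolding cspan_def by (auto intro!: exI[of _ "\<lambda>_. 0"])
  have a: "x + y \<in> cspan F" if xy: "x \<in> cspan F" "y \<in> cspan F" for x y
  proof -
    obtain c d where "x = (\<Sum>v\<in>F. scaleC (c v) v)" "y = (\<Sum>v\<in>F. scaleC (d v) v)"
      using xy unfolding cspan_def by blast
    then have "x + y = (\<Sum>v\<in>F. scaleC (c v + d v) v)" by (simp add: scaleC_add_left sum.distrib)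
    then show ?thesis unfolding cspan_def by (intro CollectI exI[of _ "\<lambda>v. c v + d v"]) simp
  qed
  have s: "scaleC k x \<in> cspan F" if x: "x \<in> cspan F" for x k
  proof -
    obtain c where "x = (\<Sum>v\<in>F. scaleC (c v) v)" using x by (auto simp: cspan_def)
    then have "scaleC k x = (\<Sum>v\<in>F. scaleC (k * c v) v)"
      by (simp add: linear_sum[OF bounded_linear.linear[OF bounded_linear_scaleC]] scaleC_scaleC)
    then show ?thesis unfolding cspan_def by (intro CollectI exI[of _ "\<lambda>v. k * c v"]) simp
  qed
  show ?thesis using 0 a s by (simp add: csubspace_def)
qed

lemma cspan_insert:
  assumes "finite F" "v \<notin> F"
  shows "cspan (insert v F) = {scaleC c v + s | c s. s \<in> cspan (F::'h::chilbert set)}"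
proof (intro equalityI subsetI)
  fix x assume "x \<in> cspan (insert v F)"
  then show "x \<in> {scaleC c v + s | c s. s \<in> cspan F}" using assms by (auto simp: cspan_def)
next
  fix x assume "x \<in> {scaleC c v + s | c s. s \<in> cspan F}"
  then obtain k c where "x = scaleC k v + (\<Sum>v\<in>F. scaleC (c v) v)" by (auto simp: cspan_def)
  moreover have "(\<Sum>w\<in>F. scaleC ((c(v := k)) w) w) = (\<Sum>v\<in>F. scaleC (c v) v)"
    using assms by (intro sum.cong) auto
  ultimately have "x = (\<Sum>w\<in>insert v F. scaleC ((c(v := k)) w) w)" using assms by simp
  then show "x \<in> cspan (insert v F)" unfolding cspan_def by blast
qed

lemma closedI_bounded_seq:
  assumes "\<And>x::nat \<Rightarrow> 'a::metric_space. bounded (range x) \<Longrightarrow> (\<forall>n. x n \<in> S) \<Longrightarrow>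
    \<exists>r l. strict_mono (r::nat\<Rightarrow>nat) \<and> (\<lambda>n. x (r n)) \<longlonglongrightarrow> l \<and> l \<in> S"
  shows "closed S"
  unfolding closed_sequential_limits
proof (intro allI impI, elim conjE)
  fix f l assume f: "\<forall>n. f n \<in> S" and l: "f \<longlonglongrightarrow> l"
  obtain r l' where r: "strict_mono (r::nat\<Rightarrow>nat)" "(\<lambda>n. f (r n)) \<longlonglongrightarrow> l'" "l' \<in> S"
    using assms[OF convergent_imp_bounded[OF l] f] by blast
  show "l \<in> S"
    using LIMSEQ_unique[OF r(2) LIMSEQ_subseq_LIMSEQ[OF l r(1), unfolded comp_def]] r(3) by simp
qed

text \<open>Bolzano-Weierstrass by induction on the spanning set. The new vector \<open>v\<close> is
  replaced by its part \<open>v'\<close> orthogonal to the old span, so that pairing with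
  \<open>v'\<close> bounds the coefficients; they converge along a subsequence and the induction
  hypothesis treats the rest.\<close>

lemma cspan_bounded_seq:
  assumes "finite F"
  shows "bounded (range x) \<Longrightarrow> (\<forall>n::nat. x n \<in> cspan F) \<Longrightarrow>
    \<exists>r l. strict_mono (r::nat\<Rightarrow>nat) \<and> (\<lambda>n. x (r n)) \<longlonglongrightarrow> l \<and> l \<in> cspan (F::'h::chilbert set)"
  using assms
proof (induction F arbitrary: x rule: finite_induct)
  case empty
  then have "x = (\<lambda>_. 0)" by (auto simp: cspan_def)
  then show ?case by (intro exI[of _ id] exI[of _ 0]) (auto simp: cspan_def strict_mono_def)
next
  case (insert v F)
  note cs = csubspaceD[OF csubspace_cspan[of F]]
  \<comment> \<open>The induction hypothesis itself supplies the closedness required to project onto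
    the old span.\<close>
  have "closed (cspan F)" by (rule closedI_bounded_seq) (rule insert.IH)
  then have cl: "closed_csubspace (cspan F)" using csubspace_cspan by (simp add: closed_csubspace_def)
  define p v' where "p = proj (cspan F) v" and "v' = v - p"
  have p: "p \<in> cspan F" "v' \<in> orth (cspan F)" using proj_props[OF cl] by (auto simp: p_def v'_def)
  have "\<exists>c s. s \<in> cspan F \<and> x n = scaleC c v + s" for n
    using insert.prems(2) unfolding cspan_insert[OF insert.hyps(1,2)] by blast
  then obtain c s where cS: "s n \<in> cspan F" "x n = scaleC (c n) v + s n" for n by metis
  show ?case
  proof (cases "v' = 0")
    case True
    then have "v = p" by (simp add: v'_def)
    then have "\<forall>n. x n \<in> cspan F" using cS p(1) cs(2,3) by simp
    with insert.IH[OF insert.prems(1)] obtain r l where r: "strict_mono (r::nat\<Rightarrow>nat)" "(\<lambda>n. x (r n)) \<longlonglongrightarrow> l" "l \<in> cspan F"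
      by blast
    have "l = scaleC 0 v + l" by simp
    then have "l \<in> cspan (insert v F)" using r(3) unfolding cspan_insert[OF insert.hyps(1,2)] by blast
    then show ?thesis using r by blast
  next
    case False
    define t where "t n = scaleC (c n) p + s n" for n
    have t: "t n \<in> cspan F" for n unfolding t_def by (intro cs(2,3) p cS)
    have xt: "x n = scaleC (c n) v' + t n" for n by (simp add: cS(2) t_def v'_def scaleC_diff_right)
    obtain M where M: "\<And>n. norm (x n) \<le> M" using insert.prems(1) unfolding bounded_iff by auto
    have "norm (c n) \<le> M / norm v'" for n
    proof -
      have "cinner v' (t n) = 0" using p(2) t orth_commute unfolding orth_def by blast
      then have "cinner v' (x n) = c n * of_real ((norm v')\<^sup>2)" by (simp add: xt cinner_simps cinner_self)
      then have "norm (c n) * (norm v')\<^sup>2 \<le> norm v' * norm (x n)"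
        using Cauchy_Schwarz[of v' "x n"] by (simp add: norm_mult norm_power)
      also have "\<dots> \<le> norm v' * M" using M by (simp add: mult_left_mono)
      finally have "norm v' * (norm (c n) * norm v') \<le> norm v' * M" by (simp add: power2_eq_square mult_ac)
      then have "norm (c n) * norm v' \<le> M" using False by simp
      then show ?thesis using False by (simp add: pos_le_divide_eq)
    qed
    then have "bounded (range c)" unfolding bounded_iff by auto
    then obtain r k where r: "strict_mono (r::nat\<Rightarrow>nat)" "(c \<circ> r) \<longlonglongrightarrow> k"
      using bounded_imp_convergent_subsequence by blast
    have lin: "(\<lambda>n. scaleC (c (r n)) v') \<longlonglongrightarrow> scaleC k v'"
    proof (rule tendsto_norm_zero_cancel[THEN LIM_zero_cancel])
      have "(\<lambda>n. cmod (c (r n) - k) * norm v') \<longlonglongrightarrow> 0 * norm v'"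
        using r(2) by (intro tendsto_mult tendsto_const tendsto_norm_zero LIM_zero) (simp add: comp_def)
      then show "(\<lambda>n. norm (scaleC (c (r n)) v' - scaleC k v')) \<longlonglongrightarrow> 0"
        by (simp add: norm_scaleC flip: scaleC_diff_left)
    qed
    have "bounded (range (\<lambda>n. x (r n) - scaleC (c (r n)) v'))"
      using bounded_minus_comp[of _ UNIV] bounded_subseq[OF insert.prems(1)] convergent_imp_bounded[OF lin] by blast
    then have "bounded (range (\<lambda>n. t (r n)))" by (simp add: xt)
    then obtain q l where q: "strict_mono (q::nat\<Rightarrow>nat)" "(\<lambda>n. t (r (q n))) \<longlonglongrightarrow> l" "l \<in> cspan F"
      using insert.IH[of "\<lambda>n. t (r n)"] t by blast
    have "(\<lambda>n. scaleC (c (r (q n))) v' + t (r (q n))) \<longlonglongrightarrow> scaleC k v' + l"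
      using LIMSEQ_subseq_LIMSEQ[OF lin q(1)] q(2) by (intro tendsto_add) (simp_all add: comp_def)
    then have "(\<lambda>n. x ((r \<circ> q) n)) \<longlonglongrightarrow> scaleC k v' + l" by (simp add: xt)
    moreover have "scaleC k v' + l = scaleC k v + (l - scaleC k p)" by (simp add: v'_def scaleC_diff_right)
    moreover have "l - scaleC k p \<in> cspan F" by (intro cs(3,4) p q)
    ultimately show ?thesis
      using strict_mono_o[OF r(1) q(1)] unfolding cspan_insert[OF insert.hyps(1,2)] by blast
  qed
qed

lemma fin_dim_iff: "fin_dim S \<longleftrightarrow> (\<exists>F. finite F \<and> S \<subseteq> cspan F)"
  by (simp add: fin_dim_def cspan_def)

lemma closed_csubspace_cspan: "finite F \<Longrightarrow> closed_csubspace (cspan (F::'h::chilbert set))"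
  unfolding closed_csubspace_def
  by (intro conjI csubspace_cspan closedI_bounded_seq cspan_bounded_seq)

lemma cspan_superset: "finite F \<Longrightarrow> v \<in> F \<Longrightarrow> v \<in> cspan (F::'h::chilbert set)"
proof -
  assume F: "finite F" "v \<in> F"
  have "(\<Sum>w\<in>F. scaleC (if w = v then 1 else 0) w) = (\<Sum>w\<in>F. if w = v then w else 0)" by (intro sum.cong) auto
  also have "\<dots> = v" using F by (simp add: sum.delta)
  finally show ?thesis unfolding cspan_def
    by (intro CollectI exI[of _ "\<lambda>w. if w = v then 1 else 0"]) simp
qed

lemma cspan_minimal: "csubspace S \<Longrightarrow> F \<subseteq> S \<Longrightarrow> cspan F \<subseteq> (S::'h::chilbert set)"
proof -
  assume S: "csubspace S" and F: "F \<subseteq> S"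
  have "(\<Sum>v\<in>F. scaleC (c v) v) \<in> S" for c
    using F by (induction F rule: infinite_finite_induct) (auto intro!: csubspaceD[OF S])
  then show ?thesis by (auto simp: cspan_def)
qed

lemma fin_dim_bounded_seq:
  assumes "fin_dim S" "bounded (range x)" "\<And>n. x n \<in> S"
  shows "\<exists>r. strict_mono (r::nat\<Rightarrow>nat) \<and> convergent (\<lambda>n. x (r n) :: 'h::chilbert)"
proof -
  obtain F where "finite F" "S \<subseteq> cspan F" using assms(1) by (auto simp: fin_dim_iff)
  then show ?thesis using cspan_bounded_seq[of F x] assms(2,3) unfolding convergent_def by blast
qed

text \<open>Otherwise Gram-Schmidt, run against the span of the vectors chosen so far, produces an
  infinite orthonormal sequence in \<open>S\<close>. Its members have mutual squared distance 2, so
  no subsequence is Cauchy.\<close>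

lemma fin_dimI_seq:
  assumes S: "csubspace S"
    and seq: "\<And>x::nat \<Rightarrow> 'h::chilbert. bounded (range x) \<Longrightarrow> (\<And>n. x n \<in> S) \<Longrightarrow>
      \<exists>r. strict_mono (r::nat\<Rightarrow>nat) \<and> convergent (\<lambda>n. x (r n))"
  shows "fin_dim S"
proof (rule ccontr)
  assume nf: "\<not> fin_dim S"
  define P where "P e n y \<longleftrightarrow> y \<in> S \<and> norm y = 1 \<and> (\<forall>m<n. cinner (e m) y = 0)" for e :: "nat \<Rightarrow> 'h" and n y
  have "\<exists>e. \<forall>n. P e n (e n)"
  proof (rule dependent_wellorder_choice)
    fix r x and f g :: "nat \<Rightarrow> 'h" assume "\<And>y. y < x \<Longrightarrow> f y = g y"
    then show "P f x r = P g x r" by (auto simp: P_def)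
  next
    fix n f assume f: "\<And>y. y < n \<Longrightarrow> P f y (f y)"
    define F where "F = f ` {..<n}"
    have F: "finite F" "F \<subseteq> S" using f by (auto simp: F_def P_def)
    obtain x where x: "x \<in> S" "x \<notin> cspan F" using nf F(1) unfolding fin_dim_iff by blast
    note pp = proj_props[OF closed_csubspace_cspan[OF F(1)], of x]
    define y where "y = x - proj (cspan F) x"
    have y0: "norm y > 0" using x(2) pp(1) by (auto simp: y_def)
    have yS: "y \<in> S" unfolding y_def using x(1) pp(1) cspan_minimal[OF S F(2)] csubspaceD(4)[OF S] by blast
    have "cinner (f m) y = 0" if "m < n" for m
      using pp(2) cspan_superset[OF F(1), of "f m"] that by (auto simp: F_def orth_def y_def)
    then have "P f n ((1 / norm y) *\<^sub>R y)"
      using y0 yS by (auto simp: P_def cinner_scaleR_right intro!: csubspaceD(5)[OF S])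
    then show "\<exists>r. P f n r" by blast
  qed
  then obtain e where e: "\<And>n. P e n (e n)" by blast
  have n1: "norm (e n) = 1" and eS: "e n \<in> S" for n using e by (auto simp: P_def)
  have d: "(norm (e m - e n))\<^sup>2 = 2" if "m < n" for m n
    using e[of n] that by (simp add: norm_diff_sq n1 P_def)
  have "bounded (range e)" unfolding bounded_iff using n1 by force
  then obtain r where r: "strict_mono (r::nat\<Rightarrow>nat)" "convergent (\<lambda>n. e (r n))" using seq[of e] eS by blast
  then have "Cauchy (\<lambda>n. e (r n))" by (simp add: Cauchy_convergent_iff)
  then obtain N where "\<And>m n. m \<ge> N \<Longrightarrow> n \<ge> N \<Longrightarrow> norm (e (r m) - e (r n)) < 1"
    unfolding Cauchy_def dist_norm by (meson zero_less_one)
  then have "norm (e (r N) - e (r (Suc N))) < 1" by simp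
  then have "(norm (e (r N) - e (r (Suc N))))\<^sup>2 < 1" by (simp add: power_less_one_iff)
  then show False using d[of "r N" "r (Suc N)"] strict_monoD[OF r(1), of N "Suc N"] by simp
qed

section \<open>Fredholm criterion for \<open>1 + U\<close> with \<open>U\<close> unitary\<close>

lemma cbounded_one_plus:
  assumes "unitary (U::'h::chilbert \<Rightarrow> 'h)" shows "cbounded (\<lambda>x. U x + x)"
  using unitaryD[OF assms] by (auto simp: cbounded_def scaleC_add_right intro: bounded_linear_add bounded_linear_ident)

lemma csubspace_range: "cbounded (L::'h::chilbert \<Rightarrow> 'h) \<Longrightarrow> csubspace (range L)"
proof -
  assume L: "cbounded L"
  then have *: "L (x + y) = L x + L y" "scaleC c (L x) = L (scaleC c x)" for x y c
    using linear_add[OF bounded_linear.linear] by (auto simp: cbounded_def)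
  have "0 \<in> range L" using *(2)[of 0 0] by (metis rangeI scaleC_zero_left)
  then show ?thesis unfolding csubspace_def using * by (auto simp: image_iff) metis+
qed

lemma closed_csubspace_kernel: "cbounded (L::'h::chilbert \<Rightarrow> 'h) \<Longrightarrow> closed_csubspace {x. L x = 0}"
proof -
  assume L: "cbounded L"
  then have bl: "bounded_linear L" and c: "\<And>c x. L (scaleC c x) = scaleC c (L x)" by (auto simp: cbounded_def)
  have "closed {x. L x = 0}"
    by (intro closed_Collect_eq continuous_intros bounded_linear.continuous_on[OF bl])
  then show ?thesis
    using linear_add[OF bounded_linear.linear[OF bl]] linear_0[OF bounded_linear.linear[OF bl]] c
    by (auto simp: closed_csubspace_def csubspace_def)
qed

text \<open>In effect the adjoint of \<open>1 + U\<close> is \<open>1 + U\<close> followed by the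
  inverse of \<open>U\<close>. Hence kernel and cokernel of \<open>1 + U\<close> are controlled by
  each other.\<close>

lemma cinner_one_plus_unitary:
  assumes "unitary (U::'h::chilbert \<Rightarrow> 'h)"
  shows "cinner z (U y + y) = cinner (U z + z) (U y)"
  by (simp add: cinner_simps unitaryD[OF assms])

lemma range_one_plus_subset:
  assumes "unitary (U::'h::chilbert \<Rightarrow> 'h)"
  shows "range (\<lambda>x. U x + x) \<subseteq> orth {x. U x + x = 0}"
  unfolding orth_def using cinner_one_plus_unitary[OF assms] by auto

lemma orth_range_one_plus:
  assumes U: "unitary (U::'h::chilbert \<Rightarrow> 'h)"
  shows "orth (range (\<lambda>x. U x + x)) \<subseteq> {x. U x + x = 0}"
proof
  fix y assume "y \<in> orth (range (\<lambda>x. U x + x))"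
  then have "cinner y (U z + z) = 0" for z using orth_commute[of y] by (auto simp: orth_def)
  then have "cinner (U y + y) (U z) = 0" for z by (simp add: cinner_one_plus_unitary[OF U])
  then have "cinner (U y + y) (U y + y) = 0" using unitaryD(7)[OF U] by (metis surjD)
  then show "y \<in> {x. U x + x = 0}" by (simp add: cinner_eq_zero_iff)
qed

text \<open>Gliding hump: otherwise there are unit vectors \<open>z n\<close> in the closed range with \<open>U z + z\<close> tending
  to 0 faster than any fixed geometric rate, and \<open>\<Sum> \<plusminus> 3\<^sup>-\<^sup>n z n\<close> with suitable signs cannot lie in the range.\<close>
lemma closed_range_bounded_below:
  assumes U: "unitary (U::'h::chilbert \<Rightarrow> 'h)" and cl: "closed (range (\<lambda>x. U x + x))"
  shows "\<exists>c>0. \<forall>z\<in>orth {x. U x + x = 0}. c * norm z \<le> norm (U z + z)"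
proof (rule ccontr)
  define L where "L x = U x + x" for x
  define M where "M = orth {x. L x = 0}"
  assume "\<not> ?thesis"
  then have "\<exists>z\<in>M. norm (L z) < c * norm z" if "c > 0" for c using that not_le unfolding M_def L_def by blast
  \<comment> \<open>The ratio 1/12 is set against the weights \<open>(1/3)^n\<close> used below: the
    quotient \<open>4^n\<close> outgrows every fixed \<open>norm y\<close>.\<close>
  from this[of "(1/12)^_"] have "\<exists>z\<in>M. norm (L z) < (1/12)^n * norm z" for n :: nat by simp
  then obtain z' where z': "z' n \<in> M" "norm (L (z' n)) < (1/12)^n * norm (z' n)" for n :: nat by metis
  have pos: "norm (z' n) > 0" for n
  proof -
    have "0 < (1/12)^n * norm (z' n)" using z'(2)[of n] norm_ge_zero[of "L (z' n)"] by linarith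
    then show ?thesis by (simp only: zero_less_mult_iff) simp
  qed
  have cM: "closed_csubspace M" unfolding M_def by (rule orth_csubspace)
  then have sM: "csubspace M" by (simp add: closed_csubspace_def)
  define z where "z n = (1 / norm (z' n)) *\<^sub>R z' n" for n
  have zM: "z n \<in> M" for n unfolding z_def by (intro csubspaceD(5)[OF sM] z')
  have z1: "norm (z n) = 1" for n using pos[of n] by (simp add: z_def)
  have Lz: "norm (L (z n)) \<le> (1/12)^n" for n
  proof -
    have "L (z n) = (1 / norm (z' n)) *\<^sub>R L (z' n)" by (simp add: L_def z_def unitaryD[OF U] scaleR_add_right)
    then have "norm (L (z n)) = norm (L (z' n)) / norm (z' n)" using pos[of n] by simp
    also have "\<dots> \<le> (1/12)^n" using z'(2)[of n] pos[of n] by (subst pos_divide_le_eq) auto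
    finally show ?thesis .
  qed
  \<comment> \<open>The sign agrees with that of the component along \<open>z n\<close> already
    present, so the new term cannot cancel it.\<close>
  define sg :: "'h \<Rightarrow> nat \<Rightarrow> real" where "sg x n = (if Re (cinner (z n) x) \<ge> 0 then 1 else - 1)" for x n
  define X where "X = rec_nat (0::'h) (\<lambda>n x. x + (sg x n * (1/3)^n) *\<^sub>R z n)"
  have X: "X 0 = 0" "X (Suc n) = X n + (sg (X n) n * (1/3)^n) *\<^sub>R z n" for n by (auto simp: X_def)
  have XM: "X n \<in> M" for n
    by (induction n) (auto simp: X intro!: csubspaceD[OF sM] zM)
  have big: "(1/3)^n \<le> \<bar>Re (cinner (z n) (X (Suc n)))\<bar>" for n
  proof -
    have "Re (cinner (z n) (X (Suc n))) = Re (cinner (z n) (X n)) + sg (X n) n * (1/3)^n"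
      by (simp add: X cinner_simps cinner_self z1 flip: of_real_power of_real_mult)
    moreover have "(0::real) < (1/3)^n" by simp
    ultimately show ?thesis unfolding sg_def by (auto simp: abs_if split: if_splits)
  qed
  have step: "norm (X (Suc n) - X n) \<le> (1/3)^n" for n by (simp add: X z1 sg_def)
  \<comment> \<open>Partial geometric sum of the step bounds \<open>(1/3)^k\<close> from
    \<open>k = n\<close> on; the full tail is \<open>3/2 * (1/3)^n\<close>.\<close>
  have tail: "norm (X (n + j) - X n) \<le> 3/2 * (1/3)^n * (1 - (1/3)^j)" for n j
  proof (induction j)
    case (Suc j)
    have "norm (X (n + Suc j) - X n) \<le> norm (X (Suc (n + j)) - X (n + j)) + norm (X (n + j) - X n)"
      using norm_triangle_ineq[of "X (Suc (n + j)) - X (n + j)" "X (n + j) - X n"] by simp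
    also have "\<dots> \<le> (1/3)^(n + j) + 3/2 * (1/3)^n * (1 - (1/3)^j)" using step[of "n + j"] Suc.IH by linarith
    also have "\<dots> = 3/2 * (1/3)^n * (1 - (1/3)^Suc j)"
    proof -
      have "a * b + 3/2 * a * (1 - b) = 3/2 * a * (1 - 1/3 * b)" for a b :: real by (simp add: field_simps)
      then show ?thesis by (simp only: power_add power_Suc)
    qed
    finally show ?case .
  qed simp
  have tail': "norm (X (n + j) - X n) \<le> 3/2 * (1/3)^n" for n j
  proof -
    have "3/2 * (1/3)^n * (1 - (1/3)^j) \<le> 3/2 * (1/3)^n * (1::real)" by (intro mult_left_mono) auto
    then show ?thesis using tail[of n j] by linarith
  qed
  have "Cauchy X"
  proof (rule CauchyI')
    fix e :: real assume e: "e > 0"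
    obtain N where N: "(1/3::real)^N < e / 2" using e real_arch_pow_inv[of "e/2" "1/3"] by auto
    have "norm (X m - X n) < e" if "m \<ge> N" "n > m" for m n
    proof -
      have "norm (X n - X m) \<le> 3/2 * (1/3)^m" using tail'[of m "n - m"] that by simp
      moreover have "(1/3::real)^m \<le> (1/3)^N" using that by (intro power_decreasing) auto
      ultimately show ?thesis using N e unfolding norm_minus_commute[of "X m"] by linarith
    qed
    then show "\<exists>N. \<forall>m\<ge>N. \<forall>n>m. dist (X m) (X n) < e" by (auto simp: dist_norm)
  qed
  then obtain x where x: "X \<longlonglongrightarrow> x" using Cauchy_convergent_iff convergent_def by blast
  have "x \<in> M" using closed_sequentially[OF _ XM x] cM by (simp add: closed_csubspace_def)
  \<comment> \<open>A closed range whose complement inside \<open>M\<close> is trivial fills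
    \<open>M\<close>, the complement of the kernel.\<close>
  have "x \<in> range L"
  proof (rule orth_trivial_imp_all[OF _ sM _ _ \<open>x \<in> M\<close>])
    show "closed_csubspace (range L)"
      using cl csubspace_range[OF cbounded_one_plus[OF U]] by (simp add: closed_csubspace_def L_def[abs_def])
    show "range L \<subseteq> M" using range_one_plus_subset[OF U] by (simp add: M_def L_def[abs_def])
    fix y assume "y \<in> M" "y \<in> orth (range L)"
    moreover then have "L y = 0" using orth_range_one_plus[OF U] by (auto simp: L_def[abs_def])
    ultimately have "cinner y y = 0" by (simp add: M_def orth_def)
    then show "y = 0" by (simp add: cinner_eq_zero_iff)
  qed
  then obtain y where y: "x = L y" by blast
  \<comment> \<open>At stage \<open>Suc n\<close> the component along \<open>z n\<close> is at least
    \<open>(1/3)^n\<close>, and the tail removes at most \<open>3/2 * (1/3)^Suc n\<close>, which is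
    half of that. Moving \<open>L\<close> over to \<open>z n\<close> bounds the remainder by
    \<open>(1/12)^n * norm y\<close>.\<close>
  have "(1/2) * 4^n \<le> norm y" for n
  proof -
    have "(\<lambda>j. norm (X (j + Suc n) - X (Suc n))) \<longlonglongrightarrow> norm (x - X (Suc n))"
      by (intro tendsto_intros LIMSEQ_ignore_initial_segment x)
    then have "norm (x - X (Suc n)) \<le> 3/2 * (1/3)^Suc n"
      by (rule Lim_bounded[where M = 0]) (use tail'[of "Suc n"] in \<open>simp add: add.commute\<close>)
    then have "\<bar>Re (cinner (z n) (x - X (Suc n)))\<bar> \<le> (1/2) * (1/3)^n"
      using Re_cinner_le[of "z n" "x - X (Suc n)"] by (simp add: z1)
    then have 1: "(1/2) * (1/3)^n \<le> \<bar>Re (cinner (z n) x)\<bar>"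
      using big[of n] unfolding cinner_diff_right minus_complex.simps by linarith
    have "Re (cinner (z n) x) = Re (cinner (L (z n)) (U y))"
      by (simp add: y L_def cinner_one_plus_unitary[OF U])
    then have "\<bar>Re (cinner (z n) x)\<bar> \<le> (1/12)^n * norm y"
      using Re_cinner_le[of "L (z n)" "U y"] mult_right_mono[OF Lz[of n] norm_ge_zero[of y]] by (simp add: unitaryD(6)[OF U])
    with 1 have "12^n * ((1/2) * (1/3)^n) \<le> 12^n * ((1/12)^n * norm y)" by (intro mult_left_mono) auto
    moreover have "(12::real)^n * (1/3)^n = 4^n" "(12::real)^n * (1/12)^n = 1"
      by (simp_all flip: power_mult_distrib)
    ultimately show ?thesis by (simp only: mult.left_commute[of "12^n"] mult.assoc[symmetric])
  qed
  note lower = this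
  obtain n where "2 * norm y < 4^n" using real_arch_pow[of 4 "2 * norm y"] by auto
  then show False using lower[of n] by linarith
qed

text \<open>From Fredholm to proper, a sequence splits into a kernel part, compact by finite
  dimension, and a complementary part controlled by the lower bound. Conversely properness gives a
  finite-dimensional kernel and a lower bound off it, hence closed range; the cokernel lies in the
  kernel.\<close>

lemma fredholm_iff_proper:
  assumes U: "unitary (U::'h::chilbert \<Rightarrow> 'h)"
  shows "cfredholm (\<lambda>x. U x + x) \<longleftrightarrow> proper_on_bounded (\<lambda>x. U x + x)"
proof
  define L where "L = (\<lambda>x. U x + x)"
  define N where "N = {x. L x = 0}"
  have cb: "cbounded L" unfolding L_def by (rule cbounded_one_plus[OF U])
  then have bl: "bounded_linear L" by (simp add: cbounded_def)
  have cN: "closed_csubspace N" unfolding N_def by (rule closed_csubspace_kernel[OF cb])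
  then have sN: "csubspace N" by (simp add: closed_csubspace_def)
  have cO: "closed (orth N)" "csubspace (orth N)" using orth_csubspace by (auto simp: closed_csubspace_def)
  note pN = proj_props[OF cN]
  have Lproj: "L (x - proj N x) = L x" for x
    using pN(1)[of x] linear_diff[OF bounded_linear.linear[OF bl]] by (simp add: N_def)
  \<comment> \<open>Shared by both directions: a lower bound off the kernel turns convergence of the
    images into the Cauchy property of the components orthogonal to the kernel.\<close>
  have Cau: "Cauchy (\<lambda>n. x n - proj N (x n))"
    if c: "c > 0" "\<And>z. z \<in> orth N \<Longrightarrow> c * norm z \<le> norm (L z)" and conv: "convergent (\<lambda>n. L (x n))"
    for c and x :: "nat \<Rightarrow> 'h"
  proof (rule metric_CauchyI)
    fix e :: real assume e: "e > 0"
    have "Cauchy (\<lambda>n. L (x n))" using conv by (simp add: Cauchy_convergent_iff)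
    then obtain M where M: "\<And>m n. m \<ge> M \<Longrightarrow> n \<ge> M \<Longrightarrow> norm (L (x m) - L (x n)) < c * e"
      using c(1) e unfolding Cauchy_def dist_norm by (meson mult_pos_pos)
    have "norm ((x m - proj N (x m)) - (x n - proj N (x n))) < e" if mn: "m \<ge> M" "n \<ge> M" for m n
    proof -
      have "c * norm ((x m - proj N (x m)) - (x n - proj N (x n))) \<le> norm (L ((x m - proj N (x m)) - (x n - proj N (x n))))"
        by (intro c(2) csubspaceD(4)[OF cO(2)] pN)
      also have "\<dots> = norm (L (x m) - L (x n))" by (simp only: linear_diff[OF bounded_linear.linear[OF bl], of "x m - _" "x n - _"] Lproj)
      also have "\<dots> < c * e" by (rule M[OF mn])
      finally show ?thesis using c(1) by simp
    qed
    then show "\<exists>M. \<forall>m\<ge>M. \<forall>n\<ge>M. dist (x m - proj N (x m)) (x n - proj N (x n)) < e" by (auto simp: dist_norm)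
  qed
  show "proper_on_bounded (\<lambda>x. U x + x)" if F: "cfredholm (\<lambda>x. U x + x)"
  proof -
    have F': "fin_dim N" "closed (range L)" using F by (auto simp: cfredholm_def N_def L_def)
    obtain c where c: "c > 0" "\<And>z. z \<in> orth N \<Longrightarrow> c * norm z \<le> norm (L z)"
      using closed_range_bounded_below[OF U] F'(2) unfolding L_def N_def by blast
    have "\<exists>r. strict_mono (r::nat\<Rightarrow>nat) \<and> convergent (\<lambda>n. x (r n))"
      if b: "bounded (range x)" and conv: "convergent (\<lambda>n. L (x n))" for x :: "nat \<Rightarrow> 'h"
    proof -
      have zc: "convergent (\<lambda>n. x n - proj N (x n))"
        using Cau[OF c conv] by (simp add: Cauchy_convergent_iff)
      then obtain l where l: "(\<lambda>n. x n - proj N (x n)) \<longlonglongrightarrow> l" by (auto simp: convergent_def)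
      have "bounded (range (\<lambda>n. x n - (x n - proj N (x n))))"
        using bounded_minus_comp[of x UNIV "\<lambda>n. x n - proj N (x n)"] b convergent_imp_bounded[OF l] by blast
      then have "bounded (range (\<lambda>n. proj N (x n)))" by simp
      then obtain r where r: "strict_mono (r::nat\<Rightarrow>nat)" "convergent (\<lambda>n. proj N (x (r n)))"
        using fin_dim_bounded_seq[OF F'(1), of "\<lambda>n. proj N (x n)"] pN(1) by blast
      have "convergent (\<lambda>n. (x (r n) - proj N (x (r n))) + proj N (x (r n)))"
        by (intro convergent_add convergent_subseq[OF zc r(1)] r(2))
      then show ?thesis using r(1) by auto
    qed
    then show ?thesis unfolding proper_on_bounded_def L_def by blast
  qed
  show "cfredholm (\<lambda>x. U x + x)" if P: "proper_on_bounded (\<lambda>x. U x + x)"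
  proof -
    have P': "proper_on_bounded L" using P by (simp add: L_def)
    have fN: "fin_dim N"
    proof (rule fin_dimI_seq[OF sN])
      fix x :: "nat \<Rightarrow> 'h" assume "bounded (range x)" and x: "\<And>n. x n \<in> N"
      moreover have "convergent (\<lambda>n. L (x n))" using x by (simp add: N_def convergent_const)
      ultimately show "\<exists>r. strict_mono (r::nat\<Rightarrow>nat) \<and> convergent (\<lambda>n. x (r n))"
        using P' unfolding proper_on_bounded_def by blast
    qed
    have "\<exists>c>0. \<forall>x\<in>orth N. c * norm x \<le> norm (L x) + norm ((\<lambda>_. 0::'h) x)"
    proof (rule proper_bounded_below[OF P' bl bounded_linear_zero cO(1)])
      show "r *\<^sub>R x \<in> orth N" if "x \<in> orth N" for r x by (rule csubspaceD(5)[OF cO(2) that])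
      fix x assume "x \<in> orth N" "L x = 0"
      then have "cinner x x = 0" by (simp add: N_def orth_def)
      then show "x = 0" by (simp add: cinner_eq_zero_iff)
    qed
    then obtain c where c: "c > 0" "\<And>z. z \<in> orth N \<Longrightarrow> c * norm z \<le> norm (L z)" by auto
    have "closed (range L)"
      unfolding closed_sequential_limits
    proof (intro allI impI, elim conjE)
      fix f l assume f: "\<forall>n::nat. f n \<in> range L" and l: "f \<longlonglongrightarrow> l"
      have "\<exists>y. f n = L y" for n using f by blast
      then obtain x where x: "f n = L (x n)" for n by metis
      have "convergent (\<lambda>n. L (x n))" using convergentI[OF l] unfolding x[abs_def] .
      then obtain y where y: "(\<lambda>n. x n - proj N (x n)) \<longlonglongrightarrow> y"
        using Cau[OF c] by (auto simp: Cauchy_convergent_iff convergent_def)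
      have "f \<longlonglongrightarrow> L y" using bounded_linear.tendsto[OF bl y] by (simp add: Lproj x[abs_def, symmetric])
      then show "l \<in> range L" using LIMSEQ_unique[OF l] by blast
    qed
    moreover have "fin_dim (orth (range L))"
      using fN orth_range_one_plus[OF U] unfolding fin_dim_def N_def L_def by blast
    ultimately show ?thesis using cb fN by (simp add: cfredholm_def N_def L_def)
  qed
qed

lemma ess_spec_iff_proper:
  assumes "unitary (U::'h::chilbert \<Rightarrow> 'h)"
  shows "- 1 \<notin> ess_spec U \<longleftrightarrow> proper_on_bounded (\<lambda>x. U x + x)"
  using fredholm_iff_proper[OF assms] by (simp add: ess_spec_def)

subsection \<open>Reduction of a unitary operator along an injective operator\<close>

text \<open>\<open>gs\<close> plays the role of the adjoint of \<open>g\<close>.  The Cayley pairs of the reduced relation are \<open>(v, v - 2 g u)\<close>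
  with \<open>(1 + U) u = (1 - U) g\<^sup>* (v - g u)\<close>; solving for \<open>u\<close> inverts \<open>(1 + U) + (1 - U) g\<^sup>* g\<close>.\<close>
definition reduction_op :: "('h::chilbert \<Rightarrow> 'h) \<Rightarrow> ('h \<Rightarrow> 'h) \<Rightarrow> ('h \<Rightarrow> 'h) \<Rightarrow> 'h \<Rightarrow> 'h" where
  "reduction_op U g gs x = (x + gs (g x)) + U (x - gs (g x))"

definition reduction :: "('h::chilbert \<Rightarrow> 'h) \<Rightarrow> ('h \<Rightarrow> 'h) \<Rightarrow> ('h \<Rightarrow> 'h) \<Rightarrow> 'h \<Rightarrow> 'h" where
  "reduction U g gs v = v - 2 *\<^sub>R g (inv (reduction_op U g gs) (gs v - U (gs v)))"

text \<open>Injectivity of \<open>g\<close> need not bound \<open>g\<close> from below; properness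
  of \<open>U + 1\<close> supplies the missing coercivity, since it controls everything outside a
  finite-dimensional kernel.\<close>

locale admissible =
  fixes U g gs :: "'h::chilbert \<Rightarrow> 'h"
  assumes unitary_U: "unitary U"
    and proper_U: "proper_on_bounded (\<lambda>x. U x + x)"
    and cbounded_g: "cbounded g" and cbounded_gs: "cbounded gs"
    and adjoint: "cinner (g x) y = cinner x (gs y)"
    and inj_g: "g x = 0 \<Longrightarrow> x = 0"
begin

abbreviation "F \<equiv> reduction_op U g gs"
abbreviation "R \<equiv> inv (reduction_op U g gs)"
abbreviation "V \<equiv> reduction U g gs"

lemmas UD = unitaryD[OF unitary_U]

lemma bl_g: "bounded_linear g" and bl_gs: "bounded_linear gs"
  and g_scaleC: "g (scaleC c x) = scaleC c (g x)" and gs_scaleC: "gs (scaleC c x) = scaleC c (gs x)"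
  using cbounded_g cbounded_gs by (auto simp: cbounded_def)

lemmas g_lin = linear_add[OF bounded_linear.linear[OF bl_g]] linear_diff[OF bounded_linear.linear[OF bl_g]]
  linear_neg[OF bounded_linear.linear[OF bl_g]] linear_0[OF bounded_linear.linear[OF bl_g]]
  linear_scale[OF bounded_linear.linear[OF bl_g]]
lemmas gs_lin = linear_add[OF bounded_linear.linear[OF bl_gs]] linear_diff[OF bounded_linear.linear[OF bl_gs]]
  linear_neg[OF bounded_linear.linear[OF bl_gs]] linear_0[OF bounded_linear.linear[OF bl_gs]]
  linear_scale[OF bounded_linear.linear[OF bl_gs]]

lemma bounded_linear_F: "bounded_linear F"
  unfolding reduction_op_def[abs_def]
  by (intro bounded_linear_add bounded_linear_ident bounded_linear_sub bounded_linear_compose[OF bl_gs bl_g]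
      bounded_linear_compose[OF UD(11)])

lemma F_scaleC: "F (scaleC c x) = scaleC c (F x)"
  by (simp add: reduction_op_def UD(5) g_scaleC gs_scaleC flip: scaleC_add_right scaleC_diff_right)

lemma cbounded_F: "cbounded F"
  using bounded_linear_F F_scaleC by (simp add: cbounded_def)

lemma adjoint': "cinner (gs y) x = cinner y (g x)"
  using adjoint[of x y] cinner_commute by metis

text \<open>Two estimates are combined: smallness of \<open>F x\<close> makes \<open>g x\<close>
  small, and smallness of both \<open>F x\<close> and \<open>g x\<close> makes
  \<open>U x + x\<close> small as well. The constant \<open>c0\<close> then bounds
  \<open>x\<close>.\<close>

lemma F_bounded_below: "\<exists>c>0. \<forall>x. c * norm x \<le> norm (F x)"
proof -
  have "\<exists>c>0. \<forall>x\<in>UNIV. c * norm x \<le> norm (U x + x) + norm (g x)"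
    by (rule proper_bounded_below[OF proper_U _ bl_g])
      (use inj_g cbounded_one_plus[OF unitary_U] in \<open>auto simp: cbounded_def\<close>)
  then obtain c0 where c0: "c0 > 0" "\<And>x. c0 * norm x \<le> norm (U x + x) + norm (g x)" by auto
  obtain G where G: "G > 0" "\<And>x. norm (g x) \<le> G * norm x"
    using bounded_linear.pos_bounded[OF bl_g] by (metis mult.commute)
  obtain G' where G': "G' > 0" "\<And>x. norm (gs x) \<le> G' * norm x"
    using bounded_linear.pos_bounded[OF bl_gs] by (metis mult.commute)
  define E where "E = 2 * G' + 1"
  define D where "D = 1 + G' * G"
  have ED: "E > 0" "D > 0" using G(1) G'(1) by (auto simp: E_def D_def add_pos_pos)
  have N: "norm (gs (g x)) \<le> G' * G * norm x" for x
    using order_trans[OF G'(2)[of "g x"] mult_left_mono[OF G(2)[of x] less_imp_le[OF G'(1)]]]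
    by (simp add: mult.assoc)
  \<comment> \<open>The difference of the squared norms of \<open>x + gs (g x)\<close> and
    \<open>x - gs (g x)\<close> is four times that of \<open>g x\<close>. As \<open>U\<close> is
    isometric, the difference of the norms is at most \<open>norm (F x)\<close>.\<close>
  have q1: "(norm (g x))\<^sup>2 \<le> D * norm (F x) * norm x" for x
  proof -
    let ?p = "norm (x + gs (g x))" and ?q = "norm (x - gs (g x))"
    have "4 * (norm (g x))\<^sup>2 = ?p\<^sup>2 - ?q\<^sup>2"
      using adjoint[of x "g x"] by (simp add: norm_add_sq norm_diff_sq Re_cinner_self flip: adjoint)
    also have "\<dots> = (?p - ?q) * (?p + ?q)" by (simp add: power2_eq_square algebra_simps)
    also have "\<dots> \<le> norm (F x) * (4 * (D * norm x))"
    proof (rule mult_mono)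
      have "?p \<le> norm (F x) + norm (U (x - gs (g x)))"
        using norm_triangle_ineq4[of "F x" "U (x - gs (g x))"] by (simp add: reduction_op_def)
      then show "?p - ?q \<le> norm (F x)" by (simp add: UD(6))
      have "?p + ?q \<le> 2 * norm x + 2 * norm (gs (g x))"
        using norm_triangle_ineq[of x "gs (g x)"] norm_triangle_ineq4[of x "gs (g x)"] by linarith
      also have "\<dots> \<le> 2 * (D * norm x)" using N[of x] by (simp add: D_def algebra_simps)
      also have "\<dots> \<le> 4 * (D * norm x)" using ED by simp
      finally show "?p + ?q \<le> 4 * (D * norm x)" .
    qed auto
    finally show ?thesis by (simp add: mult_ac)
  qed
  have q2: "c0 * norm x \<le> norm (F x) + E * norm (g x)" for x
  proof -
    have "U x + x = F x - (gs (g x) - U (gs (g x)))" by (simp add: reduction_op_def UD(2))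
    then have "norm (U x + x) \<le> norm (F x) + (norm (gs (g x)) + norm (U (gs (g x))))"
      using norm_triangle_ineq4[of "F x" "gs (g x) - U (gs (g x))"] norm_triangle_ineq4[of "gs (g x)" "U (gs (g x))"] by simp
    also have "\<dots> \<le> norm (F x) + 2 * (G' * norm (g x))" using G'(2)[of "g x"] by (simp add: UD(6))
    finally show ?thesis using c0(2)[of x] by (simp add: E_def algebra_simps)
  qed
  \<comment> \<open>Either \<open>norm (F x)\<close> is at least \<open>c0 / 2 * norm x\<close>, or
    \<open>q2\<close> leaves \<open>c0 / 2 * norm x\<close> below \<open>E * norm (g x)\<close>;
    squaring this and inserting \<open>q1\<close> produces the second entry.\<close>
  define c where "c = min (c0 / 2) (c0\<^sup>2 / (4 * E\<^sup>2 * D))"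
  have "c * norm x \<le> norm (F x)" for x
  proof (cases "norm (F x) \<ge> c0 / 2 * norm x \<or> x = 0")
    case True
    have "c * norm x \<le> c0 / 2 * norm x" by (intro mult_right_mono) (auto simp: c_def)
    then show ?thesis using True by auto
  next
    case False
    then have x: "norm x > 0" and "c0 / 2 * norm x \<le> E * norm (g x)" using q2[of x] by auto
    then have "(c0 / 2 * norm x)\<^sup>2 \<le> (E * norm (g x))\<^sup>2" using c0(1) by (intro power_mono) auto
    also have "\<dots> \<le> E\<^sup>2 * (D * norm (F x) * norm x)" using q1[of x] by (simp add: power_mult_distrib mult_left_mono)
    finally have "norm x * (c0\<^sup>2 * norm x) \<le> norm x * (4 * E\<^sup>2 * D * norm (F x))"
      by (simp add: power2_eq_square mult_ac)
    then have "c0\<^sup>2 * norm x \<le> 4 * E\<^sup>2 * D * norm (F x)" using x by simp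
    then have "c0\<^sup>2 / (4 * E\<^sup>2 * D) * norm x \<le> norm (F x)" using ED by (simp add: field_simps)
    moreover have "c * norm x \<le> c0\<^sup>2 / (4 * E\<^sup>2 * D) * norm x" by (intro mult_right_mono) (auto simp: c_def)
    ultimately show ?thesis by linarith
  qed
  moreover have "c > 0" using c0(1) ED by (simp add: c_def)
  ultimately show ?thesis by blast
qed

lemma inj_F: "inj F"
proof -
  obtain c where "c > 0" "\<And>x. c * norm x \<le> norm (F x)" using F_bounded_below by blast
  then have "F x = 0 \<Longrightarrow> x = 0" for x by (metis norm_zero mult_le_0_iff norm_le_zero_iff not_le)
  then show ?thesis using linear_injective_0[OF bounded_linear.linear[OF bounded_linear_F]] by blast
qed

text \<open>The lower bound closes the range. For \<open>y = U w\<close> orthogonal to it,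
  \<open>(y + w) + gs (g (y - w)) = 0\<close>. Pairing with \<open>y - w\<close> and using that
  \<open>y\<close> and \<open>w\<close> have equal norm gives \<open>g (y - w) = 0\<close>, so
  \<open>y = w\<close> and then \<open>2 y = 0\<close>.\<close>

lemma surj_F: "surj F"
proof -
  obtain c where c: "c > 0" "\<And>x. c * norm x \<le> norm (F x)" using F_bounded_below by blast
  have "complete (range F)"
    by (rule complete_isometric_image[OF c(1) subspace_UNIV bounded_linear_F])
      (use c(2) in \<open>auto simp: mult.commute complete_UNIV\<close>)
  then have S: "closed_csubspace (range F)"
    using csubspace_range[OF cbounded_F] by (simp add: closed_csubspace_def complete_imp_closed)
  have triv: "y = 0" if y: "y \<in> orth (range F)" for y
  proof -
    obtain w where w: "y = U w" using UD(7) by (metis surjD)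
    have "cinner x ((y + w) + gs (g (y - w))) = 0" for x
    proof -
      have "cinner (F x) y = 0" using y by (auto simp: orth_def)
      moreover have "cinner (U (x - gs (g x))) y = cinner (x - gs (g x)) w" unfolding w by (rule UD(10))
      ultimately show ?thesis
        by (simp add: reduction_op_def cinner_add_left cinner_add_right cinner_diff_left cinner_diff_right
            adjoint adjoint' g_lin gs_lin) (simp add: algebra_simps)
    qed
    then have e: "(y + w) + gs (g (y - w)) = 0" by (metis cinner_eq_zero_iff)
    have "Re (cinner (y - w) (y + w)) = (norm y)\<^sup>2 - (norm w)\<^sup>2"
      using Re_cinner_commute[of y w] by (simp add: cinner_simps Re_cinner_self)
    also have "\<dots> = 0" by (simp add: w UD(6))
    finally have "Re (cinner (y - w) (gs (g (y - w)))) = 0"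
      using arg_cong[OF e, of "\<lambda>t. Re (cinner (y - w) t)"] by (simp add: cinner_add_right)
    then have "g (y - w) = 0" by (simp add: Re_cinner_self flip: adjoint)
    then have "y = w" using inj_g by fastforce
    with e have "2 *\<^sub>R y = 0" by (simp add: g_lin gs_lin scaleR_2)
    then show "y = 0" by simp
  qed
  have "x \<in> range F" for x
    by (rule orth_trivial_imp_all[OF S _ subset_UNIV triv UNIV_I]) (simp add: csubspace_def)
  then show ?thesis by blast
qed

lemma FR: "F (R y) = y" and RF: "R (F x) = x"
  using surj_f_inv_f[OF surj_F] inv_f_f[OF inj_F] by auto

lemma bounded_linear_R: "bounded_linear R"
proof -
  obtain c where c: "c > 0" "\<And>x. c * norm x \<le> norm (F x)" using F_bounded_below by blast
  note l = bounded_linear.linear[OF bounded_linear_F]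
  show ?thesis
  proof (rule bounded_linear_intro[of _ "1 / c"])
    show "R (x + y) = R x + R y" for x y by (metis FR RF linear_add[OF l])
    show "R (r *\<^sub>R x) = r *\<^sub>R R x" for r x by (metis FR RF linear_scale[OF l])
    show "norm (R x) \<le> norm x * (1 / c)" for x using c(2)[of "R x"] c(1) by (simp add: FR field_simps)
  qed
qed

lemma R_scaleC: "R (scaleC c x) = scaleC c (R x)"
  by (metis FR RF F_scaleC)

definition "u v = R (gs v - U (gs v))"

lemma V_u: "V v = v - 2 *\<^sub>R g (u v)"
  by (simp add: reduction_def u_def)

lemma bounded_linear_u: "bounded_linear u"
  unfolding u_def[abs_def]
  by (intro bounded_linear_compose[OF bounded_linear_R] bounded_linear_sub bl_gs bounded_linear_compose[OF UD(11) bl_gs])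

lemma u_scaleC: "u (scaleC c v) = scaleC c (u v)"
  by (simp add: u_def gs_scaleC UD(5) R_scaleC flip: scaleC_diff_right)

lemma u_eqI: "F x = gs v - U (gs v) \<Longrightarrow> u v = x"
  unfolding u_def by (metis RF)

text \<open>The only relation between \<open>v\<close> and \<open>u v\<close> that matters: it is symmetric under \<open>U \<mapsto> inv U\<close>, \<open>u \<mapsto> - u\<close>,
  which makes the reductions of \<open>U\<close> and \<open>inv U\<close> mutually inverse.\<close>
lemma u_eq: "U (gs (g (u v) - v) - u v) = gs (g (u v) - v) + u v"
proof -
  have "F (u v) = gs v - U (gs v)" by (simp add: u_def FR)
  then show ?thesis by (simp add: reduction_op_def UD gs_lin algebra_simps)
qed

text \<open>By \<open>u_eq\<close> the sum and difference of \<open>?m\<close> and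
  \<open>u v\<close> have equal norm, so the real part of their inner product is 0. This says
  \<open>(norm (g (u v)))^2 = Re (cinner v (g (u v)))\<close>, precisely the condition for
  \<open>v - 2 g (u v)\<close> to have the norm of \<open>v\<close>.\<close>

lemma norm_V: "norm (V v) = norm v"
proof -
  let ?m = "gs (g (u v) - v)"
  have "(norm (?m - u v))\<^sup>2 = (norm (?m + u v))\<^sup>2" using u_eq[of v] UD(6) by metis
  then have "Re (cinner ?m (u v)) = 0" by (simp add: norm_add_sq norm_diff_sq)
  then have "(norm (g (u v)))\<^sup>2 = Re (cinner v (g (u v)))" by (simp add: adjoint' cinner_diff_left Re_cinner_self)
  then have "(norm (V v))\<^sup>2 = (norm v)\<^sup>2"
    by (simp add: V_u norm_diff_sq cinner_scaleR_right power_mult_distrib)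
  then show ?thesis by (simp add: power2_eq_iff_nonneg)
qed

lemma admissible_inverse: "admissible (inv U) g gs"
proof
  have s: "surj (inv U)" using UD(9) bij_imp_bij_inv bij_is_surj by blast
  have UI: "U (inv U x) = x" "inv U (U x) = x" for x using UD(7,8) by (simp_all add: surj_f_inv_f)
  show "unitary (inv U)"
  proof (rule unitaryI[OF _ _ _ s])
    show "inv U (x + y) = inv U x + inv U y" for x y
      using UI(2)[of "inv U x + inv U y"] by (simp only: UD(1) UI(1))
    show "inv U (scaleC c x) = scaleC c (inv U x)" for c x
      using UI(2)[of "scaleC c (inv U x)"] by (simp only: UD(5) UI(1))
    show "norm (inv U x) = norm x" for x
      using UD(6)[of "inv U x"] by (simp only: UI(1))
  qed
  show "proper_on_bounded (\<lambda>x. inv U x + x)"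
    unfolding proper_on_bounded_def
  proof (intro allI impI)
    fix x :: "nat \<Rightarrow> 'h" assume x: "bounded (range x)" "convergent (\<lambda>n. inv U (x n) + x n)"
    \<comment> \<open>Applying \<open>U\<close> turns \<open>inv U + 1\<close> into
      \<open>1 + U\<close>, whose properness is given.\<close>
    have "convergent (\<lambda>n. U (inv U (x n) + x n))" by (rule convergent_bounded_linear[OF UD(11) x(2)])
    then have "convergent (\<lambda>n. U (x n) + x n)" by (simp add: UD(1) UI add.commute)
    then show "\<exists>r. strict_mono r \<and> convergent (\<lambda>n. x (r n))" using proper_U x(1) unfolding proper_on_bounded_def by blast
  qed
qed (use cbounded_g cbounded_gs adjoint inj_g in auto)

text \<open>If \<open>u'\<close> is the auxiliary vector of \<open>w\<close> for
  \<open>inv U\<close>, then \<open>- u'\<close> is that of \<open>I.V w\<close> for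
  \<open>U\<close>; so \<open>V\<close> adds back the term \<open>2 g u'\<close> that
  \<open>I.V\<close> subtracted.\<close>

lemma surj_V: "surj V"
proof -
  interpret I: admissible "inv U" g gs by (rule admissible_inverse)
  have UI: "U (inv U x) = x" for x using UD(7) by (simp add: surj_f_inv_f)
  have "V (I.V w) = w" for w
  proof -
    define u' where "u' = I.u w"
    have "inv U (gs (g u' - w) - u') = gs (g u' - w) + u'" unfolding u'_def by (rule I.u_eq)
    then have e: "gs (g u' - w) - u' = U (gs (g u' - w) + u')" using UI by metis
    have "u (I.V w) = - u'"
    proof (rule u_eqI)
      show "F (- u') = gs (I.V w) - U (gs (I.V w))"
        using e by (simp add: reduction_op_def I.V_u UD g_lin gs_lin scaleR_2 algebra_simps flip: u'_def)
    qed
    then show ?thesis by (simp add: V_u I.V_u g_lin flip: u'_def)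
  qed
  then show ?thesis by (metis surjI)
qed

lemma unitary_V: "unitary V"
proof (rule unitaryI[OF _ _ norm_V surj_V])
  show "V (x + y) = V x + V y" for x y
    by (simp add: V_u g_lin linear_add[OF bounded_linear.linear[OF bounded_linear_u]] algebra_simps)
  show "V (scaleC c x) = scaleC c (V x)" for c x
    by (simp add: V_u u_scaleC g_scaleC scaleC_diff_right scaleC_scaleR)
qed

text \<open>\<open>V v + v\<close> is twice \<open>q = v - g (u v)\<close>, and \<open>u_eq\<close>
  expresses \<open>(1 + U) (u v)\<close> through \<open>q\<close>. Convergence of \<open>q\<close>
  thus gives a convergent subsequence of \<open>u v\<close>, and \<open>v = q + g (u v)\<close>
  follows.\<close>

lemma proper_V: "proper_on_bounded (\<lambda>x. V x + x)"
  unfolding proper_on_bounded_def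
proof (intro allI impI)
  fix v :: "nat \<Rightarrow> 'h" assume v: "bounded (range v)" "convergent (\<lambda>n. V (v n) + v n)"
  define q where "q n = v n - g (u (v n))" for n
  have "V (v n) + v n = 2 *\<^sub>R q n" for n by (simp add: V_u q_def scaleR_2 algebra_simps)
  then have "(1/2) *\<^sub>R (V (v n) + v n) = q n" for n by simp
  then have q: "convergent q"
    using convergent_bounded_linear[OF bounded_linear_scaleR_right v(2), of "1/2"] by simp
  have "U (u (v n)) + u (v n) = gs (q n) - U (gs (q n))" for n
    using u_eq[of "v n"] by (simp add: q_def UD gs_lin algebra_simps)
  moreover have "convergent (\<lambda>n. gs (q n) - U (gs (q n)))"
    by (intro convergent_diff convergent_bounded_linear[OF bl_gs q] convergent_bounded_linear[OF UD(11)])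
  ultimately have "convergent (\<lambda>n. U (u (v n)) + u (v n))" by simp
  moreover have "bounded (range (\<lambda>n. u (v n)))" by (rule bounded_range_linear[OF bounded_linear_u v(1)])
  ultimately obtain r where r: "strict_mono (r::nat\<Rightarrow>nat)" "convergent (\<lambda>n. u (v (r n)))"
    using proper_U unfolding proper_on_bounded_def by blast
  have "convergent (\<lambda>n. q (r n) + g (u (v (r n))))"
    by (intro convergent_add convergent_subseq[OF q r(1)] convergent_bounded_linear[OF bl_g r(2)])
  then show "\<exists>r. strict_mono r \<and> convergent (\<lambda>n. v (r n))" using r(1) by (auto simp: q_def)
qed

text \<open>\<open>V - 1\<close> factors as \<open>2 g R (U - 1) gs\<close>, with bounded maps
  around \<open>U - 1\<close>.\<close>

lemma compact_V:
  assumes "seq_compact_map (\<lambda>x. U x - x)"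
  shows "seq_compact_map (\<lambda>x. V x - x)"
  unfolding seq_compact_map_def
proof (intro allI impI)
  fix v :: "nat \<Rightarrow> 'h" assume v: "bounded (range v)"
  obtain r where r: "strict_mono (r::nat\<Rightarrow>nat)" "convergent (\<lambda>n. U (gs (v (r n))) - gs (v (r n)))"
    using assms bounded_range_linear[OF bl_gs v] unfolding seq_compact_map_def by blast
  have "bounded_linear (\<lambda>x. 2 *\<^sub>R g (R x))"
    by (intro bounded_linear_compose[OF bounded_linear_scaleR_right] bounded_linear_compose[OF bl_g] bounded_linear_R)
  from convergent_bounded_linear[OF this r(2)]
  have "convergent (\<lambda>n. 2 *\<^sub>R g (R (U (gs (v (r n))) - gs (v (r n)))))" .
  moreover have "2 *\<^sub>R g (R (U (gs x) - gs x)) = V x - x" for x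
  proof -
    have "U (gs x) - gs x = - (gs x - U (gs x))" by simp
    then show ?thesis
      by (simp only: linear_neg[OF bounded_linear.linear[OF bounded_linear_R]] g_lin reduction_def) simp
  qed
  ultimately show "\<exists>r. strict_mono r \<and> convergent (\<lambda>n. V (v (r n)) - v (r n))" using r(1) by auto
qed

end

lemma reduction_id:
  assumes "unitary (U::'h::chilbert \<Rightarrow> 'h)"
  shows "reduction U (\<lambda>x. x) (\<lambda>x. x) = U"
proof
  fix v
  have F: "reduction_op U (\<lambda>x. x) (\<lambda>x. x) = (\<lambda>x. 2 *\<^sub>R x)"
    by (auto simp: reduction_op_def scaleR_2 unitaryD[OF assms])
  have "inv (\<lambda>x::'h. 2 *\<^sub>R x) y = (1/2) *\<^sub>R y" for y
    by (rule inv_f_eq) (auto simp: inj_on_def)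
  then show "reduction U (\<lambda>x. x) (\<lambda>x. x) v = U v" by (simp add: reduction_def F)
qed

text \<open>When \<open>gs\<close> is a left inverse of \<open>g\<close>, the operator
  \<open>reduction_op\<close> is multiplication by 2, so the inverse is explicit.\<close>

lemma reduction_isometry:
  assumes "unitary (U::'h::chilbert \<Rightarrow> 'h)" "\<And>x. gs (g x) = x" "bounded_linear g"
  shows "reduction U g gs v = v + g (U (gs v) - gs v)"
proof -
  have F: "reduction_op U g gs = (\<lambda>x. 2 *\<^sub>R x)"
    by (auto simp: reduction_op_def scaleR_2 unitaryD[OF assms(1)] assms(2))
  have "inv (\<lambda>x::'h. 2 *\<^sub>R x) y = (1/2) *\<^sub>R y" for y
    by (rule inv_f_eq) (auto simp: inj_on_def)
  then show ?thesis
    using linear_diff[OF bounded_linear.linear[OF assms(3)]]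
    by (simp add: reduction_def F linear_scale[OF bounded_linear.linear[OF assms(3)]])
qed

subsection \<open>Norm-continuous families\<close>

text \<open>Makes the limit calculus of bounded operators available. The filter \<open>atin\<close>
  omits the point \<open>w\<close>, where the operator difference is zero anyway.\<close>

lemma norm_cont_iff:
  assumes "\<And>w. w \<in> topspace X \<Longrightarrow> bounded_linear (f w :: 'h::chilbert \<Rightarrow> 'h)"
  shows "norm_cont X f \<longleftrightarrow> (\<forall>w\<in>topspace X. ((\<lambda>v. Blinfun (f v)) \<longlongrightarrow> Blinfun (f w)) (atin X w))"
proof -
  have d: "dist (Blinfun (f v)) (Blinfun (f w)) = onorm (\<lambda>x. f v x - f w x)"
    if "v \<in> topspace X" "w \<in> topspace X" for v w
    using assms[OF that(1)] assms[OF that(2)]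
    by (simp add: dist_norm norm_blinfun.rep_eq minus_blinfun.rep_eq bounded_linear_Blinfun_apply)
  have "((\<lambda>v. Blinfun (f v)) \<longlongrightarrow> Blinfun (f w)) (atin X w) \<longleftrightarrow>
      (\<forall>e>0. \<exists>N. openin X N \<and> w \<in> N \<and> (\<forall>v\<in>N. onorm (\<lambda>x. f v x - f w x) < e))" if w: "w \<in> topspace X" for w
  proof -
    have "(\<exists>N. openin X N \<and> w \<in> N \<and> (\<forall>v\<in>N - {w}. dist (Blinfun (f v)) (Blinfun (f w)) < e)) \<longleftrightarrow>
       (\<exists>N. openin X N \<and> w \<in> N \<and> (\<forall>v\<in>N. onorm (\<lambda>x. f v x - f w x) < e))" if e: "e > 0" for e
    proof -
      have "(\<forall>v\<in>N - {w}. dist (Blinfun (f v)) (Blinfun (f w)) < e) \<longleftrightarrow> (\<forall>v\<in>N. onorm (\<lambda>x. f v x - f w x) < e)"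
        if N: "openin X N" for N
      proof -
        have "N \<subseteq> topspace X" by (rule openin_subset[OF N])
        then have "(\<forall>v\<in>N. onorm (\<lambda>x. f v x - f w x) < e) \<longleftrightarrow> (\<forall>v\<in>N. dist (Blinfun (f v)) (Blinfun (f w)) < e)"
          using d[OF _ w] by (intro ball_cong) auto
        also have "\<dots> \<longleftrightarrow> (\<forall>v\<in>N - {w}. dist (Blinfun (f v)) (Blinfun (f w)) < e)" using e by auto
        finally show ?thesis ..
      qed
      then show ?thesis by meson
    qed
    then show ?thesis unfolding tendsto_iff eventually_atin using w by simp
  qed
  then show ?thesis by (simp add: norm_cont_def)
qed

lemma eventually_atin_topspace: "eventually (\<lambda>v. v \<in> topspace X) (atin X w)"
  unfolding eventually_atin by (metis openin_topspace DiffD1)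

lemma norm_contI:
  assumes "\<And>w. w \<in> topspace X \<Longrightarrow> bounded_linear (f w :: 'h::chilbert \<Rightarrow> 'h)"
    and eq: "\<And>w. w \<in> topspace X \<Longrightarrow> blinfun_apply (G w) = f w"
    and G: "\<And>w. w \<in> topspace X \<Longrightarrow> (G \<longlongrightarrow> G w) (atin X w)"
  shows "norm_cont X f"
proof -
  have e: "Blinfun (f w) = G w" if "w \<in> topspace X" for w
    using eq[OF that] by (metis blinfun_apply_inverse)
  have "((\<lambda>v. Blinfun (f v)) \<longlongrightarrow> Blinfun (f w)) (atin X w)" if w: "w \<in> topspace X" for w
    using G[OF w] eventually_mono[OF eventually_atin_topspace e]
    by (metis (mono_tags, lifting) e eventually_mono eventually_atin_topspace tendsto_cong w)
  then show ?thesis by (simp add: norm_cont_iff[OF assms(1)])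
qed

lemma norm_cont_compose:
  assumes f: "norm_cont X f" "\<And>w. w \<in> topspace X \<Longrightarrow> bounded_linear (f w :: 'h::chilbert \<Rightarrow> 'h)"
    and g: "norm_cont X g" "\<And>w. w \<in> topspace X \<Longrightarrow> bounded_linear (g w)"
  shows "norm_cont X (\<lambda>w x. f w (g w x))"
proof (rule norm_contI[where G = "\<lambda>w. Blinfun (f w) o\<^sub>L Blinfun (g w)"])
  show "((\<lambda>w. Blinfun (f w) o\<^sub>L Blinfun (g w)) \<longlongrightarrow> Blinfun (f w) o\<^sub>L Blinfun (g w)) (atin X w)" if "w \<in> topspace X" for w
    using f(1) g(1) that by (intro tendsto_intros) (auto simp: norm_cont_iff f(2) g(2))
qed (auto simp: f(2) g(2) bounded_linear_Blinfun_apply intro: bounded_linear_compose)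

lemma norm_cont_snd:
  assumes f: "norm_cont W f" "\<And>w. w \<in> topspace W \<Longrightarrow> bounded_linear (f w :: 'h::chilbert \<Rightarrow> 'h)"
  shows "norm_cont (prod_topology Y W) (\<lambda>p. f (snd p))"
  unfolding norm_cont_def
proof (intro ballI allI impI)
  fix p and e :: real assume p: "p \<in> topspace (prod_topology Y W)" and e: "e > 0"
  have "snd p \<in> topspace W" using p by (auto simp: topspace_prod_topology)
  then obtain N where N: "openin W N" "snd p \<in> N" "\<And>v. v \<in> N \<Longrightarrow> onorm (\<lambda>x. f v x - f (snd p) x) < e"
    using f(1) e unfolding norm_cont_def by meson
  have "openin (prod_topology Y W) (topspace Y \<times> N)" using N(1) by (simp add: openin_prod_Times_iff)
  then show "\<exists>N. openin (prod_topology Y W) N \<and> p \<in> N \<and> (\<forall>v\<in>N. onorm (\<lambda>x. f (snd v) x - f (snd p) x) < e)"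
    using N p by (intro exI[of _ "topspace Y \<times> N"]) (auto simp: topspace_prod_topology mem_Times_iff)
qed

text \<open>Resolvent-type identity: \<open>B v - B0\<close> is minus the product of
  \<open>B v\<close>, \<open>A v - A0\<close> and \<open>B0\<close>. Once \<open>A v\<close> is
  close enough to \<open>A0\<close>, the identity itself yields
  \<open>norm (B v) \<le> 2 * norm B0\<close>, so the difference is linear in
  \<open>A v - A0\<close>.\<close>

lemma tendsto_inverse_blinfun:
  fixes A :: "'a \<Rightarrow> 'b::real_normed_vector \<Rightarrow>\<^sub>L 'b"
  assumes A: "(A \<longlongrightarrow> A0) F"
    and B: "eventually (\<lambda>v. B v o\<^sub>L A v = id_blinfun) F"
    and B0: "A0 o\<^sub>L B0 = id_blinfun" and AB: "eventually (\<lambda>v. A v o\<^sub>L B v = id_blinfun) F"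
      "B0 o\<^sub>L A0 = id_blinfun"
  shows "(B \<longlongrightarrow> B0) F"
proof -
  have bc: "norm (P o\<^sub>L Q) \<le> norm P * norm Q" for P Q :: "'b \<Rightarrow>\<^sub>L 'b" by (rule norm_blinfun_compose)
  have "((\<lambda>v. norm (A v - A0)) \<longlongrightarrow> 0) F" using A tendsto_norm_zero LIM_zero by blast
  moreover have "1 / (2 * (norm B0 + 1)) > 0" by (simp add: add_nonneg_pos)
  ultimately have small: "eventually (\<lambda>v. norm (A v - A0) < 1 / (2 * (norm B0 + 1))) F"
    by (rule order_tendstoD(2))
  have ev: "eventually (\<lambda>v. norm (B v - B0) \<le> 2 * norm B0 * norm B0 * norm (A v - A0)) F"
    using small B
  proof eventually_elim
    case (elim v)
    have "B v - B0 = (B v o\<^sub>L (A0 o\<^sub>L B0)) - ((B v o\<^sub>L A v) o\<^sub>L B0)"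
      unfolding B0 elim(2) by (rule blinfun_eqI) (simp add: blinfun.bilinear_simps)
    also have "\<dots> = - (B v o\<^sub>L ((A v - A0) o\<^sub>L B0))"
      by (rule blinfun_eqI) (simp add: blinfun.bilinear_simps)
    finally have "norm (B v - B0) = norm (B v o\<^sub>L ((A v - A0) o\<^sub>L B0))" by simp
    also have "\<dots> \<le> norm (B v) * (norm (A v - A0) * norm B0)"
      by (rule order_trans[OF bc mult_left_mono[OF bc norm_ge_zero]])
    finally have d: "norm (B v - B0) \<le> norm (B v) * (norm (A v - A0) * norm B0)" .
    have "norm (A v - A0) * norm B0 \<le> 1 / (2 * (norm B0 + 1)) * norm B0"
      by (intro mult_right_mono less_imp_le[OF elim(1)] norm_ge_zero)
    also have "\<dots> \<le> 1/2" 
    proof -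
      have "b / (2 * (b + 1)) \<le> 1/2" if "b \<ge> 0" for b :: real using that by (simp add: field_simps)
      from this[of "norm B0"] show ?thesis by (simp only: norm_ge_zero times_divide_eq_left mult_1)
    qed
    finally have "norm (B v) * (norm (A v - A0) * norm B0) \<le> norm (B v) * (1/2)" by (intro mult_left_mono) auto
    moreover have "norm (B v) \<le> norm B0 + norm (B v - B0)" using norm_triangle_sub[of "B v" B0] by simp
    ultimately have "norm (B v) \<le> 2 * norm B0" using d by linarith
    then have "norm (B v) * (norm (A v - A0) * norm B0) \<le> 2 * norm B0 * (norm (A v - A0) * norm B0)"
      by (intro mult_right_mono) auto
    with d show ?case by (simp add: mult_ac)
  qed
  have "((\<lambda>v. 2 * norm B0 * norm B0 * norm (A v - A0)) \<longlongrightarrow> 2 * norm B0 * norm B0 * 0) F"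
    using A by (intro tendsto_mult tendsto_const tendsto_norm_zero LIM_zero)
  then have "((\<lambda>v. B v - B0) \<longlongrightarrow> 0) F" by (intro Lim_null_comparison[OF ev]) simp
  then show ?thesis by (rule LIM_zero_cancel)
qed

text \<open>\<open>F\<close> is a polynomial in the three families, its inverse is continuous by
  \<open>tendsto_inverse_blinfun\<close>, and the reduction is built from these by
  composition.\<close>

lemma norm_cont_reduction:
  assumes adm: "\<And>w. w \<in> topspace X \<Longrightarrow> admissible (U w) (g w) (gs w)"
    and U: "norm_cont X U" and g: "norm_cont X g" and gs: "norm_cont X gs"
  shows "norm_cont X (\<lambda>w. reduction (U w) (g w) (gs w))"
proof -
  have bl: "bounded_linear (U w)" "bounded_linear (g w)" "bounded_linear (gs w)" if "w \<in> topspace X" for w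
    using admissible.UD(11) admissible.bl_g admissible.bl_gs adm[OF that] by blast+
  note ap = bl[THEN bounded_linear_Blinfun_apply]
  define F where "F w = id_blinfun + (Blinfun (gs w) o\<^sub>L Blinfun (g w)) +
      (Blinfun (U w) o\<^sub>L (id_blinfun - (Blinfun (gs w) o\<^sub>L Blinfun (g w))))" for w
  define R where "R w = Blinfun (inv (reduction_op (U w) (g w) (gs w)))" for w
  have Fap: "blinfun_apply (F w) = reduction_op (U w) (g w) (gs w)" if "w \<in> topspace X" for w
    using ap[OF that] by (auto simp: F_def reduction_op_def blinfun.bilinear_simps)
  have Rap: "blinfun_apply (R w) = inv (reduction_op (U w) (g w) (gs w))" if "w \<in> topspace X" for w
    unfolding R_def by (rule bounded_linear_Blinfun_apply[OF admissible.bounded_linear_R[OF adm[OF that]]])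
  have FR: "F w o\<^sub>L R w = id_blinfun" "R w o\<^sub>L F w = id_blinfun" if "w \<in> topspace X" for w
    using that adm[OF that]
    by (auto intro!: blinfun_eqI simp: Fap Rap admissible.FR admissible.RF)
  have t: "((\<lambda>v. Blinfun (U v)) \<longlongrightarrow> Blinfun (U w)) (atin X w)" "((\<lambda>v. Blinfun (g v)) \<longlongrightarrow> Blinfun (g w)) (atin X w)"
    "((\<lambda>v. Blinfun (gs v)) \<longlongrightarrow> Blinfun (gs w)) (atin X w)" if "w \<in> topspace X" for w
    using U g gs that by (auto simp: norm_cont_iff bl)
  have Ft: "(F \<longlongrightarrow> F w) (atin X w)" if "w \<in> topspace X" for w
    unfolding F_def by (intro tendsto_intros t that)
  have Rt: "(R \<longlongrightarrow> R w) (atin X w)" if w: "w \<in> topspace X" for w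
    by (rule tendsto_inverse_blinfun[OF Ft[OF w]])
      (auto simp: FR w intro: eventually_mono[OF eventually_atin_topspace])
  show ?thesis
  proof (rule norm_contI[where G = "\<lambda>w. id_blinfun - 2 *\<^sub>R (Blinfun (g w) o\<^sub>L (R w o\<^sub>L
        (Blinfun (gs w) - (Blinfun (U w) o\<^sub>L Blinfun (gs w)))))"])
    fix w assume w: "w \<in> topspace X"
    show "bounded_linear (reduction (U w) (g w) (gs w))"
      by (rule unitaryD(11)[OF admissible.unitary_V[OF adm[OF w]]])
    show "blinfun_apply (id_blinfun - 2 *\<^sub>R (Blinfun (g w) o\<^sub>L (R w o\<^sub>L
        (Blinfun (gs w) - (Blinfun (U w) o\<^sub>L Blinfun (gs w)))))) = reduction (U w) (g w) (gs w)"
      using ap[OF w] Rap[OF w] by (auto simp: reduction_def blinfun.diff_left blinfun.scaleR_left)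
    show "((\<lambda>w. id_blinfun - 2 *\<^sub>R (Blinfun (g w) o\<^sub>L (R w o\<^sub>L
        (Blinfun (gs w) - (Blinfun (U w) o\<^sub>L Blinfun (gs w)))))) \<longlongrightarrow> id_blinfun - 2 *\<^sub>R (Blinfun (g w) o\<^sub>L (R w o\<^sub>L
        (Blinfun (gs w) - (Blinfun (U w) o\<^sub>L Blinfun (gs w)))))) (atin X w)"
      by (intro tendsto_intros t Rt w)
  qed
qed

text \<open>Eigenvectors of an isometry for distinct eigenvalues are orthogonal, so there are only countably many.\<close>
lemma exists_phase:
  assumes sep: "separable_hilbert TYPE('h::chilbert)"
    and S: "\<And>x y. cinner (S x) (S y) = cinner x (y::'h)"
      and sS: "\<And>c x. S (scaleC c x) = scaleC c (S x)"
  shows "\<exists>\<omega>. cmod \<omega> = 1 \<and> (\<forall>x. x + scaleC \<omega> (S x) = 0 \<longrightarrow> x = 0)"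
proof (rule ccontr)
  assume none: "\<not> ?thesis"
  have ex: "\<exists>x. norm x = 1 \<and> x + scaleC \<omega> (S x) = 0" if w: "cmod \<omega> = 1" for \<omega>
  proof -
    obtain x where x: "x + scaleC \<omega> (S x) = 0" "x \<noteq> 0" using none w by blast
    have "scaleC (of_real (1 / norm x)) (x + scaleC \<omega> (S x)) = 0" using x by simp
    then have "scaleC (of_real (1 / norm x)) x + scaleC \<omega> (S (scaleC (of_real (1 / norm x)) x)) = 0"
      by (simp add: sS scaleC_add_right scaleC_scaleC mult.commute)
    moreover have "norm (scaleC (of_real (1 / norm x)) x) = 1" using x(2) by (simp only: scaleC_of_real) simp
    ultimately show ?thesis by blast
  qed
  then obtain x where x: "\<And>\<omega>. cmod \<omega> = 1 \<Longrightarrow> norm (x \<omega>) = 1"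
      "\<And>\<omega>. cmod \<omega> = 1 \<Longrightarrow> x \<omega> + scaleC \<omega> (S (x \<omega>)) = 0" by metis
  have o: "cinner (x a) (x b) = 0" if a: "cmod a = 1" and b: "cmod b = 1" and ab: "a \<noteq> b" for a b
  proof -
    have "cinner (- scaleC a (S (x a))) (- scaleC b (S (x b))) = cnj a * b * cinner (x a) (x b)"
      by (simp add: cinner_simps S)
    moreover have "- scaleC a (S (x a)) = x a" "- scaleC b (S (x b)) = x b"
      using x(2)[OF a] x(2)[OF b] by (simp_all add: eq_neg_iff_add_eq_0 neg_eq_iff_add_eq_0 add.commute)
    \<comment> \<open>Since the eigenvector for phase \<open>a\<close> equals
      \<open>- scaleC a (S (x a))\<close>, isometry of \<open>S\<close> multiplies the inner product
      by \<open>cnj a * b\<close>, which differs from 1 for distinct phases.\<close>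
    ultimately have e: "cinner (x a) (x b) = cnj a * b * cinner (x a) (x b)" by simp
    have "cnj a * b \<noteq> 1"
    proof
      assume "cnj a * b = 1"
      then have "a * (cnj a * b) = a" by simp
      moreover have "a * cnj a = 1" using a complex_norm_square[of a] by simp
      ultimately show False using ab by (simp flip: mult.assoc)
    qed
    then show ?thesis using e by auto
  qed
  obtain D :: "'h set" where D: "countable D" "closure D = UNIV" using sep unfolding separable_hilbert_def by blast
  \<comment> \<open>Balls of radius 1/2 around orthonormal vectors are disjoint, so choosing a dense
    point in each would inject the uncountable unit circle into \<open>D\<close>.\<close>
  have "\<exists>d\<in>D. dist d (x \<omega>) < 1/2" for \<omega>
    using D(2) closure_approachable[of "x \<omega>" D] by (metis UNIV_I half_gt_zero_iff zero_less_one)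
  then obtain d where d: "\<And>\<omega>. d \<omega> \<in> D" "\<And>\<omega>. dist (d \<omega>) (x \<omega>) < 1/2" by metis
  have "inj_on d (sphere 0 1)"
  proof (rule inj_onI, rule ccontr)
    fix a b assume ab: "a \<in> sphere 0 1" "b \<in> sphere 0 1" "d a = d b" "a \<noteq> b"
    have "dist (x a) (x b) < 1" using d(2)[of a] d(2)[of b] ab(3) dist_triangle2[of "x a" "x b" "d a"]
      by (simp add: dist_commute)
    then have "(norm (x a - x b))\<^sup>2 < 1" by (simp add: dist_norm power_less_one_iff)
    moreover have "(norm (x a - x b))\<^sup>2 = 2" using o[of a b] x(1) ab by (simp add: norm_diff_sq)
    ultimately show False by simp
  qed
  moreover have "d ` sphere 0 1 \<subseteq> D" using d(1) by blast
  ultimately have "countable (sphere 0 1 :: complex set)"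
    using D(1) countable_image_inj_on countable_subset by blast
  moreover have "uncountable (sphere 0 1 :: complex set)"
    by (rule connected_uncountable[where a = "1::complex" and b = "- 1"]) (auto intro: connected_sphere)
  ultimately show False by blast
qed

subsection \<open>The homotopy\<close>

text \<open>\<open>P Q + 1\<close> is \<open>(P + 1) + P (Q - 1)\<close> and also
  \<open>(Q + 1) + (P - 1) Q\<close>: a compact perturbation of one proper factor, whichever of
  \<open>P - 1\<close> and \<open>Q - 1\<close> is compact.\<close>

lemma proper_unitary_product:
  assumes P: "unitary (P::'h::chilbert \<Rightarrow> 'h)" and Q: "unitary Q"
    and "proper_on_bounded (\<lambda>x. P x + x)" "proper_on_bounded (\<lambda>x. Q x + x)"
    and c: "seq_compact_map (\<lambda>x. Q x - x) \<or> seq_compact_map (\<lambda>x. P x - x)"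
  shows "proper_on_bounded (\<lambda>x. P (Q x) + x)"
  using c
proof
  assume K: "seq_compact_map (\<lambda>x. Q x - x)"
  have "seq_compact_map (\<lambda>x. P (Q x - x))"
    using K convergent_bounded_linear[OF unitaryD(11)[OF P]] unfolding seq_compact_map_def by metis
  from proper_on_bounded_add_compact[OF assms(3) this]
  show ?thesis by (simp add: unitaryD(2)[OF P] algebra_simps)
next
  assume K: "seq_compact_map (\<lambda>x. P x - x)"
  have "seq_compact_map (\<lambda>x. P (Q x) - Q x)"
    unfolding seq_compact_map_def
  proof (intro allI impI)
    fix x :: "nat \<Rightarrow> 'h" assume "bounded (range x)"
    then have "bounded (range (\<lambda>n. Q (x n)))" by (rule bounded_range_linear[OF unitaryD(11)[OF Q]])
    then show "\<exists>r. strict_mono r \<and> convergent (\<lambda>n. P (Q (x (r n))) - Q (x (r n)))"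
      using K unfolding seq_compact_map_def by blast
  qed
  from proper_on_bounded_add_compact[OF assms(4) this]
  show ?thesis by (simp add: algebra_simps)
qed

section \<open>Phase paths and the two isometries of a splitting\<close>

definition isometry_pair :: "('h::chilbert \<Rightarrow> 'h) \<Rightarrow> ('h \<Rightarrow> 'h) \<Rightarrow> bool" where
  "isometry_pair S Ss \<longleftrightarrow> cbounded S \<and> cbounded Ss \<and> (\<forall>x y. cinner (S x) y = cinner x (Ss y)) \<and> (\<forall>x. Ss (S x) = x)"

definition phase_path :: "complex \<Rightarrow> ('h::chilbert \<Rightarrow> 'h) \<Rightarrow> real \<Rightarrow> 'h \<Rightarrow> 'h" where
  "phase_path \<omega> S t x = (1 - t) *\<^sub>R x + t *\<^sub>R scaleC \<omega> (S x)"

lemma cbounded_phase_path: "cbounded S \<Longrightarrow> cbounded (phase_path \<omega> S t)"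
  unfolding cbounded_def phase_path_def[abs_def]
  by (auto simp: scaleC_add_right scaleC_scaleR scaleC_scaleC mult.commute intro!: bounded_linear_add bounded_linear_ident
      bounded_linear_compose[OF bounded_linear_scaleR_right] bounded_linear_compose[OF bounded_linear_scaleC])

lemma phase_path_0: "phase_path \<omega> S 0 = (\<lambda>x. x)"
  by (auto simp: phase_path_def)

lemma phase_path_1: "phase_path \<omega> S 1 = (\<lambda>x. scaleC \<omega> (S x))"
  by (auto simp: phase_path_def)

lemma isometry_pair_norm: "isometry_pair S Ss \<Longrightarrow> norm (S x) = norm (x::'h::chilbert)"
  by (simp add: isometry_pair_def norm_cinner)

text \<open>Comparing norms in the kernel equation gives
  \<open>(1 - t) * norm x = t * norm x\<close>, so a nonzero kernel vector can occur only at
  \<open>t = 1/2\<close>. There it would be an eigenvector of \<open>\<omega> S\<close> for the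
  eigenvalue -1, which the choice of the phase excludes.\<close>

lemma admissible_phase_path:
  assumes U: "unitary (U::'h::chilbert \<Rightarrow> 'h)" "proper_on_bounded (\<lambda>x. U x + x)"
    and S: "isometry_pair S Ss" and w: "cmod \<omega> = 1" "\<And>x. x + scaleC \<omega> (S x) = 0 \<Longrightarrow> x = 0"
    and t: "t \<in> {0..1}"
  shows "admissible U (phase_path \<omega> S t) (phase_path (cnj \<omega>) Ss t)"
proof
  show "cinner (phase_path \<omega> S t x) y = cinner x (phase_path (cnj \<omega>) Ss t y)" for x y
    using S by (simp add: phase_path_def isometry_pair_def cinner_simps)
  show "x = 0" if z: "phase_path \<omega> S t x = 0" for x
  proof -
    have e: "(1 - t) *\<^sub>R x = - (t *\<^sub>R scaleC \<omega> (S x))" using z by (simp add: phase_path_def eq_neg_iff_add_eq_0)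
    then have "norm ((1 - t) *\<^sub>R x) = norm (t *\<^sub>R scaleC \<omega> (S x))" by (metis norm_minus_cancel)
    then have "(1 - t) * norm x = t * norm x"
      using t by (simp add: norm_scaleC w(1) isometry_pair_norm[OF S])
    then have "(2 * t - 1) * norm x = 0" by (simp add: algebra_simps)
    then consider "t = 1/2" | "x = 0" by fastforce
    then show ?thesis
    proof cases
      case 1
      with e have "(1/2) *\<^sub>R (x + scaleC \<omega> (S x)) = 0" by (simp add: scaleR_add_right eq_neg_iff_add_eq_0)
      then have "x + scaleC \<omega> (S x) = 0" by simp
      then show ?thesis by (rule w(2))
    qed
  qed
qed (use U S cbounded_phase_path in \<open>auto simp: isometry_pair_def\<close>)

lemma norm_cont_phase_path:
  assumes "cbounded (S::'h::chilbert \<Rightarrow> 'h)"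
  shows "norm_cont (prod_topology (top_of_set {0..1}) W) (\<lambda>p. phase_path \<omega> S (fst p))"
proof (rule norm_contI[where G = "\<lambda>p. (1 - fst p) *\<^sub>R id_blinfun + fst p *\<^sub>R Blinfun (\<lambda>x. scaleC \<omega> (S x))"])
  let ?X = "prod_topology (top_of_set {0..1::real}) W"
  have bl: "bounded_linear (\<lambda>x. scaleC \<omega> (S x))"
    using assms by (auto simp: cbounded_def intro: bounded_linear_compose[OF bounded_linear_scaleC])
  show "bounded_linear (phase_path \<omega> S (fst p))" for p :: "real \<times> 'a"
    using cbounded_phase_path[OF assms] by (simp add: cbounded_def)
  show "blinfun_apply ((1 - fst p) *\<^sub>R id_blinfun + fst p *\<^sub>R Blinfun (\<lambda>x. scaleC \<omega> (S x))) = phase_path \<omega> S (fst p)"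
    for p :: "real \<times> 'a"
    by (auto simp: phase_path_def blinfun.bilinear_simps bounded_linear_Blinfun_apply[OF bl])
  fix p assume p: "p \<in> topspace ?X"
  have "continuous_map ?X euclidean fst"
    using continuous_map_fst[of "top_of_set {0..1::real}" W] continuous_map_into_fulltopology by blast
  then have "\<forall>x\<in>topspace ?X. limitin euclidean fst (fst x) (atin ?X x)" unfolding continuous_map_atin .
  from bspec[OF this p] have f: "(fst \<longlongrightarrow> fst p) (atin ?X p)" unfolding limitin_canonical_iff .
  show "((\<lambda>p. (1 - fst p) *\<^sub>R id_blinfun + fst p *\<^sub>R Blinfun (\<lambda>x. scaleC \<omega> (S x))) \<longlongrightarrow>
      (1 - fst p) *\<^sub>R id_blinfun + fst p *\<^sub>R Blinfun (\<lambda>x. scaleC \<omega> (S x))) (atin ?X p)"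
    by (intro tendsto_intros f)
qed

lemma hsplit_isometries:
  assumes "hsplit (\<Phi>::'h::chilbert \<Rightarrow> 'h \<times> 'h)"
  defines "S1 \<equiv> \<lambda>x. inv \<Phi> (x, 0)" and "S2 \<equiv> \<lambda>x. inv \<Phi> (0, x)"
  shows "isometry_pair S1 (\<lambda>x. fst (\<Phi> x))" "isometry_pair S2 (\<lambda>x. snd (\<Phi> x))"
    "snd (\<Phi> (S1 x)) = 0" "S1 (fst (\<Phi> x)) + S2 (snd (\<Phi> x)) = x" "dsum \<Phi> U V x = S1 (U (fst (\<Phi> x))) + S2 (V (snd (\<Phi> x)))"
proof -
  have h: "bij \<Phi>" "\<And>x y. \<Phi> (x + y) = \<Phi> x + \<Phi> y"
    "\<And>c x. \<Phi> (scaleC c x) = (scaleC c (fst (\<Phi> x)), scaleC c (snd (\<Phi> x)))"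
    "\<And>x y. cinner x y = cinner (fst (\<Phi> x)) (fst (\<Phi> y)) + cinner (snd (\<Phi> x)) (snd (\<Phi> y))"
    using assms(1) unfolding hsplit_def by blast+
  have i: "\<Phi> (inv \<Phi> p) = p" "inv \<Phi> (\<Phi> x) = x" for p x
    using h(1) by (simp_all add: bij_is_surj surj_f_inv_f bij_is_inj)
  have ia: "inv \<Phi> (p + q) = inv \<Phi> p + inv \<Phi> q" for p q
    using i(2)[of "inv \<Phi> p + inv \<Phi> q"] by (simp only: h(2) i(1))
  have isc: "inv \<Phi> (scaleC c a, scaleC c b) = scaleC c (inv \<Phi> (a,b))" for c a b
    using i(2)[of "scaleC c (inv \<Phi> (a,b))"] by (simp only: h(3) i(1) fst_conv snd_conv)
  have nrm: "(norm x)\<^sup>2 = (norm (fst (\<Phi> x)))\<^sup>2 + (norm (snd (\<Phi> x)))\<^sup>2" for x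
    using arg_cong[OF h(4)[of x x], of Re] by (simp add: Re_cinner_self)
  have cb: "cbounded L" if add: "\<And>x y. L (x + y) = L x + L y" and sc: "\<And>c x. L (scaleC c x) = scaleC c (L x)"
    and le: "\<And>x. (norm (L x))\<^sup>2 \<le> (norm x)\<^sup>2" for L :: "'h \<Rightarrow> 'h"
  proof -
    have "bounded_linear L"
    proof (rule bounded_linear_intro[of _ 1, OF add])
      show "L (r *\<^sub>R x) = r *\<^sub>R L x" for r x by (metis sc scaleC_of_real)
      show "norm (L x) \<le> norm x * 1" for x using le[of x] by (simp add: power2_le_iff_abs_le)
    qed
    then show ?thesis using sc by (simp add: cbounded_def)
  qed
  have cf: "cbounded (\<lambda>x. fst (\<Phi> x))"
  proof (rule cb)
    show "(norm (fst (\<Phi> x)))\<^sup>2 \<le> (norm x)\<^sup>2" for x unfolding nrm[of x] by simp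
  qed (simp_all add: h(2,3))
  have cs: "cbounded (\<lambda>x. snd (\<Phi> x))"
  proof (rule cb)
    show "(norm (snd (\<Phi> x)))\<^sup>2 \<le> (norm x)\<^sup>2" for x unfolding nrm[of x] by simp
  qed (simp_all add: h(2,3))
  have n2: "(norm (inv \<Phi> (a,b)))\<^sup>2 = (norm a)\<^sup>2 + (norm b)\<^sup>2" for a b using nrm[of "inv \<Phi> (a,b)"] by (simp add: i)
  have c1: "cbounded S1"
  proof (rule cb)
    show "S1 (x + y) = S1 x + S1 y" for x y using ia[of "(x,0)" "(y,0)"] by (simp add: S1_def)
    show "S1 (scaleC c x) = scaleC c (S1 x)" for c x using isc[of c x 0] by (simp add: S1_def)
    show "(norm (S1 x))\<^sup>2 \<le> (norm x)\<^sup>2" for x using n2[of x 0] by (simp add: S1_def)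
  qed
  have c2: "cbounded S2"
  proof (rule cb)
    show "S2 (x + y) = S2 x + S2 y" for x y using ia[of "(0,x)" "(0,y)"] by (simp add: S2_def)
    show "S2 (scaleC c x) = scaleC c (S2 x)" for c x using isc[of c 0 x] by (simp add: S2_def)
    show "(norm (S2 x))\<^sup>2 \<le> (norm x)\<^sup>2" for x using n2[of 0 x] by (simp add: S2_def)
  qed
  have "cinner (S1 x) y = cinner x (fst (\<Phi> y))" for x y using h(4)[of "inv \<Phi> (x,0)" y] by (simp add: S1_def i)
  then show "isometry_pair S1 (\<lambda>x. fst (\<Phi> x))" using cf c1 by (simp add: isometry_pair_def) (simp add: S1_def i)
  have "cinner (S2 x) y = cinner x (snd (\<Phi> y))" for x y using h(4)[of "inv \<Phi> (0,x)" y] by (simp add: S2_def i)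
  then show "isometry_pair S2 (\<lambda>x. snd (\<Phi> x))" using cs c2 by (simp add: isometry_pair_def) (simp add: S2_def i)
  show "snd (\<Phi> (S1 x)) = 0" by (simp add: S1_def i)
  show "S1 (fst (\<Phi> x)) + S2 (snd (\<Phi> x)) = x" by (simp add: S1_def S2_def i flip: ia)
  show "dsum \<Phi> U V x = S1 (U (fst (\<Phi> x))) + S2 (V (snd (\<Phi> x)))"
    by (simp add: S1_def S2_def dsum_def flip: ia)
qed

text \<open>The phase drops out at the endpoint because \<open>\<omega>\<close> and its conjugate
  enter once on each side of the complex linear \<open>U - 1\<close>.\<close>

lemma reduction_phase_path_1:
  assumes U: "unitary (U::'h::chilbert \<Rightarrow> 'h)" and S: "isometry_pair S Ss" and w: "cmod \<omega> = 1"
  shows "reduction U (phase_path \<omega> S 1) (phase_path (cnj \<omega>) Ss 1) v = v + S (U (Ss v) - Ss v)"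
proof -
  have ww: "\<omega> * cnj \<omega> = 1" "cnj \<omega> * \<omega> = 1" using w complex_norm_square[of \<omega>] by (simp_all add: mult.commute)
  have S': "cbounded S" "cbounded Ss" "\<And>x. Ss (S x) = x" using S by (auto simp: isometry_pair_def)
  have sc: "S (scaleC c x) = scaleC c (S x)" "Ss (scaleC c x) = scaleC c (Ss x)" for c x
    using S' by (auto simp: cbounded_def)
  have "reduction U (phase_path \<omega> S 1) (phase_path (cnj \<omega>) Ss 1) v =
      v + scaleC \<omega> (S (U (scaleC (cnj \<omega>) (Ss v)) - scaleC (cnj \<omega>) (Ss v)))"
    unfolding phase_path_1
    by (rule reduction_isometry[OF U])
      (use S' ww sc in \<open>auto simp: scaleC_scaleC cbounded_def intro!: bounded_linear_compose[OF bounded_linear_scaleC]\<close>)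
  also have "\<dots> = v + S (U (Ss v) - Ss v)"
    by (simp add: unitaryD(5)[OF U] sc(1) scaleC_scaleC ww flip: scaleC_diff_right)
  finally show ?thesis .
qed

text \<open>Both factors are reduced simultaneously, \<open>Q w\<close> towards \<open>S1\<close>
  and \<open>P w\<close> towards \<open>S2\<close>, and the results are multiplied. The phases
  depend on the isometries alone, so one path serves every \<open>w\<close>; the compact alternative
  survives along it by \<open>compact_V\<close>.\<close>

lemma ufred_homotopic_product:
  fixes P Q :: "'w \<Rightarrow> 'h::chilbert \<Rightarrow> 'h"
  assumes sep: "separable_hilbert TYPE('h)" and \<Phi>: "hsplit (\<Phi> :: 'h \<Rightarrow> 'h \<times> 'h)"
    and P: "\<And>w. w \<in> topspace W \<Longrightarrow> Ufred (P w)" "norm_cont W P"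
    and Q: "\<And>w. w \<in> topspace W \<Longrightarrow> Ufred (Q w)" "norm_cont W Q"
    and c: "(\<forall>w\<in>topspace W. seq_compact_map (\<lambda>x. Q w x - x)) \<or> (\<forall>w\<in>topspace W. seq_compact_map (\<lambda>x. P w x - x))"
  shows "ufred_homotopic W (\<lambda>w x. P w (Q w x)) (\<lambda>w. dsum \<Phi> (Q w) (P w))"
proof -
  have uP: "unitary (P w)" "proper_on_bounded (\<lambda>x. P w x + x)" and uQ: "unitary (Q w)" "proper_on_bounded (\<lambda>x. Q w x + x)"
    if "w \<in> topspace W" for w
    using P(1)[OF that] Q(1)[OF that] by (auto simp: Ufred_def ess_spec_iff_proper)
  define S1 where "S1 x = inv \<Phi> (x, 0)" for x
  define S2 where "S2 x = inv \<Phi> (0, x)" for x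
  define T1 where "T1 x = fst (\<Phi> x)" for x
  define T2 where "T2 x = snd (\<Phi> x)" for x
  have pair: "isometry_pair S1 T1" "isometry_pair S2 T2" and T2S1: "T2 (S1 x) = 0" and sum: "S1 (T1 x) + S2 (T2 x) = x"
    and ds: "dsum \<Phi> U V x = S1 (U (T1 x)) + S2 (V (T2 x))" for x U V
    unfolding S1_def[abs_def] S2_def[abs_def] T1_def[abs_def] T2_def[abs_def] by (rule hsplit_isometries[OF \<Phi>])+
  have "\<exists>\<omega>. cmod \<omega> = 1 \<and> (\<forall>x. x + scaleC \<omega> (S x) = 0 \<longrightarrow> x = 0)" if "isometry_pair S Ss" for S Ss :: "'h \<Rightarrow> 'h"
    by (rule exists_phase[OF sep]) (use that in \<open>auto simp: isometry_pair_def cbounded_def\<close>)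
  then obtain a b where a: "cmod a = 1" "\<And>x. x + scaleC a (S1 x) = 0 \<Longrightarrow> x = 0"
    and b: "cmod b = 1" "\<And>x. x + scaleC b (S2 x) = 0 \<Longrightarrow> x = 0" using pair by metis
  let ?X = "prod_topology (top_of_set {0..1::real}) W"
  define hQ where "hQ p = reduction (Q (snd p)) (phase_path a S1 (fst p)) (phase_path (cnj a) T1 (fst p))" for p
  define hP where "hP p = reduction (P (snd p)) (phase_path b S2 (fst p)) (phase_path (cnj b) T2 (fst p))" for p
  define h where "h p x = hP p (hQ p x)" for p x
  have tX: "p \<in> topspace ?X \<longleftrightarrow> fst p \<in> {0..1} \<and> snd p \<in> topspace W" for p
    by (auto simp: topspace_prod_topology mem_Times_iff)
  have adQ: "admissible (Q (snd p)) (phase_path a S1 (fst p)) (phase_path (cnj a) T1 (fst p))" if p: "p \<in> topspace ?X" for p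
  proof -
    have w: "snd p \<in> topspace W" "fst p \<in> {0..1}" using p unfolding tX by auto
    show ?thesis by (rule admissible_phase_path[OF uQ[OF w(1)] pair(1) a w(2)])
  qed
  have adP: "admissible (P (snd p)) (phase_path b S2 (fst p)) (phase_path (cnj b) T2 (fst p))" if p: "p \<in> topspace ?X" for p
  proof -
    have w: "snd p \<in> topspace W" "fst p \<in> {0..1}" using p unfolding tX by auto
    show ?thesis by (rule admissible_phase_path[OF uP[OF w(1)] pair(2) b w(2)])
  qed
  have cbd: "cbounded S1" "cbounded S2" "cbounded T1" "cbounded T2" using pair by (auto simp: isometry_pair_def)
  have "norm_cont ?X hQ" unfolding hQ_def[abs_def]
    by (rule norm_cont_reduction[OF adQ norm_cont_snd[OF Q(2) unitaryD(11)[OF uQ(1)]]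
          norm_cont_phase_path[OF cbd(1)] norm_cont_phase_path[OF cbd(3)]])
  moreover have "norm_cont ?X hP" unfolding hP_def[abs_def]
    by (rule norm_cont_reduction[OF adP norm_cont_snd[OF P(2) unitaryD(11)[OF uP(1)]]
          norm_cont_phase_path[OF cbd(2)] norm_cont_phase_path[OF cbd(4)]])
  moreover have u: "unitary (hQ p)" "unitary (hP p)" if "p \<in> topspace ?X" for p
    unfolding hQ_def hP_def using admissible.unitary_V adQ[OF that] adP[OF that] by blast+
  ultimately have cont: "norm_cont ?X h"
    unfolding h_def[abs_def] using norm_cont_compose[of ?X hP hQ] unitaryD(11) by blast
  have uf: "Ufred (h p)" if p: "p \<in> topspace ?X" for p
  proof -
    have "proper_on_bounded (\<lambda>x. hP p (hQ p x) + x)"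
    proof (rule proper_unitary_product[OF u(2,1)[OF p]])
      show "proper_on_bounded (\<lambda>x. hP p x + x)" "proper_on_bounded (\<lambda>x. hQ p x + x)"
        unfolding hQ_def hP_def using admissible.proper_V adQ[OF p] adP[OF p] by blast+
      have "seq_compact_map (\<lambda>x. Q (snd p) x - x) \<or> seq_compact_map (\<lambda>x. P (snd p) x - x)" using c p unfolding tX by blast
      then show "seq_compact_map (\<lambda>x. hQ p x - x) \<or> seq_compact_map (\<lambda>x. hP p x - x)"
        unfolding hQ_def hP_def using admissible.compact_V[OF adQ[OF p]] admissible.compact_V[OF adP[OF p]] by blast
    qed
    moreover have "unitary (h p)" unfolding h_def by (rule unitary_comp[OF u(2,1)[OF p]])
    ultimately show ?thesis by (simp add: Ufred_def ess_spec_iff_proper h_def)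
  qed
  have h0: "h (0,w) = (\<lambda>x. P w (Q w x))" if "w \<in> topspace W" for w
    using uP(1)[OF that] uQ(1)[OF that] by (auto simp: h_def hP_def hQ_def phase_path_0 reduction_id)
  have h1: "h (1,w) = dsum \<Phi> (Q w) (P w)" if w: "w \<in> topspace W" for w
  proof
    fix x
    have S: "S1 (y - z) = S1 y - S1 z" "S2 (y - z) = S2 y - S2 z" "T2 (y + z) = T2 y + T2 z" for y z
      using cbd linear_diff[OF bounded_linear.linear] linear_add[OF bounded_linear.linear] by (auto simp: cbounded_def)
    have q: "hQ (1,w) x = x + S1 (Q w (T1 x) - T1 x)"
      using reduction_phase_path_1[OF uQ(1)[OF w] pair(1) a(1)] by (simp add: hQ_def)
    \<comment> \<open>The two isometries have orthogonal ranges, so the endpoint of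
      \<open>hQ\<close> leaves the component seen by \<open>hP\<close> unchanged and the corrections
      simply add.\<close>
    then have "T2 (hQ (1,w) x) = T2 x" by (simp only: S(3) T2S1) simp
    then have "h (1,w) x = x + S1 (Q w (T1 x) - T1 x) + S2 (P w (T2 x) - T2 x)"
      using reduction_phase_path_1[OF uP(1)[OF w] pair(2) b(1)] by (simp add: h_def hP_def q)
    also have "\<dots> = x - (S1 (T1 x) + S2 (T2 x)) + (S1 (Q w (T1 x)) + S2 (P w (T2 x)))" by (simp add: S algebra_simps)
    also have "\<dots> = dsum \<Phi> (Q w) (P w) x" by (simp add: sum ds)
    finally show "h (1,w) x = dsum \<Phi> (Q w) (P w) x" .
  qed
  show ?thesis unfolding ufred_homotopic_def
    using cont uf h0 h1 tX by (intro exI[of _ h]) auto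
qed

section \<open>Transfer from unitary families to the operators \<open>A'\<close>\<close>

lemma norm_cont_cong:
  assumes f: "norm_cont X f" and eq: "\<And>w. w \<in> topspace X \<Longrightarrow> f w = f' w"
  shows "norm_cont X f'"
  unfolding norm_cont_def
proof (intro ballI allI impI)
  fix w and e :: real assume w: "w \<in> topspace X" and "e > 0"
  then obtain N where N: "openin X N" "w \<in> N" "\<forall>v\<in>N. onorm (\<lambda>x. f v x - f w x) < e"
    using f unfolding norm_cont_def by meson
  moreover have "f v = f' v" if "v \<in> N" for v using eq openin_subset[OF N(1)] that by blast
  ultimately show "\<exists>N. openin X N \<and> w \<in> N \<and> (\<forall>v\<in>N. onorm (\<lambda>x. f' v x - f' w x) < e)"
    using eq[OF w] by (intro exI[of _ N]) simp
qed

theorem theorem5p1: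
  fixes W :: "'w topology"
    and T A B :: "'w \<Rightarrow> ('h::chilbert \<times> 'h) set"
  assumes sep: "separable_hilbert TYPE('h)"
    and W_k: "k_space W" and W_para: "paracompact_space W"
    and T_sym: "\<forall>w\<in>topspace W. closed_dd_symmetric (T w)"
    and A_sa: "\<forall>w\<in>topspace W. is_op (A w) \<and> selfadjK UNIV (A w) \<and> T w \<subseteq> A w \<and> A w \<subseteq> adj (T w)"
    and A_cont: "norm_cont W (\<lambda>w. cay (A w))"
    and Km_cont: "norm_cont W (\<lambda>w. proj (Kminus (T w)))"
    and B_sa: "\<forall>w\<in>topspace W. selfadjK (Kminus (T w)) (B w) \<and> closed (B w)"
    and B_cont: "norm_cont W (\<lambda>w. cayH (Kminus (T w)) (B w))"
    and A_fred: "\<forall>w\<in>topspace W. fredK UNIV (A w)"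
    and B_fred: "\<forall>w\<in>topspace W. fredK (Kminus (T w)) (B w)"
    and cpt: "(\<forall>w\<in>topspace W. compact_resolventK UNIV (A w)) \<or>
              (\<forall>w\<in>topspace W. compact_resolventK (Kminus (T w)) (B w))"
  shows "(\<forall>w\<in>topspace W. is_op (Aprime (T w) (A w) (B w)) \<and>
             selfadjK UNIV (Aprime (T w) (A w) (B w)) \<and> fredK UNIV (Aprime (T w) (A w) (B w)))
       \<and> norm_cont W (\<lambda>w. cay (Aprime (T w) (A w) (B w)))
       \<and> (\<forall>\<Phi>. hsplit \<Phi> \<longrightarrow>
            ufred_homotopic W (\<lambda>w. cay (Aprime (T w) (A w) (B w)))
              (\<lambda>w. dsum \<Phi> (cay (A w)) (cayH (Kminus (T w)) (B w))))"
proof -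
  define P where "P w = cayH (Kminus (T w)) (B w)" for w
  define Q where "Q w = cay (A w)" for w
  have uP: "unitary (P w)" if "w \<in> topspace W" for w
    using unitary_cayH[OF closed_csubspace_Kminus, of "T w" "B w"] B_sa that by (simp add: P_def)
  have uQ: "unitary (Q w)" if "w \<in> topspace W" for w
    using unitary_cay[of "A w"] A_sa that by (simp add: Q_def)
  have fP: "- 1 \<notin> ess_spec (P w)" if "w \<in> topspace W" for w
    using that B_fred by (simp add: fredK_def P_def)
  have fQ: "- 1 \<notin> ess_spec (Q w)" if "w \<in> topspace W" for w
    using that A_fred by (simp add: fredK_def cayH_UNIV Q_def)
  have c: "(\<forall>w\<in>topspace W. seq_compact_map (\<lambda>x. Q w x - x)) \<or> (\<forall>w\<in>topspace W. seq_compact_map (\<lambda>x. P w x - x))"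
    using cpt compact_op_seq_compact unfolding compact_resolventK_def cayH_UNIV P_def Q_def by blast
  have uPQ: "unitary (\<lambda>x. P w (Q w x))" if "w \<in> topspace W" for w
    by (rule unitary_comp[OF uP[OF that] uQ[OF that]])
  \<comment> \<open>From here on every claim about \<open>A'\<close> is a claim about the product of
    \<open>P w\<close> and \<open>Q w\<close>, including its self-adjointness.\<close>
  have graph: "(v,y) \<in> cayley_graph (Aprime (T w) (A w) (B w)) \<longleftrightarrow> y = P w (Q w v)" if "w \<in> topspace W" for w v y
    unfolding P_def Q_def using that T_sym A_sa B_sa by (intro cayley_graph_Aprime) auto
  have sa: "selfadjK UNIV (Aprime (T w) (A w) (B w))" and ca: "cay (Aprime (T w) (A w) (B w)) = (\<lambda>x. P w (Q w x))"
    if "w \<in> topspace W" for w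
    using selfadj_of_unitary_cayley[OF uPQ[OF that] graph[OF that]] by auto
  \<comment> \<open>Single-valuedness is inherited from the adjoint of \<open>T w\<close>, of which
    the extension is a restriction.\<close>
  have op: "is_op (Aprime (T w) (A w) (B w))" if "w \<in> topspace W" for w
    using is_op_adj T_sym that unfolding is_op_def Aprime_def by fast
  have "proper_on_bounded (\<lambda>x. P w (Q w x) + x)" if w: "w \<in> topspace W" for w
    by (rule proper_unitary_product[OF uP[OF w] uQ[OF w]])
      (use fP[OF w] fQ[OF w] c w in \<open>auto simp: ess_spec_iff_proper uP uQ\<close>)
  then have fr: "fredK UNIV (Aprime (T w) (A w) (B w))" if "w \<in> topspace W" for w
    using that by (simp add: fredK_def cayH_UNIV ca ess_spec_iff_proper uPQ)
  have cP: "norm_cont W P" using B_cont by (simp add: P_def[abs_def])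
  have cQ: "norm_cont W Q" using A_cont by (simp add: Q_def[abs_def])
  have "norm_cont W (\<lambda>w x. P w (Q w x))"
    by (rule norm_cont_compose[OF cP unitaryD(11)[OF uP] cQ unitaryD(11)[OF uQ]])
  then have nc: "norm_cont W (\<lambda>w. cay (Aprime (T w) (A w) (B w)))" by (rule norm_cont_cong) (simp add: ca)
  have hom: "ufred_homotopic W (\<lambda>w. cay (Aprime (T w) (A w) (B w)))
      (\<lambda>w. dsum \<Phi> (cay (A w)) (cayH (Kminus (T w)) (B w)))" if \<Phi>: "hsplit \<Phi>" for \<Phi>
  proof -
    have "Ufred (P w)" "Ufred (Q w)" if "w \<in> topspace W" for w
      using uP[OF that] uQ[OF that] fP[OF that] fQ[OF that] by (simp_all add: Ufred_def)
    then have "ufred_homotopic W (\<lambda>w x. P w (Q w x)) (\<lambda>w. dsum \<Phi> (Q w) (P w))"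
      by (intro ufred_homotopic_product[OF sep \<Phi> _ cP _ cQ c])
    then show ?thesis unfolding ufred_homotopic_def by (simp add: ca P_def[symmetric] Q_def[symmetric])
  qed
  show ?thesis
    by (intro conjI ballI allI impI op sa fr nc hom)
qed

end
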